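(* Consider an electrical circuit whose modified nodal analysis (MNA) system in the unknowns $\varphi$ (nodal potentials), $i_L$ (inductor currents), $i_{V_s}$ and $i_{V_c}$ (currents through independent and controlled voltage sources) is \begin{align*} &A_C\tfrac{d}{dt}q_C(A_C^\top\varphi)+A_R\,g_R(A_R^\top\varphi,A_{CV}^\top\varphi,i_L,t)+A_L i_L+A_{V_s}i_{V_s}+A_{V_c}i_{V_c}+A_{I_s}i_s(t)+A_{I_c}i_c(A^\top\varphi,i_L,i_{V_c},t)=0,\\ &\tfrac{d}{dt}\phi_L(i_L)-A_L^\top\varphi=0,\\ &A_{V_s}^\top\varphi-v_s(t)=0,\\ &A_{V_c}^\top\varphi-v_c(A_{CV_s}^\top\varphi,i_L,t)=0, \end{align*} where $A_{I_c}=[A_{I_c,1},A_{I_c,2},A_{I_c,3},A_{I_c,4}]$ and $$i_c(A^\top\varphi,i_L,i_{V_c},t)=\begin{bmatrix} i_{c,1}(A^\top\varphi,i_L,i_{V_c},t)\\ i_{c,2}(A_{CRV}^\top\varphi,i_L,i_{V_c},t)\\ i_{c,3}(A_{CRV}^\top\varphi,i_L,t)\\ i_{c,4}(A_{CV}^\top\varphi,i_L,t)\end{bmatrix}.$$ Assume: (A) Well-posedness: the circuit is connected, not shorted and contains no self-loops; it contains no loop made up of only voltage sources; it contains no cutset made up of only current sources. (B) The Jacobians $C(x)=\partial q_C(x)/\partial x$, $L(x)=\partial\phi_L(x)/\partial x$ and $G(x,y)=\partial g_R(x,y)/\partial x$ are all positive definite (here $x$ is the first argument of $g_R$, i.e.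 the resistor voltages $A_R^\top\varphi$, and $y$ collects all its other arguments). (C) Controlled sources: (1) controlled voltage sources are not part of any $C$-$V$ loop; (2) every controlled current source described by $A_{I_c,1}$ has a $V_s$-only path between its terminals; (3) every controlled current source described by $A_{I_c,2}$ has a $C$-$V_s$-only path between its terminals; (4) every controlled current source described by $A_{I_c,3}$ has a $C$-$V$-only path between its terminals; (5) controlled current sources described by $A_{I_c,4}$ are not part of any $L$-$I$ cutset. Then this MNA system can be decoupled to a semi-explicit index one differential-algebraic equation using only basis matrices.
   Context: Circuit: a finite directed multigraph with a distinguished ground node, each branch being of exactly one type: capacitor ($C$), inductor ($L$), resistor ($R$), independent voltage source ($V_s$), controlled voltage source ($V_c$), independent current source ($I_s$), controlled current source ($I_c$). $V$ means $V_s$ or $V_c$, and $I$ means $I_s$ or $I_c$. Each controlled current source is assigned to exactly one of four groups, with incidence matrices $A_{I_c,1},\dots,A_{I_c,4}$. The topology is fixed in time. Incidence matrices: the unreduced incidence matrix has entry $+1$ if branch $j$ leaves node $i$, $-1$ if branch $j$ enters node $i$, and $0$ otherwise; the reduced incidence matrix $A$ is obtained by deleting the row of the ground node. $A_E$ denotes the columns of $A$ belonging to branches of type $E$. Groups are written as concatenations: $A_V=[A_{V_s},A_{V_c}]$, $A_{CV}=[A_C,A_V]$, $A_{CV_s}=[A_C,A_{V_s}]$, $A_{CRV}=[A_C,A_R,A_V]$; in $A^\top\varphi$, $A$ contains all branches. A $C$-$V$ loop is a loop made up of only capacitors or voltage sources (inclusive or). An $L$-$I$ cutset is a cutset made up of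 only inductors or current sources. An $X$-only path is a path all of whose branches are of the listed types. The functions $q_C,\phi_L,g_R$ describe capacitors, inductors and resistors (multiport elements are allowed), $v_c,i_c$ describe controlled sources and $v_s(t),i_s(t)$ independent sources; all are taken to be continuously differentiable. Positive definite means $x^\top Mx>0$ for all $x\neq0$ (symmetry not required). Regular means invertible. Basis matrices: for a matrix $M^\top\in\mathbb{R}^{b\times n}$, basis matrices $P,Q,V,W$ of $M^\top$ are matrices with $\operatorname{im}Q=\ker M^\top$, $\operatorname{im}W=\ker M$, such that the columns of $[P,Q]$ form a basis of $\mathbb{R}^n$ and the columns of $[V,W]$ form a basis of $\mathbb{R}^b$. Semi-explicit index one DAE: a system $\frac{d}{dt}x=f(x,y,t)$, $0=g(x,y,t)$ such that the Jacobian of $g$ with respect to $y$ is regular; $x$ are the differential and $y$ the algebraic variables. "Decoupled to a semi-explicit index one DAE using only basis matrices" means the following. By successive splittings of variables of the form $u=P\tilde u+Q\bar u$ (for nodal potentials) or $u=V\tilde u+W\bar u$ (for inductor currents), where the matrices used are basis matrices of transposed incidence matrices $A_E^\top$ or of products of such a matrix with previously obtained matrices $Q$, the unknowns $(\varphi,i_L,i_{V_s},i_{V_c})$ are replaced, via an invertible linear change of variables, by new unknowns $(x,y,z)$. By successively multiplying the equations from the left with $P^\top,Q^\top$ (resp. $V^\top,W^\top$) of these basis matrices and then resolving the total time derivatives, substituting the time derivatives of those variables that are purely time-dependent and solving for $\frac{d}{dt}x$, the MNA system is transformed into an equivalent system (same continuously differentiable solutions, up to the change of variables) consisting of a semi-explicit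 index one DAE $\frac{d}{dt}x=f(x,y,t)$, $0=g(x,y,t)$ together with a system $h(x',y',x,y,z,t)=0$ which is uniquely solvable for the output variables $z$; the variables $z$ do not appear in $f$ and $g$. *)

theory Defs
  imports "HOL-Analysis.Analysis"
begin

section \<open>Coordinate spaces and blocks of matrices\<close>

text \<open>
  Most dimensions below (numbers of branches of a type, ranks) depend on the circuit and may be 0,
  so they are not types.  The space \<open>\<real>\<^sup>I\<close> for a subset \<open>I\<close> of a finite index type is the coordinate
  subspace of the vectors vanishing outside \<open>I\<close>, and a matrix whose rows are indexed by \<open>I\<close> and whose
  columns are indexed by \<open>J\<close> is padded with zeros.  The concatenation \<open>[P, Q]\<close> of two padded matrices
  with disjoint sets of column indices is then \<open>P + Q\<close>.
\<close>

definition coord_space :: "'k set \<Rightarrow> (real^'k::finite) set" where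
  "coord_space I = {v. \<forall>i. i \<notin> I \<longrightarrow> v $ i = 0}"

definition restr :: "'k set \<Rightarrow> real^'k::finite \<Rightarrow> real^'k" where
  "restr I v = (\<chi> i. if i \<in> I then v $ i else 0)"

definition block :: "'r set \<Rightarrow> 'c set \<Rightarrow> real^'c::finite^'r::finite \<Rightarrow> real^'c^'r" where
  "block I J M = (\<chi> i j. if i \<in> I \<and> j \<in> J then M $ i $ j else 0)"

definition id_block :: "'k set \<Rightarrow> real^'k::finite^'k" where
  "id_block I = block I I (mat 1)"

definition regular_block :: "'r set \<Rightarrow> 'c set \<Rightarrow> real^'c::finite^'r::finite \<Rightarrow> bool" where
  "regular_block I J M \<longleftrightarrow>
     (\<exists>M'. block I J M ** block J I M' = id_block I \<and> block J I M' ** block I J M = id_block J)"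

definition pos_def_block :: "'k set \<Rightarrow> real^'k::finite^'k \<Rightarrow> bool" where
  "pos_def_block I M \<longleftrightarrow> (\<forall>x \<in> coord_space I. x \<noteq> 0 \<longrightarrow> x \<bullet> (M *v x) > 0)"

definition cont_diff :: "('a::real_normed_vector \<Rightarrow> 'b::real_normed_vector) \<Rightarrow> bool" where
  "cont_diff f \<longleftrightarrow>
     (\<exists>f'. (\<forall>x. (f has_derivative blinfun_apply (f' x)) (at x)) \<and> continuous_on UNIV f')"

section \<open>Basis matrices\<close>

text \<open>
  For \<open>M\<close> with column indices \<open>I\<close>: \<open>im Q = ker M\<close> and the columns of \<open>[P, Q]\<close> form a basis of \<open>\<real>\<^sup>I\<close>.
  As \<open>[P, Q]\<close> is square, its columns can be indexed by \<open>I\<close>; \<open>J\<close> indexes the columns of \<open>P\<close>.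
\<close>

definition kernel_splitting ::
  "'k set \<Rightarrow> real^'k::finite^'m::finite \<Rightarrow> 'k set \<Rightarrow> real^'k^'k \<Rightarrow> real^'k^'k \<Rightarrow> bool" where
  "kernel_splitting I M J P Q \<longleftrightarrow>
     J \<subseteq> I \<and>
     (\<forall>j. j \<notin> J \<longrightarrow> column j P = 0) \<and>
     (\<forall>j. j \<notin> I - J \<longrightarrow> column j Q = 0) \<and>
     range ((*v) Q) = {v \<in> coord_space I. M *v v = 0} \<and>
     inj_on (\<lambda>j. column j (P + Q)) I \<and>
     independent ((\<lambda>j. column j (P + Q)) ` I) \<and>
     span ((\<lambda>j. column j (P + Q)) ` I) = coord_space I"

text \<open>Basis matrices \<open>P, Q, V, W\<close> of \<open>MT\<close>, which has row indices \<open>I'\<close> and column indices \<open>I\<close>.\<close>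

definition basis_matrices ::
  "'b set \<Rightarrow> 'n set \<Rightarrow> real^'n::finite^'b::finite \<Rightarrow>
   'n set \<Rightarrow> real^'n^'n \<Rightarrow> real^'n^'n \<Rightarrow> 'b set \<Rightarrow> real^'b^'b \<Rightarrow> real^'b^'b \<Rightarrow> bool" where
  "basis_matrices I' I MT J P Q J' V W \<longleftrightarrow>
     kernel_splitting I MT J P Q \<and> kernel_splitting I' (transpose MT) J' V W"

section \<open>Circuits\<close>

datatype kind = Cap | Ind | Res | Vs | Vc | Is | Ic1 | Ic2 | Ic3 | Ic4

definition V_kinds :: "kind set" where "V_kinds = {Vs, Vc}"
definition I_kinds :: "kind set" where "I_kinds = {Is, Ic1, Ic2, Ic3, Ic4}"

text \<open>
  The nodes are the elements of \<open>'n option\<close>; \<open>None\<close> is the ground node.  A branch leaves its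
  \<open>tail\<close> and enters its \<open>head\<close>.
\<close>

record ('n, 'b) circuit =
  tail :: "'b \<Rightarrow> 'n option"
  head :: "'b \<Rightarrow> 'n option"
  kind_of :: "'b \<Rightarrow> kind"

definition branches :: "('n, 'b, 'z) circuit_scheme \<Rightarrow> kind set \<Rightarrow> 'b set" where
  "branches c K = {b. kind_of c b \<in> K}"

definition incidence :: "('n::finite, 'b::finite, 'z) circuit_scheme \<Rightarrow> real^'b^('n option)" where
  "incidence c = (\<chi> i j. (if tail c j = i then 1 else 0) - (if head c j = i then 1 else 0))"

definition inc :: "('n::finite, 'b::finite, 'z) circuit_scheme \<Rightarrow> kind set \<Rightarrow> real^'b^'n" where
  "inc c K = block UNIV (branches c K) (\<chi> i. incidence c $ Some i)"

subsection \<open>Paths, loops and cutsets\<close>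

definition joins :: "('n, 'b, 'z) circuit_scheme \<Rightarrow> 'b \<Rightarrow> 'n option \<Rightarrow> 'n option \<Rightarrow> bool" where
  "joins c b u v \<longleftrightarrow> (tail c b = u \<and> head c b = v) \<or> (tail c b = v \<and> head c b = u)"

definition is_path :: "('n, 'b, 'z) circuit_scheme \<Rightarrow> 'n option list \<Rightarrow> 'b list \<Rightarrow> bool" where
  "is_path c us bs \<longleftrightarrow>
     length us = Suc (length bs) \<and> distinct us \<and>
     (\<forall>i < length bs. joins c (bs ! i) (us ! i) (us ! Suc i))"

definition has_path ::
  "('n, 'b, 'z) circuit_scheme \<Rightarrow> 'b set \<Rightarrow> 'n option \<Rightarrow> 'n option \<Rightarrow> bool" where
  "has_path c E u v \<longleftrightarrow>
     (\<exists>us bs. is_path c us bs \<and> hd us = u \<and> last us = v \<and> set bs \<subseteq> E)"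

definition is_loop :: "('n, 'b, 'z) circuit_scheme \<Rightarrow> 'n option list \<Rightarrow> 'b list \<Rightarrow> bool" where
  "is_loop c us bs \<longleftrightarrow>
     bs \<noteq> [] \<and> length us = length bs \<and> distinct us \<and> distinct bs \<and>
     (\<forall>i < length bs. joins c (bs ! i) (us ! i) (us ! (Suc i mod length bs)))"

definition loop_set :: "('n, 'b, 'z) circuit_scheme \<Rightarrow> 'b set \<Rightarrow> bool" where
  "loop_set c B \<longleftrightarrow> (\<exists>us bs. is_loop c us bs \<and> B = set bs)"

definition connected_via :: "('n, 'b, 'z) circuit_scheme \<Rightarrow> 'b set \<Rightarrow> bool" where
  "connected_via c E \<longleftrightarrow> (\<forall>u v. has_path c E u v)"

definition cutset :: "('n, 'b, 'z) circuit_scheme \<Rightarrow> 'b set \<Rightarrow> bool" where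
  "cutset c B \<longleftrightarrow> \<not> connected_via c (- B) \<and> (\<forall>B'. B' \<subset> B \<longrightarrow> connected_via c (- B'))"

text \<open>
  No separate condition expresses that the circuit is not shorted: there are at least two nodes
  (ground and an element of \<open>'n\<close>), and no branch has its two terminals identified.
\<close>

definition well_posed :: "('n, 'b, 'z) circuit_scheme \<Rightarrow> bool" where
  "well_posed c \<longleftrightarrow>
     connected_via c UNIV \<and>
     (\<forall>b. tail c b \<noteq> head c b) \<and>
     (\<forall>B. loop_set c B \<longrightarrow> \<not> B \<subseteq> branches c V_kinds) \<and>
     (\<forall>B. cutset c B \<longrightarrow> \<not> B \<subseteq> branches c I_kinds)"

definition admissible_controlled_sources :: "('n, 'b, 'z) circuit_scheme \<Rightarrow> bool" where
  "admissible_controlled_sources c \<longleftrightarrow>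
     (\<forall>b \<in> branches c {Vc}. \<forall>B. loop_set c B \<and> B \<subseteq> branches c ({Cap} \<union> V_kinds) \<longrightarrow> b \<notin> B) \<and>
     (\<forall>b \<in> branches c {Ic1}. has_path c (branches c {Vs}) (tail c b) (head c b)) \<and>
     (\<forall>b \<in> branches c {Ic2}. has_path c (branches c {Cap, Vs}) (tail c b) (head c b)) \<and>
     (\<forall>b \<in> branches c {Ic3}. has_path c (branches c ({Cap} \<union> V_kinds)) (tail c b) (head c b)) \<and>
     (\<forall>b \<in> branches c {Ic4}. \<forall>B. cutset c B \<and> B \<subseteq> branches c ({Ind} \<union> I_kinds) \<longrightarrow> b \<notin> B)"

section \<open>Modified nodal analysis\<close>

text \<open>
  Each function stands for a function between the corresponding coordinate spaces: only its values
  at padded vectors, and only the components belonging to the branches it describes, are used.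
\<close>

record ('n, 'b::finite) network = "('n, 'b) circuit" +
  q_C :: "real^'b \<Rightarrow> real^'b"
  phi_L :: "real^'b \<Rightarrow> real^'b"
  g_R :: "real^'b \<Rightarrow> real^'b \<Rightarrow> real^'b \<Rightarrow> real \<Rightarrow> real^'b"
  v_s :: "real \<Rightarrow> real^'b"
  v_c :: "real^'b \<Rightarrow> real^'b \<Rightarrow> real \<Rightarrow> real^'b"
  i_s :: "real \<Rightarrow> real^'b"
  i_c1 :: "real^'b \<Rightarrow> real^'b \<Rightarrow> real^'b \<Rightarrow> real \<Rightarrow> real^'b"
  i_c2 :: "real^'b \<Rightarrow> real^'b \<Rightarrow> real^'b \<Rightarrow> real \<Rightarrow> real^'b"
  i_c3 :: "real^'b \<Rightarrow> real^'b \<Rightarrow> real \<Rightarrow> real^'b"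
  i_c4 :: "real^'b \<Rightarrow> real^'b \<Rightarrow> real \<Rightarrow> real^'b"

definition smooth_elements :: "('n::finite, 'b::finite) network \<Rightarrow> bool" where
  "smooth_elements N \<longleftrightarrow>
     cont_diff (q_C N) \<and> cont_diff (phi_L N) \<and>
     cont_diff (\<lambda>(v, w, i, t). g_R N v w i t) \<and>
     cont_diff (v_s N) \<and> cont_diff (i_s N) \<and>
     cont_diff (\<lambda>(v, i, t). v_c N v i t) \<and>
     cont_diff (\<lambda>(v, i, j, t). i_c1 N v i j t) \<and>
     cont_diff (\<lambda>(v, i, j, t). i_c2 N v i j t) \<and>
     cont_diff (\<lambda>(v, i, t). i_c3 N v i t) \<and>
     cont_diff (\<lambda>(v, i, t). i_c4 N v i t)"

definition passive_elements :: "('n::finite, 'b::finite) network \<Rightarrow> bool" where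
  "passive_elements N \<longleftrightarrow>
     (\<forall>v \<in> coord_space (branches N {Cap}).
        pos_def_block (branches N {Cap}) (jacobian (q_C N) (at v))) \<and>
     (\<forall>i \<in> coord_space (branches N {Ind}).
        pos_def_block (branches N {Ind}) (jacobian (phi_L N) (at i))) \<and>
     (\<forall>v \<in> coord_space (branches N {Res}). \<forall>w \<in> coord_space (branches N ({Cap} \<union> V_kinds)).
      \<forall>i \<in> coord_space (branches N {Ind}). \<forall>t.
        pos_def_block (branches N {Res}) (jacobian (\<lambda>v. g_R N v w i t) (at v)))"

definition volt :: "('n::finite, 'b::finite) network \<Rightarrow> kind set \<Rightarrow> real^'n \<Rightarrow> real^'b" where
  "volt N K \<phi> = transpose (inc N K) *v \<phi>"

text \<open>Kirchhoff's current law without the capacitive term.\<close>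

definition static_currents ::
  "('n::finite, 'b::finite) network \<Rightarrow> real^'n \<Rightarrow> real^'b \<Rightarrow> real^'b \<Rightarrow> real^'b \<Rightarrow> real \<Rightarrow> real^'n" where
  "static_currents N \<phi> iL iVs iVc t =
     inc N {Res} *v g_R N (volt N {Res} \<phi>) (volt N ({Cap} \<union> V_kinds) \<phi>) iL t +
     inc N {Ind} *v iL + inc N {Vs} *v iVs + inc N {Vc} *v iVc +
     inc N {Is} *v i_s N t +
     inc N {Ic1} *v i_c1 N (volt N UNIV \<phi>) iL iVc t +
     inc N {Ic2} *v i_c2 N (volt N ({Cap, Res} \<union> V_kinds) \<phi>) iL iVc t +
     inc N {Ic3} *v i_c3 N (volt N ({Cap, Res} \<union> V_kinds) \<phi>) iL t +
     inc N {Ic4} *v i_c4 N (volt N ({Cap} \<union> V_kinds) \<phi>) iL t"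

definition vs_residual :: "('n::finite, 'b::finite) network \<Rightarrow> real^'n \<Rightarrow> real \<Rightarrow> real^'b" where
  "vs_residual N \<phi> t = volt N {Vs} \<phi> - restr (branches N {Vs}) (v_s N t)"

definition vc_residual ::
  "('n::finite, 'b::finite) network \<Rightarrow> real^'n \<Rightarrow> real^'b \<Rightarrow> real \<Rightarrow> real^'b" where
  "vc_residual N \<phi> iL t =
     volt N {Vc} \<phi> - restr (branches N {Vc}) (v_c N (volt N {Cap, Vs} \<phi>) iL t)"

definition C1_curve ::
  "real set \<Rightarrow> (real \<Rightarrow> 'a::real_normed_vector) \<Rightarrow> (real \<Rightarrow> 'a) \<Rightarrow> bool" where
  "C1_curve T u u' \<longleftrightarrow>
     (\<forall>t \<in> T. (u has_vector_derivative u' t) (at t within T)) \<and> continuous_on T u'"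

definition mna_space ::
  "('n::finite, 'b::finite) network \<Rightarrow> ((real^'n) \<times> (real^'b) \<times> (real^'b) \<times> (real^'b)) set" where
  "mna_space N =
     UNIV \<times> coord_space (branches N {Ind}) \<times> coord_space (branches N {Vs}) \<times>
     coord_space (branches N {Vc})"

definition mna_solution ::
  "('n::finite, 'b::finite) network \<Rightarrow> real set \<Rightarrow>
   (real \<Rightarrow> (real^'n) \<times> (real^'b) \<times> (real^'b) \<times> (real^'b)) \<Rightarrow> bool" where
  "mna_solution N T u \<longleftrightarrow>
     (\<forall>t \<in> T. u t \<in> mna_space N) \<and> (\<exists>u'. C1_curve T u u') \<and>
     (\<forall>t \<in> T. case u t of (\<phi>, iL, iVs, iVc) \<Rightarrow>
        (\<exists>dq. ((\<lambda>s. q_C N (volt N {Cap} (fst (u s)))) has_vector_derivative dq) (at t within T) \<and>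
              inc N {Cap} *v dq + static_currents N \<phi> iL iVs iVc t = 0) \<and>
        (\<exists>d\<phi>. ((\<lambda>s. phi_L N (fst (snd (u s)))) has_vector_derivative d\<phi>) (at t within T) \<and>
              restr (branches N {Ind}) d\<phi> - volt N {Ind} \<phi> = 0) \<and>
        vs_residual N \<phi> t = 0 \<and>
        vc_residual N \<phi> iL t = 0)"

section \<open>Decoupling by basis matrices\<close>

text \<open>
  \<open>splitting c Bs S I Q Ls TL\<close>: successive splittings have led to \<open>\<phi> = [S, Q] \<phi>'\<close> and
  \<open>i\<^sub>L = TL i\<^sub>L'\<close>.  Here \<open>Q\<close> is the product of the matrices \<open>Q\<close> obtained so far, with column
  indices \<open>I\<close>; the columns of \<open>S\<close> are those of the split-off products with a matrix \<open>P\<close>, whose sets of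
  column indices are the elements of \<open>Bs\<close>; and \<open>Ls\<close> contains the sets of column indices of the blocks
  of \<open>TL\<close>, which is the identity or \<open>[V, W]\<close>.
\<close>

inductive splitting ::
  "('n::finite, 'b::finite, 'z) circuit_scheme \<Rightarrow> 'n set set \<Rightarrow> real^'n^'n \<Rightarrow> 'n set \<Rightarrow> real^'n^'n \<Rightarrow>
   'b set set \<Rightarrow> real^'b^'b \<Rightarrow> bool"
  for c where
  start: "splitting c {} 0 UNIV (mat 1) {branches c {Ind}} (id_block (branches c {Ind}))"
| potentials:
    "splitting c Bs S I Q Ls TL \<Longrightarrow>
     basis_matrices (branches c K) I (transpose (inc c K) ** Q) J P Q' J' V W \<Longrightarrow>
     splitting c (insert J Bs) (S + Q ** P) (I - J) (Q ** Q') Ls TL"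
| currents:
    "splitting c Bs S I Q {branches c {Ind}} (id_block (branches c {Ind})) \<Longrightarrow>
     basis_matrices (branches c {Ind}) I (transpose (inc c {Ind}) ** Q) J P Q' J' V W \<Longrightarrow>
     splitting c Bs S I Q {J', branches c {Ind} - J'} (V + W)"

text \<open>
  The new unknowns, and likewise the projected equations, are collected in vectors indexed by
  \<open>'n + 'b\<close>: \<open>Inl\<close> for potentials (Kirchhoff's current law), \<open>Inr\<close> for currents of inductors and
  voltage sources (equations of these elements).
\<close>

definition nodal_part :: "real^('n::finite + 'b::finite) \<Rightarrow> real^'n" where
  "nodal_part w = (\<chi> i. w $ Inl i)"

definition branch_part :: "real^('n::finite + 'b::finite) \<Rightarrow> real^'b" where
  "branch_part w = (\<chi> b. w $ Inr b)"

definition mna_unknowns ::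
  "('n::finite, 'b::finite) network \<Rightarrow> real^'n^'n \<Rightarrow> real^'b^'b \<Rightarrow> real^('n + 'b) \<Rightarrow>
   (real^'n) \<times> (real^'b) \<times> (real^'b) \<times> (real^'b)" where
  "mna_unknowns N TN TL w =
     (TN *v nodal_part w, TL *v branch_part w,
      restr (branches N {Vs}) (branch_part w), restr (branches N {Vc}) (branch_part w))"

definition variable_blocks ::
  "('n, 'b, 'z) circuit_scheme \<Rightarrow> 'n set set \<Rightarrow> 'n set \<Rightarrow> 'b set set \<Rightarrow> ('n + 'b) set set" where
  "variable_blocks c Bs I Ls =
     (`) Inl ` (insert I Bs) \<union> (`) Inr ` (Ls \<union> {branches c {Vs}, branches c {Vc}})"

definition groups_blocks :: "'k set set \<Rightarrow> 'k set \<Rightarrow> 'k set \<Rightarrow> 'k set \<Rightarrow> bool" where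
  "groups_blocks Bs X Y Z \<longleftrightarrow>
     X \<union> Y \<union> Z = \<Union> Bs \<and> X \<inter> Y = {} \<and> X \<inter> Z = {} \<and> Y \<inter> Z = {} \<and>
     (\<forall>B \<in> Bs. B \<subseteq> X \<or> B \<subseteq> Y \<or> B \<subseteq> Z)"

text \<open>
  The left-hand sides of the MNA equations with the total time derivatives resolved by the chain
  rule, multiplied from the left with the transposes of all blocks of \<open>TN\<close> and \<open>TL\<close>, as functions of
  the new unknowns \<open>w\<close> and their derivatives \<open>w'\<close>.
\<close>

definition projected_mna ::
  "('n::finite, 'b::finite) network \<Rightarrow> real^'n^'n \<Rightarrow> real^'b^'b \<Rightarrow>
   real^('n + 'b) \<Rightarrow> real^('n + 'b) \<Rightarrow> real \<Rightarrow> real^('n + 'b)" where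
  "projected_mna N TN TL w' w t =
     (case mna_unknowns N TN TL w of (\<phi>, iL, iVs, iVc) \<Rightarrow>
      case mna_unknowns N TN TL w' of (\<phi>', iL', _, _) \<Rightarrow>
      \<chi> k. case k of
        Inl j \<Rightarrow>
          (transpose TN *v
            (inc N {Cap} *v (jacobian (q_C N) (at (volt N {Cap} \<phi>)) *v volt N {Cap} \<phi>') +
             static_currents N \<phi> iL iVs iVc t)) $ j
      | Inr b \<Rightarrow>
          if kind_of N b = Ind then
            (transpose TL *v (jacobian (phi_L N) (at iL) *v iL' - volt N {Ind} \<phi>)) $ b
          else if kind_of N b = Vs then vs_residual N \<phi> t $ b
          else if kind_of N b = Vc then vc_residual N \<phi> iL t $ b
          else 0)"

text \<open>\<open>x' = f x y t\<close>, \<open>0 = g x y t\<close> with \<open>x \<in> \<real>\<^sup>X\<close>, \<open>y \<in> \<real>\<^sup>Y\<close> and equations \<open>g\<close> indexed by \<open>E\<close>.\<close>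

definition semi_explicit_index_one ::
  "'k set \<Rightarrow> 'k set \<Rightarrow> 'k set \<Rightarrow> (real^'k::finite \<Rightarrow> real^'k \<Rightarrow> real \<Rightarrow> real^'k) \<Rightarrow>
   (real^'k \<Rightarrow> real^'k \<Rightarrow> real \<Rightarrow> real^'k) \<Rightarrow> bool" where
  "semi_explicit_index_one X Y E f g \<longleftrightarrow>
     continuous_on UNIV (\<lambda>(x, y, t). f x y t) \<and> cont_diff (\<lambda>(x, y, t). g x y t) \<and>
     (\<forall>x \<in> coord_space X. \<forall>y \<in> coord_space Y. \<forall>t.
        f x y t \<in> coord_space X \<and> g x y t \<in> coord_space E \<and>
        regular_block E Y (jacobian (\<lambda>y. g x y t) (at y)))"

definition uniquely_solvable_outputs ::
  "'k set \<Rightarrow> 'k set \<Rightarrow> 'k set \<Rightarrow>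
   (real^'k::finite \<Rightarrow> real^'k \<Rightarrow> real^'k \<Rightarrow> real^'k \<Rightarrow> real^'k \<Rightarrow> real \<Rightarrow> real^'k) \<Rightarrow> bool" where
  "uniquely_solvable_outputs X Y Z h \<longleftrightarrow>
     (\<forall>x' \<in> coord_space X. \<forall>y' \<in> coord_space Y. \<forall>x \<in> coord_space X. \<forall>y \<in> coord_space Y. \<forall>t.
        \<exists>!z. z \<in> coord_space Z \<and> h x' y' x y z t = 0)"

definition decoupled_solution ::
  "'k set \<Rightarrow> 'k set \<Rightarrow> 'k set \<Rightarrow> (real^'k::finite \<Rightarrow> real^'k \<Rightarrow> real \<Rightarrow> real^'k) \<Rightarrow>
   (real^'k \<Rightarrow> real^'k \<Rightarrow> real \<Rightarrow> real^'k) \<Rightarrow>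
   (real^'k \<Rightarrow> real^'k \<Rightarrow> real^'k \<Rightarrow> real^'k \<Rightarrow> real^'k \<Rightarrow> real \<Rightarrow> real^'k) \<Rightarrow>
   real set \<Rightarrow> (real \<Rightarrow> real^'k) \<Rightarrow> bool" where
  "decoupled_solution X Y Z f g h T w \<longleftrightarrow>
     (\<forall>t \<in> T. w t \<in> coord_space (X \<union> Y \<union> Z)) \<and>
     (\<exists>w'. C1_curve T w w' \<and>
        (\<forall>t \<in> T.
           restr X (w' t) = f (restr X (w t)) (restr Y (w t)) t \<and>
           g (restr X (w t)) (restr Y (w t)) t = 0 \<and>
           h (restr X (w' t)) (restr Y (w' t)) (restr X (w t)) (restr Y (w t)) (restr Z (w t)) t = 0))"

text \<open>
  The unknowns are grouped into \<open>x\<close>, \<open>y\<close>, \<open>z\<close> (indices \<open>X\<close>, \<open>Y\<close>, \<open>Z\<close>) and the projected equations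
  \<open>F\<close> into those that are solved for \<open>x'\<close> (\<open>D\<close>), those that make up \<open>g\<close> (\<open>E\<close>) and those that make up
  \<open>h\<close> (\<open>G\<close>).  The components of \<open>y\<close> in \<open>K\<close> are purely time-dependent: \<open>g = 0\<close> forces them to be
  \<open>\<tau> t\<close>, and it is their derivatives that are substituted when solving for \<open>x'\<close>.
\<close>

definition decouplable_by_basis_matrices :: "('n::finite, 'b::finite) network \<Rightarrow> bool" where
  "decouplable_by_basis_matrices N \<longleftrightarrow>
     (\<exists>Bs S I Q Ls TL X Y Z D E G K \<tau> \<tau>' f g h.
        let TN = S + Q;
            blocks = variable_blocks N Bs I Ls;
            F = projected_mna N TN TL;
            U = coord_space (\<Union> blocks)
        in splitting N Bs S I Q Ls TL \<and>
           bij_betw (mna_unknowns N TN TL) U (mna_space N) \<and>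
           groups_blocks blocks X Y Z \<and>
           groups_blocks blocks D E G \<and>
           K \<subseteq> Y \<and> C1_curve UNIV \<tau> \<tau>' \<and>
           (\<forall>x \<in> coord_space X. \<forall>y \<in> coord_space Y. \<forall>t. g x y t = 0 \<longrightarrow> restr K y = \<tau> t) \<and>
           (\<forall>w' \<in> U. \<forall>w \<in> U. \<forall>t.
              (restr K w' = \<tau>' t \<longrightarrow>
                 (restr D (F w' w t) = 0 \<longleftrightarrow> restr X w' = f (restr X w) (restr Y w) t)) \<and>
              restr E (F w' w t) = g (restr X w) (restr Y w) t \<and>
              restr G (F w' w t) =
                h (restr X w') (restr Y w') (restr X w) (restr Y w) (restr Z w) t) \<and>
           semi_explicit_index_one X Y E f g \<and>
           uniquely_solvable_outputs X Y Z h \<and>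
           (\<forall>T w. is_interval T \<and> interior T \<noteq> {} \<and> (\<forall>t \<in> T. w t \<in> U) \<longrightarrow>
              (mna_solution N T (\<lambda>t. mna_unknowns N TN TL (w t)) \<longleftrightarrow>
               decoupled_solution X Y Z f g h T w)))"

end

theory Submission
  imports Defs
begin

text \<open>
  The decoupling splits the potentials along the chain of kernels of \<open>A\<^sub>V\<^sub>s\<^sup>T\<close>, \<open>[A\<^sub>C, A\<^sub>V\<^sub>s]\<^sup>T\<close>,
  \<open>[A\<^sub>C, A\<^sub>V]\<^sup>T\<close> and \<open>[A\<^sub>C, A\<^sub>R, A\<^sub>V]\<^sup>T\<close>: the potentials are \<open>\<phi> = TN a\<close>, where the coordinates of \<open>a\<close>
  fall into blocks \<open>J1\<close> to \<open>J5\<close> and the \<open>k\<close>-th kernel consists of the \<open>\<phi>\<close> whose coordinates in the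
  first \<open>k\<close> blocks vanish (\<open>splitting_extend\<close>).  The inductor currents are then split as
  \<open>i\<^sub>L = [V, W] b\<close> by basis matrices of \<open>A\<^sub>L\<^sup>T Q\<close>, where \<open>Q\<close> spans the last kernel; \<open>J'\<close> is the block
  of \<open>V\<close>.  Each of the projected equations is Kirchhoff's current law tested with the potentials of
  one block, or the equation of an element; so whether a term occurs in it depends only on
  which voltages the test potentials can put on the branches.

  The coordinates \<open>J1\<close> (independent voltage sources) and \<open>J'\<close> (current law tested with \<open>J5\<close>)
  are purely time-dependent (\<open>time_dependent_variables\<close>).  The current law at \<open>J2\<close> and the inductor
  equations outside \<open>J'\<close> have a positive definite mass matrix made of \<open>C\<close> and \<open>L\<close> and can be solved
  for the derivatives (\<open>explicit_differential_equation\<close>).  The remaining algebraic equations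
  determine \<open>J3\<close> (controlled voltage sources), \<open>J4\<close> (positive definite resistors) and the currents of
  the controlled voltage sources, so that their Jacobian is block triangular with regular diagonal
  blocks (\<open>algebraic_jacobian_regular\<close>).  The potentials \<open>J5\<close> and the currents of the independent
  voltage sources occur only in the inductor equations at \<open>J'\<close> and the current law at \<open>J1\<close>, and are
  determined by them (\<open>outputs_unique\<close>).

  The conditions on the circuit enter through two facts of graph theory.  A branch carrying a current of a
  circulation lies in a loop of such branches (\<open>circulation_branch_in_loop\<close>), so that currents in
  voltage sources are determined by their contributions to the current law.  A branch whose terminals
  have different potentials lies in a cutset of such branches (\<open>branch_with_voltage_in_cutset\<close>), so
  that potentials putting no voltage on capacitors, resistors and voltage sources put none on the
  fourth group of controlled current sources, and vanish if they put none on inductors either.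
  The other three groups drop out of the tested current law because of the paths between their terminals.
\<close>

section \<open>Potentials, paths, loops and cutsets\<close>

text \<open>The potentials of all nodes: that of the ground node is zero.\<close>

definition potential :: "real^'n::finite \<Rightarrow> 'n option \<Rightarrow> real" where
  "potential \<phi> u = (case u of None \<Rightarrow> 0 | Some i \<Rightarrow> \<phi> $ i)"

lemma volt_nth:
  "volt N K \<phi> $ b =
     (if kind_of N b \<in> K then potential \<phi> (tail N b) - potential \<phi> (head N b) else 0)"
proof (cases "kind_of N b \<in> K")
  case True
  have *: "(\<Sum>i\<in>UNIV. (if u = Some i then 1 else 0) * \<phi> $ i) = potential \<phi> u" for u
  proof (cases u)
    case (Some k)
    have "(\<Sum>i\<in>UNIV. (if u = Some i then 1 else 0) * \<phi> $ i) = (\<Sum>i\<in>UNIV. if k = i then \<phi> $ i else 0)"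
      by (rule sum.cong) (auto simp: Some)
    then show ?thesis by (simp add: Some potential_def)
  qed (simp add: potential_def)
  have "volt N K \<phi> $ b = (\<Sum>i\<in>UNIV. ((if tail N b = Some i then 1 else 0) -
      (if head N b = Some i then 1 else 0)) * \<phi> $ i)"
    using True by (simp add: volt_def matrix_vector_mult_def transpose_def inc_def block_def
        incidence_def branches_def)
  also have "\<dots> = potential \<phi> (tail N b) - potential \<phi> (head N b)"
    by (simp only: left_diff_distrib sum_subtractf *)
  finally show ?thesis using True by simp
next
  case False
  then show ?thesis
    by (simp add: volt_def matrix_vector_mult_def transpose_def inc_def block_def branches_def)
qed

lemma inner_matrix_transpose: "(M *v x) \<bullet> y = x \<bullet> (transpose M *v (y::real^'m::finite))"
  for M :: "real^'n::finite^'m"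
  by (metis dot_lmul_matrix inner_commute transpose_matrix_vector)

lemma inner_inc: "(inc N K *v i) \<bullet> \<phi> = i \<bullet> volt N K \<phi>"
  by (simp add: inner_matrix_transpose volt_def)

text \<open>Adjacency through branches of \<open>E\<close>; its reflexive transitive closure is \<^const>\<open>has_path\<close>.\<close>

definition linked :: "('n, 'b, 'z) circuit_scheme \<Rightarrow> 'b set \<Rightarrow> ('n option \<times> 'n option) set" where
  "linked c E = {(u, v). \<exists>b\<in>E. joins c b u v}"

lemma joins_commute: "joins c b u v \<longleftrightarrow> joins c b v u"
  by (auto simp: joins_def)

lemma linked_rtrancl_sym: "(u, v) \<in> (linked c E)\<^sup>* \<Longrightarrow> (v, u) \<in> (linked c E)\<^sup>*"
proof -
  have "sym (linked c E)"
    by (auto simp: linked_def sym_def joins_commute)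
  then show "(u, v) \<in> (linked c E)\<^sup>* \<Longrightarrow> (v, u) \<in> (linked c E)\<^sup>*"
    by (meson sym_rtrancl symD)
qed

lemma linked_mono: "E \<subseteq> E' \<Longrightarrow> (linked c E)\<^sup>* \<subseteq> (linked c E')\<^sup>*"
  by (rule rtrancl_mono) (auto simp: linked_def)

lemma has_path_iff: "has_path c E u v \<longleftrightarrow> (u, v) \<in> (linked c E)\<^sup>*"
proof
  assume "has_path c E u v"
  then obtain us bs where p: "is_path c us bs" "hd us = u" "last us = v" "set bs \<subseteq> E"
    by (auto simp: has_path_def)
  then have l: "length us = Suc (length bs)" by (simp add: is_path_def)
  have "(us ! 0, us ! i) \<in> (linked c E)\<^sup>*" if "i \<le> length bs" for i
    using that
  proof (induction i)
    case (Suc i)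
    then have "joins c (bs ! i) (us ! i) (us ! Suc i)" using p by (auto simp: is_path_def)
    moreover have "bs ! i \<in> E" using Suc.prems p(4) by auto
    ultimately have "(us ! i, us ! Suc i) \<in> linked c E" by (auto simp: linked_def)
    with Suc show ?case by (meson Suc_leD rtrancl.rtrancl_into_rtrancl)
  qed simp
  from this[of "length bs"] show "(u, v) \<in> (linked c E)\<^sup>*"
    using p l by (metis diff_Suc_1 hd_conv_nth last_conv_nth le_refl length_0_conv nat.distinct(1))
next
  assume "(u, v) \<in> (linked c E)\<^sup>*"
  then show "has_path c E u v"
  proof (induction rule: rtrancl_induct)
    case base
    show ?case unfolding has_path_def
      by (rule exI[of _ "[u]"], rule exI[of _ "[]"]) (simp add: is_path_def)
  next
    case (step v w)
    then obtain us bs where p: "is_path c us bs" "hd us = u" "last us = v" "set bs \<subseteq> E"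
      by (auto simp: has_path_def)
    then have l: "length us = Suc (length bs)" by (simp add: is_path_def)
    from step obtain b where b: "b \<in> E" "joins c b v w" by (auto simp: linked_def)
    show ?case
    proof (cases "w \<in> set us")
      case True
      then obtain k where k: "k < length us" "us ! k = w" by (auto simp: in_set_conv_nth)
      have "is_path c (take (Suc k) us) (take k bs)"
        using p k l by (auto simp: is_path_def)
      moreover have "hd (take (Suc k) us) = u" using p(2) by (simp add: hd_take)
      moreover have "last (take (Suc k) us) = w" using k by (simp add: take_Suc_conv_app_nth)
      moreover have "set (take k bs) \<subseteq> E" using p(4) by (meson dual_order.trans set_take_subset)
      ultimately show ?thesis unfolding has_path_def by blast
    next
      case False
      have "joins c ((bs @ [b]) ! i) ((us @ [w]) ! i) ((us @ [w]) ! Suc i)" if "i < Suc (length bs)" for i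
      proof (cases "i < length bs")
        case True
        then show ?thesis using p(1) l by (auto simp: is_path_def nth_append)
      next
        case False
        with that have i: "i = length bs" by simp
        have "us ! length bs = v" using p(3) l
          by (metis diff_Suc_1 last_conv_nth length_0_conv nat.distinct(1))
        then show ?thesis using i l b by (simp add: nth_append)
      qed
      then have "is_path c (us @ [w]) (bs @ [b])"
        using p(1) False by (simp add: is_path_def)
      moreover have "hd (us @ [w]) = u" using p(2) l by (cases us) auto
      ultimately show ?thesis unfolding has_path_def using p(4) b(1)
        by (intro exI[of _ "us @ [w]"] exI[of _ "bs @ [b]"]) auto
    qed
  qed
qed

lemma path_closes_to_loop:
  assumes "has_path c E v u" "b \<notin> E" "joins c b u v" "u \<noteq> v"
  shows "\<exists>B. loop_set c B \<and> b \<in> B \<and> B \<subseteq> insert b E"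
proof -
  obtain us bs where p: "is_path c us bs" "hd us = v" "last us = u" "set bs \<subseteq> E"
    using assms(1) by (auto simp: has_path_def)
  then have l: "length us = Suc (length bs)" and d: "distinct us"
    and j: "\<And>i. i < length bs \<Longrightarrow> joins c (bs ! i) (us ! i) (us ! Suc i)"
    by (auto simp: is_path_def)
  have ne: "us \<noteq> []" using l by auto
  have "distinct bs"
    unfolding distinct_conv_nth
  proof (intro allI impI)
    fix i k assume ik: "i < length bs" "k < length bs" "i \<noteq> k"
    show "bs ! i \<noteq> bs ! k"
    proof
      assume "bs ! i = bs ! k"
      then have "(us ! i = us ! k \<and> us ! Suc i = us ! Suc k) \<or> (us ! i = us ! Suc k \<and> us ! Suc i = us ! k)"
        using j[OF ik(1)] j[OF ik(2)] by (auto simp: joins_def)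
      then show False using ik l d by (auto simp: nth_eq_iff_index_eq)
    qed
  qed
  moreover have "b \<notin> set bs" using assms(2) p(4) by auto
  moreover have "joins c ((bs @ [b]) ! i) (us ! i) (us ! (Suc i mod length (bs @ [b])))"
    if "i < length (bs @ [b])" for i
  proof (cases "i < length bs")
    case True
    then show ?thesis using j by (simp add: nth_append)
  next
    case False
    with that have i: "i = length bs" by simp
    have "us ! length bs = u" "us ! 0 = v" using p(2,3) l ne
      by (auto simp: last_conv_nth hd_conv_nth)
    then show ?thesis using i assms(3) by simp
  qed
  ultimately have "is_loop c us (bs @ [b])"
    using l d by (simp add: is_loop_def)
  then show ?thesis
    unfolding loop_set_def using p(4)
    by (intro exI[of _ "set (bs @ [b])"] conjI exI[of _ us] exI[of _ "bs @ [b]"]) auto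
qed

text \<open>
  If no path of the support of a circulation closed the loop through \<open>b\<close>, then the nodes reachable
  from one end of \<open>b\<close> would span a cut that the circulation crosses through \<open>b\<close> only.
\<close>

lemma circulation_branch_in_loop:
  fixes N :: "('n::finite, 'b::finite) network"
  assumes circ: "inc N UNIV *v j = 0" and b: "j $ b \<noteq> 0" "tail N b \<noteq> head N b"
  shows "\<exists>B. loop_set N B \<and> b \<in> B \<and> B \<subseteq> {e. j $ e \<noteq> 0}"
proof -
  define E where "E = {e. j $ e \<noteq> 0} - {b}"
  define R where "R = {u. (head N b, u) \<in> (linked N E)\<^sup>*}"
  have "tail N b \<in> R"
  proof (rule ccontr)
    assume nR: "tail N b \<notin> R"
    have hR: "head N b \<in> R" by (simp add: R_def)
    have closed: "u \<in> R \<Longrightarrow> joins N e u v \<Longrightarrow> e \<in> E \<Longrightarrow> v \<in> R" for u v e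
      unfolding R_def linked_def mem_Collect_eq by (rule rtrancl_into_rtrancl) auto
    define ch where "ch u = (if u \<in> R then 1 else (0::real))" for u
    define \<phi> where "\<phi> = (\<chi> i. ch (Some i) - ch None)"
    have pot: "potential \<phi> u = ch u - ch None" for u
      by (cases u) (auto simp: potential_def \<phi>_def)
    have "j $ e * (ch (tail N e) - ch (head N e)) = (if e = b then - j $ b else 0)" for e
    proof -
      consider "e = b" | "e \<noteq> b" "j $ e = 0" | "e \<in> E" by (auto simp: E_def)
      then show ?thesis
      proof cases
        case 3
        then have "tail N e \<in> R \<longleftrightarrow> head N e \<in> R" using closed by (auto simp: joins_def)
        with 3 show ?thesis by (auto simp: E_def ch_def)
      qed (use nR hR in \<open>auto simp: ch_def\<close>)
    qed
    then have "j \<bullet> volt N UNIV \<phi> = (\<Sum>e\<in>UNIV. if e = b then - j $ b else 0)"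
      unfolding inner_vec_def by (intro sum.cong) (auto simp: volt_nth pot)
    also have "\<dots> = - j $ b" by simp
    finally show False using circ b(1) by (simp flip: inner_inc)
  qed
  then have "has_path N E (head N b) (tail N b)" by (simp add: has_path_iff R_def)
  from path_closes_to_loop[OF this, of b] b show ?thesis
    by (fastforce simp: E_def joins_def)
qed

text \<open>
  A maximal set of branches that contains all branches without voltage and does not connect the two
  ends of \<open>b\<close> has exactly two components, so that its complement is a cutset.
\<close>

lemma branch_with_voltage_in_cutset:
  fixes p :: "'n::finite option \<Rightarrow> real" and c :: "('n, 'b::finite, 'z) circuit_scheme"
  assumes con: "connected_via c UNIV" and b: "p (tail c b) \<noteq> p (head c b)"
  shows "\<exists>B. cutset c B \<and> b \<in> B \<and> B \<subseteq> {e. p (tail c e) \<noteq> p (head c e)}"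
proof -
  define E0 where "E0 = {e. p (tail c e) = p (head c e)}"
  let ?u = "tail c b" and ?v = "head c b"
  define \<A> where "\<A> = {S. E0 \<subseteq> S \<and> (?u, ?v) \<notin> (linked c S)\<^sup>*}"
  have "p u = p v" if "(u, v) \<in> (linked c E0)\<^sup>*" for u v
    using that by induction (auto simp: linked_def joins_def E0_def)
  then have "E0 \<in> \<A>" using b by (auto simp: \<A>_def)
  moreover have "finite \<A>" by simp
  ultimately obtain S where S: "S \<in> \<A>" and max: "\<And>S'. S' \<in> \<A> \<Longrightarrow> S \<subseteq> S' \<Longrightarrow> S' = S"
    using finite_has_maximal by (metis empty_iff)
  have sep: "(?u, ?v) \<notin> (linked c S)\<^sup>*" and E0S: "E0 \<subseteq> S" using S by (auto simp: \<A>_def)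
  have "(?u, ?v) \<in> linked c {b}" by (auto simp: linked_def joins_def)
  then have bS: "b \<notin> S" using sep linked_mono[of "{b}" S c] by blast
  define Ru where "Ru = {w. (?u, w) \<in> (linked c S)\<^sup>*}"
  define Rv where "Rv = {w. (?v, w) \<in> (linked c S)\<^sup>*}"
  have stepS: "e \<in> S \<Longrightarrow> joins c e x y \<Longrightarrow> (w, x) \<in> (linked c S)\<^sup>* \<Longrightarrow> (w, y) \<in> (linked c S)\<^sup>*" for e w x y
    by (rule rtrancl_into_rtrancl[of w x]) (auto simp: linked_def)
  have joined: "(?u, ?v) \<in> (linked c (insert e S))\<^sup>*" if "e \<notin> S" for e
  proof -
    have "insert e S \<notin> \<A>" using max[of "insert e S"] that by auto
    then show ?thesis using E0S by (auto simp: \<A>_def)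
  qed
  have cover: "w \<in> Ru \<union> Rv" for w
  proof -
    have "(?u, w) \<in> (linked c UNIV)\<^sup>*" using con by (simp add: connected_via_def has_path_iff)
    then show ?thesis
    proof induction
      case base
      then show ?case by (simp add: Ru_def)
    next
      case (step x y)
      from step(2) obtain e where e: "joins c e x y" by (auto simp: linked_def)
      show ?case
      proof (rule ccontr)
        assume y: "y \<notin> Ru \<union> Rv"
        have eS: "e \<notin> S" using y step(3) e stepS by (auto simp: Ru_def Rv_def)
        (* Adding e merges a component of S with that of y and hence cannot connect the ends of b. *)
        define Cy where "Cy = {w. (y, w) \<in> (linked c S)\<^sup>*}"
        define R where "R = Ru \<union> (if x \<in> Ru then Cy else {})"
        have "w \<in> R" if "(?u, w) \<in> (linked c (insert e S))\<^sup>*" for w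
          using that
        proof induction
          case base
          then show ?case by (simp add: R_def Ru_def)
        next
          case (step x' y')
          then obtain e' where e': "e' \<in> insert e S" "joins c e' x' y'" by (auto simp: linked_def)
          show ?case
          proof (cases "e' \<in> S")
            case True
            then show ?thesis using step(3) stepS[OF True e'(2)]
              by (auto simp: R_def Ru_def Cy_def split: if_splits)
          next
            case False
            with e' have "joins c e x' y'" by simp
            with e have "(x' = x \<and> y' = y) \<or> (x' = y \<and> y' = x)" by (auto simp: joins_def)
            then show ?thesis using step(3) y
              by (auto simp: R_def Cy_def split: if_splits)
          qed
        qed
        with joined[OF eS] have "?v \<in> R" by blast
        moreover have "?v \<notin> Ru" using sep by (simp add: Ru_def)
        moreover have "?v \<notin> Cy"
          using y linked_rtrancl_sym[of y ?v c S] by (auto simp: Cy_def Rv_def)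
        ultimately show False by (auto simp: R_def split: if_splits)
      qed
    qed
  qed
  have "cutset c (- S)"
    unfolding cutset_def
  proof (intro conjI allI impI)
    show "\<not> connected_via c (- (- S))"
      using sep by (auto simp: connected_via_def has_path_iff)
    fix B' assume "B' \<subset> - S"
    then obtain e where e: "e \<notin> S" "e \<notin> B'" by auto
    have sub: "insert e S \<subseteq> - B'" using e \<open>B' \<subset> - S\<close> by auto
    note mono1 = linked_mono[OF sub, of c]
    have mono2: "(linked c S)\<^sup>* \<subseteq> (linked c (- B'))\<^sup>*" using sub by (intro linked_mono) auto
    have uv: "(?u, ?v) \<in> (linked c (- B'))\<^sup>*" using joined[OF e(1)] mono1 by blast
    have "(?u, w) \<in> (linked c (- B'))\<^sup>*" for w
      using cover[of w] uv mono2 by (auto simp: Ru_def Rv_def intro: rtrancl_trans)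
    then show "connected_via c (- B')"
      unfolding connected_via_def has_path_iff
      by (meson linked_rtrancl_sym rtrancl_trans)
  qed
  moreover have "b \<in> - S" using bS by simp
  moreover have "- S \<subseteq> {e. p (tail c e) \<noteq> p (head c e)}" using E0S by (auto simp: E0_def)
  ultimately show ?thesis by blast
qed

text \<open>This is how the path conditions on the controlled current sources are used.\<close>

lemma potential_eq_along_path:
  assumes "has_path N (branches N K) u v" "volt N K \<phi> = 0"
  shows "potential \<phi> u = potential \<phi> v"
proof -
  have "(u, v) \<in> (linked N (branches N K))\<^sup>*" using assms(1) by (simp add: has_path_iff)
  then show ?thesis
  proof induction
    case (step x y)
    then obtain e where "kind_of N e \<in> K" "joins N e x y"
      by (auto simp: linked_def branches_def)
    moreover have "volt N K \<phi> $ e = 0" using assms(2) by simp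
    ultimately show ?case using step.IH by (auto simp: volt_nth joins_def)
  qed simp
qed

section \<open>Coordinate subspaces and basis matrices\<close>

lemma restr_nth [simp]: "restr I v $ i = (if i \<in> I then v $ i else 0)"
  by (simp add: restr_def)

lemma mem_coord_space: "v \<in> coord_space I \<longleftrightarrow> (\<forall>i. i \<notin> I \<longrightarrow> v $ i = 0)"
  by (simp add: coord_space_def)

lemma restr_in_coord_space: "I \<subseteq> J \<Longrightarrow> restr I v \<in> coord_space J"
  by (auto simp: mem_coord_space)

lemma restr_eq_self: "v \<in> coord_space I \<Longrightarrow> restr I v = v"
  by (auto simp: mem_coord_space vec_eq_iff)

lemma restr_eq_0_iff: "restr I v = 0 \<longleftrightarrow> (\<forall>i\<in>I. v $ i = 0)"
  by (auto simp: vec_eq_iff)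

lemma restr_empty [simp]: "restr {} v = 0"
  by (simp add: vec_eq_iff)

lemma restr_0 [simp]: "restr I 0 = 0"
  by (simp add: vec_eq_iff)

lemma restr_restr: "restr I (restr J v) = restr (I \<inter> J) v"
  by (auto simp: vec_eq_iff)

lemma restr_add: "restr I (u + v) = restr I u + restr I v"
  by (simp add: vec_eq_iff)

lemma restr_scaleR: "restr I (c *\<^sub>R v) = c *\<^sub>R restr I v"
  by (simp add: vec_eq_iff)

lemma linear_restr [simp]: "linear (restr I)"
  by (intro linearI) (simp_all add: restr_add restr_scaleR)

lemma subspace_coord_space [simp]: "subspace (coord_space I)"
  by (auto simp: subspace_def mem_coord_space)

lemma span_coord_space [simp]: "span (coord_space I) = coord_space I"
  by (simp add: span_eq_iff)

lemma dim_coord_space: "dim (coord_space I :: (real^'k::finite) set) = card I"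
  using dim_substandard_cart[of I, where ?'a = real]
  by (simp add: coord_space_def dim_vec_eq)

lemma card_le_of_coord_inj:
  fixes f :: "real^'k::finite \<Rightarrow> real^'l::finite"
  assumes lin: "linear f" and maps: "\<And>x. x \<in> coord_space I \<Longrightarrow> f x \<in> coord_space J"
    and inj: "\<And>x. x \<in> coord_space I \<Longrightarrow> f x = 0 \<Longrightarrow> x = 0"
  shows "card I \<le> card J"
proof -
  have "inj_on f (coord_space I)"
    by (rule inj_onI) (metis inj lin linear_diff right_minus_eq subspace_coord_space subspace_diff)
  then have "dim (f ` coord_space I) = dim (coord_space I :: (real^'k) set)"
    using dim_image_eq[OF lin] by simp
  moreover have "dim (f ` coord_space I) \<le> dim (coord_space J :: (real^'l) set)"
    using maps by (intro dim_subset) auto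
  ultimately show ?thesis by (simp add: dim_coord_space)
qed

lemma coord_linear_inverse:
  fixes f :: "real^'k::finite \<Rightarrow> real^'l::finite"
  assumes lin: "linear f" and maps: "\<And>x. x \<in> coord_space I \<Longrightarrow> f x \<in> coord_space J"
    and inj: "\<And>x. x \<in> coord_space I \<Longrightarrow> f x = 0 \<Longrightarrow> x = 0"
    and card: "card J \<le> card I"
  obtains g where "linear g" "\<And>y. g y \<in> coord_space I" "\<And>x. x \<in> coord_space I \<Longrightarrow> g (f x) = x"
    "\<And>y. y \<in> coord_space J \<Longrightarrow> f (g y) = y"
proof -
  have inj_on: "inj_on f (coord_space I)"
    by (rule inj_onI) (metis inj lin linear_diff right_minus_eq subspace_coord_space subspace_diff)
  then obtain g where g: "range g \<subseteq> span (coord_space I)" "linear g"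
      "\<And>x. x \<in> coord_space I \<Longrightarrow> g (f x) = x"
    using linear_inj_on_left_inverse[OF lin, of "coord_space I"] by auto
  have "dim (f ` coord_space I) = card I"
    using dim_image_eq[OF lin, of "coord_space I"] inj_on by (simp add: dim_coord_space)
  then have "f ` coord_space I = coord_space J"
    using maps card
    by (intro subspace_dim_equal) (auto simp: dim_coord_space linear_subspace_image[OF lin])
  then have "f (g y) = y" if "y \<in> coord_space J" for y
    using that g(3) by (metis imageE)
  with g show ?thesis by (intro that) auto
qed

lemma block_mult: "block I J M *v x = restr I (M *v restr J x)"
  by (auto simp: vec_eq_iff block_def matrix_vector_mult_def intro!: sum.cong)

lemma id_block_mult: "id_block I *v x = restr I x"
  by (simp add: id_block_def block_mult restr_restr)

lemma regular_blockI:
  assumes card: "card I = card J"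
    and inj: "\<And>y. y \<in> coord_space J \<Longrightarrow> restr I (M *v y) = 0 \<Longrightarrow> y = 0"
  shows "regular_block I J M"
proof -
  define f where "f y = restr I (M *v y)" for y
  have lin: "linear f" unfolding f_def
    using linear_compose[OF matrix_vector_mul_linear linear_restr] by (simp add: o_def)
  obtain g where g: "linear g" "\<And>y. g y \<in> coord_space J" "\<And>x. x \<in> coord_space J \<Longrightarrow> g (f x) = x"
    "\<And>y. y \<in> coord_space I \<Longrightarrow> f (g y) = y"
  proof (rule coord_linear_inverse[OF lin, of J I])
    show "f y \<in> coord_space I" for y by (simp add: f_def restr_in_coord_space)
    show "y = 0" if "y \<in> coord_space J" "f y = 0" for y
      using inj that by (simp add: f_def)
    show "card I \<le> card J" using card by simp
  qed blast
  have M': "block J I (matrix g) *v x = g (restr I x)" for x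
    using g(1,2) by (simp add: block_mult matrix_works restr_eq_self)
  have M: "block I J M *v x = f (restr J x)" for x
    by (simp add: block_mult f_def)
  have "block I J M ** block J I (matrix g) = id_block I"
    using g(2,4) by (simp add: matrix_eq M M' id_block_mult restr_eq_self restr_in_coord_space
        flip: matrix_vector_mul_assoc)
  moreover have "restr I (f x) = f x" for x
    by (simp add: f_def restr_restr)
  then have "block J I (matrix g) ** block I J M = id_block J"
    using g(3) by (simp add: matrix_eq M M' id_block_mult restr_in_coord_space
        flip: matrix_vector_mul_assoc)
  ultimately show ?thesis unfolding regular_block_def by blast
qed

lemma in_range_if_orthogonal_to_kernel:
  fixes M :: "real^'n::finite^'m::finite"
  assumes "\<And>y. transpose M *v y = 0 \<Longrightarrow> x \<bullet> y = 0"
  shows "\<exists>j. M *v j = x"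
proof -
  let ?R = "range ((*v) M)"
  have sub: "subspace ?R" by (intro linear_subspace_image) auto
  have "x \<in> (?R\<^sup>\<bottom>)\<^sup>\<bottom>"
    unfolding orthogonal_comp_def orthogonal_def mem_Collect_eq
  proof (intro ballI)
    fix y assume "y \<in> {x. \<forall>y\<in>?R. y \<bullet> x = 0}"
    then have "(M *v j) \<bullet> y = 0" for j by auto
    then have "j \<bullet> (transpose M *v y) = 0" for j by (metis inner_matrix_transpose)
    then have "transpose M *v y = 0" by (metis inner_eq_zero_iff)
    then show "y \<bullet> x = 0" using assms inner_commute by metis
  qed
  then have "x \<in> ?R" using orthogonal_comp_self[OF sub] by simp
  then show ?thesis by auto
qed

lemma matrix_mult_restr_columns:
  fixes M :: "real^'n::finite^'m::finite"
  assumes "\<And>j. j \<notin> J \<Longrightarrow> column j M = 0"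
  shows "M *v x = M *v restr J x"
proof -
  have *: "M $ i $ j * x $ j = M $ i $ j * restr J x $ j" for i j
    using assms[of j] by (auto simp: column_def vec_eq_iff)
  show ?thesis unfolding vec_eq_iff matrix_vector_mult_def vec_lambda_beta
    by (intro allI sum.cong refl *)
qed

text \<open>Extend a basis of the kernel to one of the coordinate space and index it by \<open>I\<close>.\<close>

lemma kernel_splitting_exists: "\<exists>J P Q. kernel_splitting I (M :: real^'k::finite^'m::finite) J P Q"
proof -
  define Ker where "Ker = {v \<in> coord_space I. M *v v = 0}"
  have subK: "subspace Ker"
    by (auto simp: Ker_def subspace_def mem_coord_space matrix_vector_right_distrib scaleR_matrix_vector_assoc
        matrix_vector_mult_scaleR)
  obtain BK where BK: "BK \<subseteq> Ker" "independent BK" "Ker \<subseteq> span BK"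
    using maximal_independent_subset by blast
  then have "BK \<subseteq> coord_space I" by (auto simp: Ker_def)
  then obtain B where B: "BK \<subseteq> B" "B \<subseteq> coord_space I" "independent B" "coord_space I \<subseteq> span B"
    using maximal_independent_subset_extend BK(2) by meson
  have "span B = coord_space I"
    using B by (metis span_minimal subspace_coord_space subset_antisym)
  moreover have "card B = card I"
    using dim_span_eq_card_independent[OF B(3)] \<open>span B = coord_space I\<close> by (simp add: dim_coord_space)
  moreover have "finite B" using B(3) by (simp add: independent_imp_finite)
  ultimately obtain \<beta> where \<beta>: "bij_betw \<beta> I B"
    using finite_same_card_bij[of I B] by auto
  define J where "J = {i \<in> I. \<beta> i \<notin> BK}"
  define P where "P = (\<chi> r j. if j \<in> J then \<beta> j $ r else 0)"
  define Q where "Q = (\<chi> r j. if j \<in> I - J then \<beta> j $ r else 0)"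
  have colP: "column j P = (if j \<in> J then \<beta> j else 0)" for j
    by (auto simp: P_def column_def vec_eq_iff)
  have colQ: "column j Q = (if j \<in> I - J then \<beta> j else 0)" for j
    by (auto simp: Q_def column_def vec_eq_iff)
  have "J \<subseteq> I" by (auto simp: J_def)
  have colPQ: "column j (P + Q) = \<beta> j" if "j \<in> I" for j
    using that by (auto simp: P_def Q_def column_def vec_eq_iff)
  have img: "(\<lambda>j. column j (P + Q)) ` I = B"
    using \<beta> colPQ by (simp add: bij_betw_def)
  have "range ((*v) Q) = Ker"
  proof
    have "column j Q \<in> Ker" for j
      using BK(1) subspace_0[OF subK] by (auto simp: colQ J_def)
    then have "Q *v x \<in> Ker" for x
      by (auto simp: matrix_mult_sum scalar_mult_eq_scaleR intro!: subspace_sum subspace_scale subK)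
    then show "range ((*v) Q) \<subseteq> Ker" by auto
    have "b \<in> range ((*v) Q)" if "b \<in> BK" for b
    proof -
      have "b \<in> \<beta> ` I" using that B(1) \<beta> by (auto simp: bij_betw_def)
      then obtain j where "j \<in> I" "\<beta> j = b" by auto
      then have "b = column j Q" using that by (simp add: colQ J_def)
      then have "b = Q *v axis j 1" by (simp add: matrix_vector_mult_basis)
      then show ?thesis by blast
    qed
    moreover have "subspace (range ((*v) Q))" by (intro linear_subspace_image) auto
    ultimately have "span BK \<subseteq> range ((*v) Q)" by (intro span_minimal) auto
    then show "Ker \<subseteq> range ((*v) Q)" using BK(3) by blast
  qed
  moreover have "inj_on (\<lambda>j. column j (P + Q)) I"
    using \<beta> colPQ by (simp add: bij_betw_def inj_on_def)
  ultimately have "kernel_splitting I M J P Q"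
    using \<open>J \<subseteq> I\<close> B(3) \<open>span B = coord_space I\<close> by (simp add: kernel_splitting_def img colP colQ Ker_def)
  then show ?thesis by blast
qed

lemma basis_matrices_exist: "\<exists>J P Q J' V W. basis_matrices I' I MT J P Q J' V W"
  unfolding basis_matrices_def using kernel_splitting_exists by meson

lemma kernel_splitting_props:
  fixes M :: "real^'k::finite^'m::finite"
  assumes "kernel_splitting I M J P Q"
  shows kernel_splitting_subset: "J \<subseteq> I"
    and kernel_splitting_P: "P *v x = P *v restr J x"
    and kernel_splitting_Q: "Q *v x = Q *v restr (I - J) x"
    and kernel_splitting_range: "(P + Q) *v x \<in> coord_space I"
    and kernel_splitting_inj: "a \<in> coord_space I \<Longrightarrow> (P + Q) *v a = 0 \<Longrightarrow> a = 0"
    and kernel_splitting_kernel: "a \<in> coord_space I \<Longrightarrow> M *v ((P + Q) *v a) = 0 \<longleftrightarrow> restr J a = 0"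
proof -
  note ks = assms[unfolded kernel_splitting_def]
  let ?col = "\<lambda>j. column j (P + Q)"
  have inj_on: "inj_on ?col I" using ks by simp
  show sub: "J \<subseteq> I" using ks by simp
  show P: "P *v x = P *v restr J x" for x using ks by (intro matrix_mult_restr_columns) auto
  show Q: "Q *v x = Q *v restr (I - J) x" for x using ks by (intro matrix_mult_restr_columns) auto
  have col0: "?col j = 0" if "j \<notin> I" for j
    using ks that sub by (auto simp: column_def vec_eq_iff)
  have col: "?col j \<in> coord_space I" for j
  proof (cases "j \<in> I")
    case True
    then have "?col j \<in> span (?col ` I)" by (intro span_base imageI)
    then show ?thesis using ks by simp
  next
    case False
    then show ?thesis by (simp add: col0 subspace_0)
  qed
  show "(P + Q) *v x \<in> coord_space I" for x
    unfolding matrix_mult_sum scalar_mult_eq_scaleR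
    by (intro subspace_sum subspace_scale subspace_coord_space col)
  show inj: "a = 0" if "a \<in> coord_space I" "(P + Q) *v a = 0" for a
  proof -
    have "(P + Q) *v a = (\<Sum>j\<in>I. a $ j *\<^sub>R ?col j)"
      unfolding matrix_mult_sum scalar_mult_eq_scaleR
      by (rule sum.mono_neutral_right) (auto simp: col0)
    also have "\<dots> = (\<Sum>v\<in>?col ` I. a $ (inv_into I ?col v) *\<^sub>R v)"
      using inj_on by (subst sum.reindex) (auto simp: inv_into_f_f[OF inj_on] intro!: sum.cong)
    finally have "(\<Sum>v\<in>?col ` I. a $ (inv_into I ?col v) *\<^sub>R v) = 0" using that by simp
    then have "\<forall>v\<in>?col ` I. a $ (inv_into I ?col v) = 0"
      using ks by (auto simp: dependent_finite)
    then have "\<forall>j\<in>I. a $ j = 0"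
      using inv_into_f_f[OF inj_on] by simp
    with that(1) show ?thesis by (auto simp: mem_coord_space vec_eq_iff)
  qed
  show "M *v ((P + Q) *v a) = 0 \<longleftrightarrow> restr J a = 0" if a: "a \<in> coord_space I" for a
  proof
    assume *: "M *v ((P + Q) *v a) = 0"
    have "(P + Q) *v a \<in> coord_space I" by fact
    with * obtain c where "(P + Q) *v a = Q *v c" using ks by blast
    also have "\<dots> = (P + Q) *v restr (I - J) c"
      using P[of "restr (I - J) c"] Q[of c]
      by (simp add: matrix_vector_mult_add_rdistrib restr_restr)
    finally have "(P + Q) *v (a - restr (I - J) c) = 0" by (simp add: matrix_vector_mult_diff_distrib)
    moreover have "a - restr (I - J) c \<in> coord_space I"
      using a by (intro subspace_diff) (auto intro: restr_in_coord_space)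
    ultimately have "a = restr (I - J) c" using inj by fastforce
    then show "restr J a = 0" by (simp add: vec_eq_iff)
  next
    assume "restr J a = 0"
    then have "(P + Q) *v a = Q *v a"
      using P[of a] by (simp add: matrix_vector_mult_add_rdistrib)
    moreover have "M *v (Q *v a) = 0" using ks by blast
    ultimately show "M *v ((P + Q) *v a) = 0" by simp
  qed
qed

section \<open>Successive splittings of the potentials\<close>

text \<open>
  In the coordinates \<open>\<phi> = T a\<close>, the kernel of \<open>A\<^sub>E\<^sup>T\<close> consists of the potentials whose coordinates in
  \<open>H\<close> vanish.  A growing chain of sets \<open>E\<close> with this property describes a flag of such kernels.
\<close>

definition flag :: "('n::finite, 'b::finite) network \<Rightarrow> kind set \<Rightarrow> 'n set \<Rightarrow> real^'n^'n \<Rightarrow> bool" where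
  "flag N E H T \<longleftrightarrow> (\<forall>a. volt N E (T *v a) = 0 \<longleftrightarrow> restr H a = 0)"

text \<open>
  The matrices \<open>S\<close> and \<open>Q\<close> of a splitting have their nonzero columns outside and inside \<open>I\<close>,
  and \<open>[S, Q]\<close> is regular.
\<close>

definition adapted :: "'n set \<Rightarrow> real^'n::finite^'n \<Rightarrow> real^'n^'n \<Rightarrow> bool" where
  "adapted I S Q \<longleftrightarrow> (\<forall>a. (S + Q) *v a = 0 \<longrightarrow> a = 0) \<and>
     (\<forall>a. S *v restr I a = 0) \<and> (\<forall>a. Q *v restr (- I) a = 0)"

lemma restr_split: "restr (- I) a + restr I a = a"
  by (simp add: vec_eq_iff)

lemma volt_Un_eq_0: "volt N (E \<union> K) \<phi> = 0 \<longleftrightarrow> volt N E \<phi> = 0 \<and> volt N K \<phi> = 0"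
  by (auto simp: vec_eq_iff volt_nth)

text \<open>
  Splitting with one more set \<open>K\<close> of kinds adds the kernel of \<open>A\<^sub>E\<^sub>\<union>\<^sub>K\<^sup>T\<close> to the flag.  The kernels
  obtained before stay described by the same coordinates, since the change of coordinates
  only affects those in \<open>I\<close>.
\<close>

lemma splitting_extend:
  fixes N :: "('n::finite, 'b::finite) network"
  assumes sp: "splitting N Bs S I Q Ls TL" and ad: "adapted I S Q"
    and fl: "flag N E (- I) (S + Q)"
  obtains J S' Q' where "splitting N (insert J Bs) S' (I - J) Q' Ls TL" "J \<subseteq> I"
    "adapted (I - J) S' Q'" "flag N (E \<union> K) (- (I - J)) (S' + Q')"
    "\<And>E0 H0. H0 \<subseteq> - I \<Longrightarrow> flag N E0 H0 (S + Q) \<Longrightarrow> flag N E0 H0 (S' + Q')"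
proof -
  let ?M = "transpose (inc N K) ** Q"
  obtain J P Q' J' V W where bm: "basis_matrices (branches N K) I ?M J P Q' J' V W"
    using basis_matrices_exist by blast
  then have ks: "kernel_splitting I ?M J P Q'" by (simp add: basis_matrices_def)
  define T where "T = S + Q"
  define R where "R a = restr (- I) a + (P + Q') *v restr I a" for a
  have Sd: "S *v a = S *v restr (- I) a" and Qd: "Q *v a = Q *v restr I a" for a
  proof -
    have "S *v a = S *v restr (- I) a + S *v restr I a" "Q *v a = Q *v restr (- I) a + Q *v restr I a"
      by (simp_all add: restr_split flip: matrix_vector_right_distrib)
    then show "S *v a = S *v restr (- I) a" "Q *v a = Q *v restr I a"
      using ad by (simp_all add: adapted_def)
  qed
  have JI: "J \<subseteq> I" by (rule kernel_splitting_subset[OF ks])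
  have PQd: "(P + Q') *v a = (P + Q') *v restr I a" for a
  proof -
    have "P *v a = P *v restr I a" "Q' *v a = Q' *v restr I a"
      using kernel_splitting_P[OF ks, of a] kernel_splitting_P[OF ks, of "restr I a"]
        kernel_splitting_Q[OF ks, of a] kernel_splitting_Q[OF ks, of "restr I a"] JI
      by (simp_all add: restr_restr Int_absorb1 Int_absorb2 Int_Diff)
    then show ?thesis by (simp add: matrix_vector_mult_add_rdistrib)
  qed
  have PQmem: "(P + Q') *v a \<in> coord_space I" for a by (rule kernel_splitting_range[OF ks])
  have RI: "restr (- I) (R a) = restr (- I) a" for a
    using PQmem[of "restr I a"] by (auto simp: R_def vec_eq_iff mem_coord_space)
  have RI': "restr I (R a) = (P + Q') *v restr I a" for a
    using PQmem[of "restr I a"] by (auto simp: R_def vec_eq_iff mem_coord_space)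
  have T': "(S + Q ** P + Q ** Q') *v a = T *v R a" for a
  proof -
    have "T *v R a = S *v R a + Q *v R a" by (simp add: T_def matrix_vector_mult_add_rdistrib)
    also have "S *v R a = S *v a" using Sd[of a] Sd[of "R a"] by (simp add: RI)
    also have "Q *v R a = Q *v ((P + Q') *v a)" using Qd[of "R a"] PQd[of a] by (simp add: RI')
    finally show ?thesis
      by (simp add: matrix_vector_mult_add_rdistrib matrix_vector_right_distrib
          flip: matrix_vector_mul_assoc)
  qed
  have R0: "a = 0" if "R a = 0" for a
  proof -
    have "restr (- I) a = 0" using RI[of a] that by simp
    moreover have "restr I a = 0"
      using RI'[of a] that kernel_splitting_inj[OF ks, of "restr I a"]
      by (simp add: restr_in_coord_space)
    ultimately show ?thesis using restr_split[of I a] by simp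
  qed
  let ?S' = "S + Q ** P" and ?Q' = "Q ** Q'"
  have 1: "splitting N (insert J Bs) ?S' (I - J) ?Q' Ls TL"
    by (rule splitting.potentials[OF sp bm])
  have ad': "adapted (I - J) ?S' ?Q'"
    unfolding adapted_def
  proof (intro conjI allI impI)
    fix a
    show "a = 0" if "(?S' + ?Q') *v a = 0"
    proof (rule R0)
      have "(S + Q) *v R a = 0" using that by (simp add: T' T_def)
      then show "R a = 0" using ad unfolding adapted_def by blast
    qed
    have "S *v restr (I - J) a = 0"
      using Sd[of "restr (I - J) a"] by (simp add: restr_restr Diff_Int_distrib)
    moreover have "P *v restr (I - J) a = 0"
      using kernel_splitting_P[OF ks, of "restr (I - J) a"]
      by (simp add: restr_restr)
    ultimately show "?S' *v restr (I - J) a = 0"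
      by (simp add: matrix_vector_mult_add_rdistrib flip: matrix_vector_mul_assoc)
    have "Q' *v restr (- (I - J)) a = 0"
      using kernel_splitting_Q[OF ks, of "restr (- (I - J)) a"]
      by (simp only: restr_restr Compl_disjoint restr_empty matrix_vector_mult_0_right)
    then show "?Q' *v restr (- (I - J)) a = 0"
      by (simp flip: matrix_vector_mul_assoc)
  qed
  have fl': "flag N (E \<union> K) (- (I - J)) (?S' + ?Q')"
    unfolding flag_def
  proof
    fix a
    have e: "volt N E (T *v R a) = 0 \<longleftrightarrow> restr (- I) a = 0"
      using fl RI[of a] by (simp add: flag_def T_def)
    have k: "volt N K (T *v R a) = 0 \<longleftrightarrow> restr J a = 0" if "restr (- I) a = 0"
    proof -
      have "R a = (P + Q') *v restr I a" using that by (simp add: R_def)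
      moreover have "S *v R a = 0" using Sd[of "R a"] RI[of a] that by simp
      ultimately have "T *v R a = Q *v ((P + Q') *v restr I a)"
        by (simp add: T_def matrix_vector_mult_add_rdistrib[of S Q])
      then have "volt N K (T *v R a) = ?M *v ((P + Q') *v restr I a)"
        by (simp add: volt_def flip: matrix_vector_mul_assoc)
      then have "volt N K (T *v R a) = 0 \<longleftrightarrow> restr J (restr I a) = 0"
        using kernel_splitting_kernel[OF ks, of "restr I a"] by (simp add: restr_in_coord_space)
      then show ?thesis using JI by (simp add: restr_restr Int_absorb2)
    qed
    show "volt N (E \<union> K) ((?S' + ?Q') *v a) = 0 \<longleftrightarrow> restr (- (I - J)) a = 0"
      unfolding T' volt_Un_eq_0 e using k by (auto simp: restr_eq_0_iff)
  qed
  have pres: "flag N E0 H0 (?S' + ?Q')" if "H0 \<subseteq> - I" "flag N E0 H0 (S + Q)" for E0 H0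
    unfolding flag_def
  proof
    fix a
    have "restr H0 (R a) = restr H0 (restr (- I) (R a))"
      using that(1) by (simp add: restr_restr Int_absorb2)
    also have "\<dots> = restr H0 a"
      using that(1) by (simp add: RI restr_restr Int_absorb2)
    finally show "volt N E0 ((?S' + ?Q') *v a) = 0 \<longleftrightarrow> restr H0 a = 0"
      using that(2) by (simp add: T' flag_def T_def)
  qed
  show ?thesis by (rule that[OF 1 JI ad' fl' pres])
qed

section \<open>Continuously differentiable functions\<close>

lemma cont_diffI:
  assumes "\<And>x. (f has_derivative blinfun_apply (f' x)) (at x)" "continuous_on UNIV f'"
  shows "cont_diff f"
  using assms unfolding cont_diff_def by blast

lemma cont_diffE:
  assumes "cont_diff f"
  obtains f' where "\<And>x. (f has_derivative blinfun_apply (f' x)) (at x)" "continuous_on UNIV f'"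
  using assms unfolding cont_diff_def by blast

lemma cont_diff_continuous: "cont_diff f \<Longrightarrow> continuous_on UNIV f"
  unfolding cont_diff_def
  by (meson UNIV_I continuous_at_imp_continuous_on has_derivative_continuous)

lemma cont_diff_compose:
  assumes "cont_diff f" "cont_diff g"
  shows "cont_diff (\<lambda>x. f (g x))"
proof -
  obtain f' g' where f: "\<And>x. (f has_derivative blinfun_apply (f' x)) (at x)" "continuous_on UNIV f'"
    and g: "\<And>x. (g has_derivative blinfun_apply (g' x)) (at x)" "continuous_on UNIV g'"
    using assms by (metis cont_diffE)
  show ?thesis
  proof (rule cont_diffI)
    fix x
    show "((\<lambda>x. f (g x)) has_derivative blinfun_apply (f' (g x) o\<^sub>L g' x)) (at x)"
      using has_derivative_compose[OF g(1) f(1)] by (simp add: blinfun_compose.rep_eq o_def)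
    have "continuous_on UNIV (\<lambda>x. f' (g x))"
      using continuous_on_compose2[OF f(2) cont_diff_continuous[OF assms(2)]] by simp
    then show "continuous_on UNIV (\<lambda>x. f' (g x) o\<^sub>L g' x)"
      by (intro continuous_intros g(2))
  qed
qed

lemma cont_diff_bounded_linear: "bounded_linear f \<Longrightarrow> cont_diff f"
  by (rule cont_diffI[where f' = "\<lambda>_. Blinfun f"])
    (auto simp: bounded_linear_Blinfun_apply bounded_linear_imp_has_derivative)

lemma cont_diff_linear: "bounded_linear L \<Longrightarrow> cont_diff f \<Longrightarrow> cont_diff (\<lambda>x. L (f x))"
  by (rule cont_diff_compose[OF cont_diff_bounded_linear])

lemma linear_to_bounded: "linear f \<Longrightarrow> bounded_linear f"
  for f :: "'a::euclidean_space \<Rightarrow> 'b::real_normed_vector"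
  by (simp add: linear_conv_bounded_linear)

lemmas cont_diff_lin = cont_diff_linear[OF linear_to_bounded]
lemmas continuous_on_linear = bounded_linear.continuous_on[OF linear_to_bounded]

lemma cont_diff_const: "cont_diff (\<lambda>x. c)"
  by (rule cont_diffI[where f' = "\<lambda>_. 0"]) (simp_all add: zero_blinfun.rep_eq)

lemma cont_diff_id: "cont_diff (\<lambda>x. x)"
  by (rule cont_diff_bounded_linear[OF bounded_linear_ident])

lemma cont_diff_add:
  assumes "cont_diff f" "cont_diff g"
  shows "cont_diff (\<lambda>x. f x + g x)"
proof -
  obtain f' g' where f: "\<And>x. (f has_derivative blinfun_apply (f' x)) (at x)" "continuous_on UNIV f'"
    and g: "\<And>x. (g has_derivative blinfun_apply (g' x)) (at x)" "continuous_on UNIV g'"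
    using assms by (metis cont_diffE)
  show ?thesis
  proof (rule cont_diffI)
    show "((\<lambda>x. f x + g x) has_derivative blinfun_apply (f' x + g' x)) (at x)" for x
      using has_derivative_add[OF f(1) g(1), of x] by (simp add: plus_blinfun.rep_eq)
    show "continuous_on UNIV (\<lambda>x. f' x + g' x)" by (intro continuous_intros f(2) g(2))
  qed
qed

lemma cont_diff_diff:
  assumes "cont_diff f" "cont_diff g"
  shows "cont_diff (\<lambda>x. f x - g x)"
  using cont_diff_add[OF assms(1) cont_diff_linear[OF bounded_linear_minus[OF bounded_linear_ident] assms(2)]]
  by simp

lemma cont_diff_sum:
  assumes "\<And>i. i \<in> A \<Longrightarrow> cont_diff (f i)"
  shows "cont_diff (\<lambda>x. \<Sum>i\<in>A. f i x)"
proof (cases "finite A")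
  case True
  then show ?thesis using assms
    by (induction A rule: finite_induct) (auto intro: cont_diff_const cont_diff_add)
qed (simp add: cont_diff_const)

lemma cont_diff_Pair:
  assumes "cont_diff f" "cont_diff g"
  shows "cont_diff (\<lambda>x. (f x, g x))"
proof -
  have "bounded_linear (\<lambda>y. (y, 0))" "bounded_linear (\<lambda>z. (0, z))"
    by (intro bounded_linear_Pair bounded_linear_ident bounded_linear_zero)+
  from cont_diff_add[OF cont_diff_linear[OF this(1) assms(1)] cont_diff_linear[OF this(2) assms(2)]]
  show ?thesis by simp
qed

lemma cont_diff_vec:
  fixes f :: "'a::real_normed_vector \<Rightarrow> real^'k::finite"
  assumes "\<And>k. cont_diff (\<lambda>x. f x $ k)"
  shows "cont_diff f"
proof -
  have "f = (\<lambda>x. \<Sum>k\<in>UNIV. f x $ k *\<^sub>R axis k 1)"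
    by (auto simp: vec_eq_iff axis_def if_distrib cong: if_cong)
  moreover have "cont_diff (\<lambda>x. \<Sum>k\<in>UNIV. f x $ k *\<^sub>R axis k 1 :: real^'k)"
    by (intro cont_diff_sum cont_diff_linear[OF bounded_linear_scaleR_left] assms)
  ultimately show ?thesis by simp
qed

lemma cont_diff_compose3:
  assumes "cont_diff (\<lambda>(a, b, c). F a b c)" "cont_diff a" "cont_diff b" "cont_diff c"
  shows "cont_diff (\<lambda>p. F (a p) (b p) (c p))"
  using cont_diff_compose[OF assms(1) cont_diff_Pair[OF assms(2) cont_diff_Pair[OF assms(3,4)]]]
  by simp

lemma cont_diff_compose4:
  assumes "cont_diff (\<lambda>(a, b, c, d). F a b c d)" "cont_diff a" "cont_diff b" "cont_diff c" "cont_diff d"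
  shows "cont_diff (\<lambda>p. F (a p) (b p) (c p) (d p))"
  using cont_diff_compose[OF assms(1)
      cont_diff_Pair[OF assms(2) cont_diff_Pair[OF assms(3) cont_diff_Pair[OF assms(4,5)]]]]
  by simp

lemma cont_diff_has_jacobian:
  fixes f :: "real^'a::finite \<Rightarrow> real^'b::finite"
  assumes "cont_diff f"
  shows "(f has_derivative (\<lambda>h. jacobian f (at x) *v h)) (at x)"
  using assms unfolding cont_diff_def by (metis differentiableI jacobian_works)

lemma continuous_on_jacobian_mult:
  fixes f :: "real^'a::finite \<Rightarrow> real^'b::finite"
  assumes f: "cont_diff f" and "continuous_on S a" "continuous_on S v"
  shows "continuous_on S (\<lambda>p. jacobian f (at (a p)) *v v p)"
proof -
  obtain f' where f': "\<And>x. (f has_derivative blinfun_apply (f' x)) (at x)" "continuous_on UNIV f'"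
    using f by (metis cont_diffE)
  have "jacobian f (at x) *v h = f' x h" for x h
    using has_derivative_unique[OF cont_diff_has_jacobian[OF f] f'(1)] by metis
  moreover have "continuous_on S (\<lambda>p. f' (a p))"
    using continuous_on_compose2[OF f'(2) assms(2)] by simp
  ultimately show ?thesis by (auto intro!: continuous_intros assms(3))
qed

lemma jacobian_directional:
  fixes f :: "real^'a::finite \<Rightarrow> real^'b::finite"
  assumes "cont_diff f"
  shows "((\<lambda>s. f (y + s *\<^sub>R d)) has_vector_derivative (jacobian f (at y) *v d)) (at 0)"
proof -
  have "((\<lambda>s. y + s *\<^sub>R d) has_derivative (\<lambda>s. s *\<^sub>R d)) (at 0)"
    by (auto intro!: derivative_eq_intros)
  from has_derivative_compose[OF this, of f "\<lambda>h. jacobian f (at y) *v h"]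
  have "((\<lambda>s. f (y + s *\<^sub>R d)) has_derivative (\<lambda>s. jacobian f (at y) *v (s *\<^sub>R d))) (at 0)"
    using cont_diff_has_jacobian[OF assms, of y] by simp
  then show ?thesis
    by (simp add: has_vector_derivative_def matrix_vector_mult_scaleR)
qed

subsection \<open>Continuously differentiable curves on intervals\<close>

lemma not_bot_within_interval:
  fixes T :: "real set"
  assumes "is_interval T" "interior T \<noteq> {}" "t \<in> T"
  shows "at t within T \<noteq> bot"
proof -
  have "T \<noteq> {t}" using assms(2) by auto
  then have "t islimpt T"
    using assms by (intro connected_imp_perfect) (auto simp: is_interval_connected_1)
  then show ?thesis by (simp add: trivial_limit_within)
qed

lemma has_vector_derivative_jacobian_chain:
  fixes f :: "real^'a::finite \<Rightarrow> real^'b::finite"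
  assumes "cont_diff f" "(u has_vector_derivative u') (at t within T)"
  shows "((\<lambda>s. f (u s)) has_vector_derivative (jacobian f (at (u t)) *v u')) (at t within T)"
proof -
  have "(u has_derivative (\<lambda>s. s *\<^sub>R u')) (at t within T)"
    using assms(2) by (simp add: has_vector_derivative_def)
  from has_derivative_compose[OF this cont_diff_has_jacobian[OF assms(1)]]
  show ?thesis by (simp add: has_vector_derivative_def matrix_vector_mult_scaleR)
qed

lemma C1_curve_linear:
  assumes "bounded_linear L" "C1_curve T u u'"
  shows "C1_curve T (\<lambda>t. L (u t)) (\<lambda>t. L (u' t))"
  using assms unfolding C1_curve_def
  by (auto intro: bounded_linear.has_vector_derivative bounded_linear.continuous_on)

lemma C1_curve_cong:
  assumes "\<And>t. t \<in> T \<Longrightarrow> u t = v t" "C1_curve T u u'"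
  shows "C1_curve T v u'"
  using assms unfolding C1_curve_def by (metis has_vector_derivative_transform)

lemma C1_curve_subset: "C1_curve T u u' \<Longrightarrow> S \<subseteq> T \<Longrightarrow> C1_curve S u u'"
  unfolding C1_curve_def by (meson continuous_on_subset has_vector_derivative_within_subset subsetD)

lemma C1_curve_derivative_unique:
  assumes "C1_curve T u u'" "C1_curve T v v'" "\<And>t. t \<in> T \<Longrightarrow> u t = v t"
    and "is_interval T" "interior T \<noteq> {}" "t \<in> T"
  shows "u' t = v' t"
proof -
  have "(u has_vector_derivative u' t) (at t within T)" "(u has_vector_derivative v' t) (at t within T)"
    using assms(1,6) C1_curve_cong[OF assms(3)[symmetric] assms(2)] by (auto simp: C1_curve_def)
  then show ?thesis
    using vector_derivative_unique_within[OF not_bot_within_interval[OF assms(4-6)]] by blast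
qed

lemma cont_diff_C1_curve:
  assumes "cont_diff u"
  obtains u' where "C1_curve UNIV u u'"
proof -
  obtain f' where f: "\<And>x. (u has_derivative blinfun_apply (f' x)) (at x)" "continuous_on UNIV f'"
    using assms by (metis cont_diffE)
  have "blinfun_apply (f' x) = (\<lambda>s. s *\<^sub>R f' x 1)" for x
    by (metis blinfun.scaleR_right mult.right_neutral real_scaleR_def)
  then have "C1_curve UNIV u (\<lambda>t. f' t 1)"
    unfolding C1_curve_def has_vector_derivative_def using f by (auto intro!: continuous_intros)
  then show ?thesis by (rule that)
qed

section \<open>Consequences of the conditions on the circuit\<close>

lemma volt_linear: "linear (volt N K)"
  unfolding volt_def[abs_def] by (rule matrix_vector_mul_linear)

lemmas volt_add = linear_add[OF volt_linear]
  and volt_diff = linear_diff[OF volt_linear]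
  and volt_scaleR = linear_scale[OF volt_linear]

lemma volt_eq_0_mono: "volt N K \<phi> = 0 \<Longrightarrow> K' \<subseteq> K \<Longrightarrow> volt N K' \<phi> = 0"
  by (auto simp: vec_eq_iff volt_nth split: if_splits)

lemma volt_in_coord_space: "volt N K \<phi> \<in> coord_space (branches N K)"
  by (auto simp: mem_coord_space volt_nth branches_def)

lemma inc_eq_0_iff: "inc N K *v i = 0 \<longleftrightarrow> (\<forall>\<phi>. i \<bullet> volt N K \<phi> = 0)"
  by (metis inner_eq_zero_iff inner_inc inner_zero_left)

lemma inner_volt_restrict:
  assumes "i \<in> coord_space (branches N K)"
  shows "i \<bullet> volt N UNIV \<phi> = i \<bullet> volt N K \<phi>"
  unfolding inner_vec_def using assms
  by (intro sum.cong) (auto simp: volt_nth mem_coord_space branches_def)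

lemma static_currents_inner:
  "static_currents N \<phi> iL iVs iVc t \<bullet> \<psi> =
     g_R N (volt N {Res} \<phi>) (volt N ({Cap} \<union> V_kinds) \<phi>) iL t \<bullet> volt N {Res} \<psi> +
     iL \<bullet> volt N {Ind} \<psi> + iVs \<bullet> volt N {Vs} \<psi> + iVc \<bullet> volt N {Vc} \<psi> + i_s N t \<bullet> volt N {Is} \<psi> +
     i_c1 N (volt N UNIV \<phi>) iL iVc t \<bullet> volt N {Ic1} \<psi> +
     i_c2 N (volt N ({Cap, Res} \<union> V_kinds) \<phi>) iL iVc t \<bullet> volt N {Ic2} \<psi> +
     i_c3 N (volt N ({Cap, Res} \<union> V_kinds) \<phi>) iL t \<bullet> volt N {Ic3} \<psi> +
     i_c4 N (volt N ({Cap} \<union> V_kinds) \<phi>) iL t \<bullet> volt N {Ic4} \<psi>"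
  by (simp add: static_currents_def inner_add_left inner_inc)

locale admissible_network =
  fixes N :: "('n::finite, 'b::finite) network"
  assumes smooth: "smooth_elements N"
    and well_posed: "well_posed N"
    and passive_el: "passive_elements N"
    and admissible: "admissible_controlled_sources N"
begin

lemma no_self_loop: "tail N b \<noteq> head N b"
  using well_posed by (simp add: well_posed_def)

lemma circulation_CV_zero_on_Vc:
  assumes "j \<in> coord_space (branches N ({Cap} \<union> V_kinds))" "inc N UNIV *v j = 0" "kind_of N b = Vc"
  shows "j $ b = 0"
proof (rule ccontr)
  assume "j $ b \<noteq> 0"
  from circulation_branch_in_loop[OF assms(2) this no_self_loop]
  obtain B where B: "loop_set N B" "b \<in> B" "B \<subseteq> {e. j $ e \<noteq> 0}" by blast
  then have "B \<subseteq> branches N ({Cap} \<union> V_kinds)"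
    using assms(1) unfolding mem_coord_space by blast
  with B assms(3) admissible show False
    unfolding admissible_controlled_sources_def branches_def by blast
qed

lemma Vs_currents_independent:
  assumes i: "i \<in> coord_space (branches N {Vs})" and "\<And>\<phi>. i \<bullet> volt N {Vs} \<phi> = 0"
  shows "i = 0"
proof (rule ccontr)
  assume "i \<noteq> 0"
  then obtain b where b: "i $ b \<noteq> 0" by (auto simp: vec_eq_iff)
  have "inc N UNIV *v i = 0"
    using assms by (simp add: inc_eq_0_iff inner_volt_restrict[OF i])
  from circulation_branch_in_loop[OF this b no_self_loop]
  obtain B where B: "loop_set N B" "b \<in> B" "B \<subseteq> {e. i $ e \<noteq> 0}" by blast
  then have "B \<subseteq> branches N V_kinds"
    using i by (auto simp: mem_coord_space branches_def V_kinds_def)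
  with B(1) well_posed show False by (auto simp: well_posed_def)
qed

text \<open>
  A current through controlled voltage sources that is orthogonal to the kernel of \<open>[A\<^sub>C, A\<^sub>V\<^sub>s]\<^sup>T\<close>
  can be completed by currents through capacitors and independent voltage sources to a circulation.
\<close>

lemma Vc_currents_independent:
  assumes i: "i \<in> coord_space (branches N {Vc})"
    and orth: "\<And>\<phi>. volt N {Cap, Vs} \<phi> = 0 \<Longrightarrow> i \<bullet> volt N {Vc} \<phi> = 0"
  shows "i = 0"
proof -
  have "\<exists>j. inc N {Cap, Vs} *v j = inc N {Vc} *v i"
    by (rule in_range_if_orthogonal_to_kernel) (use orth in \<open>simp only: inner_inc flip: volt_def\<close>)
  then obtain j0 where j0: "inc N {Cap, Vs} *v j0 = inc N {Vc} *v i" by blast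
  define j where "j = restr (branches N {Cap, Vs}) j0"
  have j: "j \<in> coord_space (branches N {Cap, Vs})" by (simp add: j_def restr_in_coord_space)
  have "j0 \<bullet> volt N {Cap, Vs} \<phi> = j \<bullet> volt N {Cap, Vs} \<phi>" for \<phi>
    unfolding inner_vec_def by (intro sum.cong) (auto simp: j_def volt_nth branches_def)
  then have eq: "j \<bullet> volt N {Cap, Vs} \<phi> = i \<bullet> volt N {Vc} \<phi>" for \<phi>
    using j0 by (metis inner_inc)
  have "inc N UNIV *v (i - j) = 0"
    using eq by (simp add: inc_eq_0_iff inner_diff_left inner_volt_restrict[OF i] inner_volt_restrict[OF j])
  moreover have "i - j \<in> coord_space (branches N ({Cap} \<union> V_kinds))"
    using i j by (auto simp: mem_coord_space branches_def V_kinds_def)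
  ultimately have "(i - j) $ b = 0" if "kind_of N b = Vc" for b
    using circulation_CV_zero_on_Vc that by blast
  moreover have "j $ b = 0" if "kind_of N b = Vc" for b
    using j that by (simp add: mem_coord_space branches_def)
  ultimately have "i $ b = 0" if "kind_of N b = Vc" for b using that by force
  then show "i = 0" using i by (auto simp: vec_eq_iff mem_coord_space branches_def)
qed

lemma volt_eq_0_of_paths:
  assumes "\<forall>b\<in>branches N K. has_path N (branches N E) (tail N b) (head N b)" "volt N E \<phi> = 0"
  shows "volt N K \<phi> = 0"
  using potential_eq_along_path[OF _ assms(2)] assms(1)
  by (auto simp: vec_eq_iff volt_nth branches_def)

lemma volt_Ic1: "volt N {Vs} \<phi> = 0 \<Longrightarrow> volt N {Ic1} \<phi> = 0"
  using admissible volt_eq_0_of_paths unfolding admissible_controlled_sources_def by blast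

lemma volt_Ic2: "volt N {Cap, Vs} \<phi> = 0 \<Longrightarrow> volt N {Ic2} \<phi> = 0"
  using admissible volt_eq_0_of_paths unfolding admissible_controlled_sources_def by blast

lemma volt_Ic3: "volt N ({Cap} \<union> V_kinds) \<phi> = 0 \<Longrightarrow> volt N {Ic3} \<phi> = 0"
  using admissible volt_eq_0_of_paths unfolding admissible_controlled_sources_def by blast

lemma connected: "connected_via N UNIV"
  using well_posed by (simp add: well_posed_def)

lemma volt_Ic4:
  assumes "volt N ({Cap, Res} \<union> V_kinds) \<phi> = 0"
  shows "volt N {Ic4} \<phi> = 0"
proof -
  have "volt N {Ic4} \<phi> $ b = 0" for b
  proof (rule ccontr)
    assume "volt N {Ic4} \<phi> $ b \<noteq> 0"
    then have k: "kind_of N b = Ic4" and d: "potential \<phi> (tail N b) \<noteq> potential \<phi> (head N b)"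
      by (auto simp: volt_nth split: if_splits)
    from branch_with_voltage_in_cutset[OF connected d] obtain B where
      B: "cutset N B" "b \<in> B" "B \<subseteq> {e. potential \<phi> (tail N e) \<noteq> potential \<phi> (head N e)}" by blast
    have "e \<in> branches N ({Ind} \<union> I_kinds)" if "e \<in> B" for e
    proof -
      have "kind_of N e \<notin> {Cap, Res} \<union> V_kinds"
        using that B(3) assms by (auto simp: vec_eq_iff volt_nth split: if_splits)
      then show ?thesis
        by (cases "kind_of N e") (auto simp: branches_def V_kinds_def I_kinds_def)
    qed
    with B k admissible show False
      unfolding admissible_controlled_sources_def branches_def by blast
  qed
  then show ?thesis by (simp add: vec_eq_iff)
qed

lemma volt_CRVL_injective:
  assumes "volt N ({Cap, Res} \<union> V_kinds) \<phi> = 0" "volt N {Ind} \<phi> = 0"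
  shows "\<phi> = 0"
proof -
  have "potential \<phi> (tail N b) = potential \<phi> (head N b)" for b
  proof (rule ccontr)
    assume "potential \<phi> (tail N b) \<noteq> potential \<phi> (head N b)"
    from branch_with_voltage_in_cutset[OF connected this] obtain B where
      B: "cutset N B" "B \<subseteq> {e. potential \<phi> (tail N e) \<noteq> potential \<phi> (head N e)}" by blast
    have "e \<in> branches N I_kinds" if "e \<in> B" for e
    proof -
      have "kind_of N e \<notin> {Cap, Res} \<union> V_kinds \<union> {Ind}"
        using that B(2) assms by (auto simp: vec_eq_iff volt_nth split: if_splits)
      then show ?thesis
        by (cases "kind_of N e") (auto simp: branches_def V_kinds_def I_kinds_def)
    qed
    with B(1) well_posed show False unfolding well_posed_def by blast
  qed
  then have "volt N UNIV \<phi> = 0" by (simp add: vec_eq_iff volt_nth)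
  moreover have "has_path N (branches N UNIV) None (Some i)" for i
    using connected by (simp add: connected_via_def branches_def)
  ultimately have "potential \<phi> (Some i) = potential \<phi> None" for i
    by (metis potential_eq_along_path)
  then show ?thesis by (simp add: potential_def vec_eq_iff)
qed

end

section \<open>The projected equations in split coordinates\<close>

lemma transpose_mult_inner: "(transpose M *v r) \<bullet> a = r \<bullet> (M *v a)"
  for M :: "real^'n::finite^'m::finite"
  by (metis inner_matrix_transpose transpose_transpose)

lemma transpose_mult_nth: "(transpose M *v r) $ j = r \<bullet> (M *v axis j 1)"
  for M :: "real^'n::finite^'m::finite"
  by (metis transpose_mult_inner inner_axis' inner_commute mult_1 real_inner_1_left)

lemma restr_transpose_eq_0_iff:
  fixes M :: "real^'n::finite^'m::finite"
  shows "restr J (transpose M *v r) = 0 \<longleftrightarrow> (\<forall>a\<in>coord_space J. r \<bullet> (M *v a) = 0)"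
proof
  assume *: "restr J (transpose M *v r) = 0"
  show "\<forall>a\<in>coord_space J. r \<bullet> (M *v a) = 0"
  proof
    fix a assume a: "a \<in> coord_space J"
    have "(transpose M *v r) \<bullet> a = 0"
      unfolding inner_vec_def
    proof (intro sum.neutral ballI)
      fix j
      show "(transpose M *v r) $ j \<bullet> a $ j = 0"
        using * a by (cases "j \<in> J") (auto simp: restr_eq_0_iff mem_coord_space simp del: transpose_matrix_vector)
    qed
    then show "r \<bullet> (M *v a) = 0" by (simp add: transpose_mult_inner del: transpose_matrix_vector)
  qed
next
  assume *: "\<forall>a\<in>coord_space J. r \<bullet> (M *v a) = 0"
  have "axis j 1 \<in> coord_space J" if "j \<in> J" for j
    using that by (auto simp: mem_coord_space axis_def)
  then show "restr J (transpose M *v r) = 0"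
    using * by (simp add: restr_eq_0_iff transpose_mult_nth del: transpose_matrix_vector)
qed

lemma nodal_part_nth [simp]: "nodal_part w $ i = w $ Inl i"
  by (simp add: nodal_part_def)

lemma branch_part_nth [simp]: "branch_part w $ b = w $ Inr b"
  by (simp add: branch_part_def)

lemma linear_nodal_part: "linear nodal_part"
  by (intro linearI) (simp_all add: vec_eq_iff)

lemma linear_branch_part: "linear branch_part"
  by (intro linearI) (simp_all add: vec_eq_iff)

text \<open>The inverse of the pair of \<^const>\<open>nodal_part\<close> and \<^const>\<open>branch_part\<close>.\<close>

definition join_parts :: "real^'n::finite \<Rightarrow> real^'b::finite \<Rightarrow> real^('n + 'b)" where
  "join_parts a b = (\<chi> k. case k of Inl i \<Rightarrow> a $ i | Inr i \<Rightarrow> b $ i)"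

lemma join_parts_nth [simp]: "join_parts a b $ Inl i = a $ i" "join_parts a b $ Inr j = b $ j"
  by (simp_all add: join_parts_def)

lemma sum_vec_eq_iff: "w = v \<longleftrightarrow> (\<forall>i. w $ Inl i = v $ Inl i) \<and> (\<forall>b. w $ Inr b = v $ Inr b)"
  for w v :: "'a^('n::finite + 'b::finite)"
  unfolding vec_eq_iff by (metis sum.exhaust)

lemma parts_join [simp]: "nodal_part (join_parts a b) = a" "branch_part (join_parts a b) = b"
  by (simp_all add: vec_eq_iff)

lemma join_parts_collapse [simp]: "join_parts (nodal_part w) (branch_part w) = w"
  by (simp add: sum_vec_eq_iff)

text \<open>
  Coordinates \<open>\<phi> = TN a\<close>, \<open>i\<^sub>L = TL b\<close> after the splittings with the independent voltage sources
  (\<open>J1\<close>), the capacitors (\<open>J2\<close>), the controlled voltage sources (\<open>J3\<close>) and the resistors (\<open>J4\<close>);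
  \<open>J5\<close> are the remaining potentials.  The inductor currents with coordinates outside \<open>J'\<close> are
  those invisible to Kirchhoff's current law tested with the remaining potentials.
\<close>

locale split_network = admissible_network N
  for N :: "('n::finite, 'b::finite) network" +
  fixes TN :: "real^'n^'n" and J1 J2 J3 J4 J5 :: "'n set" and TL :: "real^'b^'b" and J' :: "'b set"
  assumes TN_inj: "TN *v a = 0 \<Longrightarrow> a = 0"
    and cover: "J1 \<union> J2 \<union> J3 \<union> J4 \<union> J5 = UNIV"
    and disjoint: "J1 \<inter> J2 = {}" "(J1 \<union> J2) \<inter> J3 = {}" "(J1 \<union> J2 \<union> J3) \<inter> J4 = {}"
      "(J1 \<union> J2 \<union> J3 \<union> J4) \<inter> J5 = {}"
    and flag1: "flag N {Vs} J1 TN"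
    and flag2: "flag N {Cap, Vs} (J1 \<union> J2) TN"
    and flag3: "flag N ({Cap} \<union> V_kinds) (J1 \<union> J2 \<union> J3) TN"
    and flag4: "flag N ({Cap, Res} \<union> V_kinds) (J1 \<union> J2 \<union> J3 \<union> J4) TN"
    and J'_subset: "J' \<subseteq> branches N {Ind}"
    and TL_range: "TL *v b \<in> coord_space (branches N {Ind})"
    and TL_support: "TL *v b = TL *v restr (branches N {Ind}) b"
    and TL_inj: "b \<in> coord_space (branches N {Ind}) \<Longrightarrow> TL *v b = 0 \<Longrightarrow> b = 0"
    and TL_kernel: "b \<in> coord_space (branches N {Ind}) \<Longrightarrow>
      (\<forall>a\<in>coord_space J5. (TL *v b) \<bullet> volt N {Ind} (TN *v a) = 0) \<longleftrightarrow> restr J' b = 0"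
begin

abbreviation "bL \<equiv> branches N {Ind}"
abbreviation "bS \<equiv> branches N {Vs}"
abbreviation "bC \<equiv> branches N {Vc}"

lemma kind_disjoint: "bL \<inter> bS = {}" "bL \<inter> bC = {}" "bS \<inter> bC = {}"
  by (auto simp: branches_def)

text \<open>
  The differential variables \<open>vX\<close>, the algebraic variables \<open>vY\<close> with the purely time-dependent ones
  \<open>vK\<close> among them, and the output variables \<open>vZ\<close>.  The equations at \<open>vX\<close> are solved for the
  derivatives, those at \<open>eE\<close> are the algebraic ones, and those at \<open>vK\<close> determine the outputs.
\<close>

definition vX :: "('n + 'b) set" where "vX = Inl ` J2 \<union> Inr ` (bL - J')"
definition vY :: "('n + 'b) set" where "vY = Inl ` (J1 \<union> J3 \<union> J4) \<union> Inr ` (J' \<union> bC)"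
definition vZ :: "('n + 'b) set" where "vZ = Inl ` J5 \<union> Inr ` bS"
definition vK :: "('n + 'b) set" where "vK = Inl ` J1 \<union> Inr ` J'"
definition eE :: "('n + 'b) set" where "eE = Inl ` (J3 \<union> J4 \<union> J5) \<union> Inr ` (bS \<union> bC)"
definition vU :: "('n + 'b) set" where "vU = range Inl \<union> Inr ` (bL \<union> bS \<union> bC)"

lemma index_sets [simp]:
  "Inl i \<in> vX \<longleftrightarrow> i \<in> J2" "Inr b \<in> vX \<longleftrightarrow> b \<in> bL - J'"
  "Inl i \<in> vY \<longleftrightarrow> i \<in> J1 \<union> J3 \<union> J4" "Inr b \<in> vY \<longleftrightarrow> b \<in> J' \<union> bC"
  "Inl i \<in> vZ \<longleftrightarrow> i \<in> J5" "Inr b \<in> vZ \<longleftrightarrow> b \<in> bS"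
  "Inl i \<in> vK \<longleftrightarrow> i \<in> J1" "Inr b \<in> vK \<longleftrightarrow> b \<in> J'"
  "Inl i \<in> eE \<longleftrightarrow> i \<in> J3 \<union> J4 \<union> J5" "Inr b \<in> eE \<longleftrightarrow> b \<in> bS \<union> bC"
  "Inl i \<in> vU" "Inr b \<in> vU \<longleftrightarrow> b \<in> bL \<union> bS \<union> bC"
  by (auto simp: vX_def vY_def vZ_def vK_def eE_def vU_def)

lemma J5_iff: "i \<in> J5 \<longleftrightarrow> i \<notin> J1 \<and> i \<notin> J2 \<and> i \<notin> J3 \<and> i \<notin> J4"
  using cover disjoint by blast

lemma set_eq_sumI: "(\<And>i. Inl i \<in> A \<longleftrightarrow> Inl i \<in> B) \<Longrightarrow> (\<And>b. Inr b \<in> A \<longleftrightarrow> Inr b \<in> B) \<Longrightarrow> A = B"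
  by (metis set_eqI sum.exhaust)

lemma partition_variables:
  "vX \<union> vY \<union> vZ = vU" "vX \<inter> vY = {}" "vX \<inter> vZ = {}" "vY \<inter> vZ = {}"
  using J'_subset disjoint kind_disjoint by (intro set_eq_sumI; auto simp: J5_iff)+

lemma partition_equations:
  "vX \<union> eE \<union> vK = vU" "vX \<inter> eE = {}" "vX \<inter> vK = {}" "eE \<inter> vK = {}"
  using J'_subset disjoint kind_disjoint by (intro set_eq_sumI; auto simp: J5_iff)+

lemma vK_subset: "vK \<subseteq> vY"
  by (auto simp: vK_def vY_def)

text \<open>Nodal potentials, inductor currents and voltage source currents in terms of the new unknowns.\<close>

definition pot :: "real^('n + 'b) \<Rightarrow> real^'n" where "pot w = TN *v nodal_part w"
definition cur :: "real^('n + 'b) \<Rightarrow> real^'b" where "cur w = TL *v branch_part w"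

lemma linear_pot: "linear pot"
  unfolding pot_def using linear_compose[OF linear_nodal_part matrix_vector_mul_linear[of TN]]
  by (simp add: o_def)

lemma linear_cur: "linear cur"
  unfolding cur_def using linear_compose[OF linear_branch_part matrix_vector_mul_linear[of TL]]
  by (simp add: o_def)

lemma cur_in_coord_space: "cur w \<in> coord_space bL"
  by (simp add: cur_def TL_range)

abbreviation iS :: "real^('n + 'b) \<Rightarrow> real^'b" where "iS w \<equiv> restr bS (branch_part w)"
abbreviation iC :: "real^('n + 'b) \<Rightarrow> real^'b" where "iC w \<equiv> restr bC (branch_part w)"

lemma TN_inverse:
  obtains g where "linear g" "\<And>a. g (TN *v a) = a" "\<And>\<phi>. TN *v g \<phi> = \<phi>"
proof (rule coord_linear_inverse[OF matrix_vector_mul_linear[of TN], of UNIV UNIV])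
  show "a = 0" if "TN *v a = 0" for a by (rule TN_inj[OF that])
  show "TN *v a \<in> coord_space UNIV" for a by (simp add: mem_coord_space)
qed (use that in \<open>auto simp: mem_coord_space\<close>)

lemma TL_inverse:
  obtains g where "linear g" "\<And>i. g i \<in> coord_space bL"
    "\<And>b. b \<in> coord_space bL \<Longrightarrow> g (TL *v b) = b" "\<And>i. i \<in> coord_space bL \<Longrightarrow> TL *v g i = i"
proof (rule coord_linear_inverse[OF matrix_vector_mul_linear[of TL], of bL bL])
  show "b = 0" if "b \<in> coord_space bL" "TL *v b = 0" for b by (rule TL_inj[OF that])
  show "TL *v b \<in> coord_space bL" for b by (rule TL_range)
qed (use that in auto)

text \<open>
  The capacitor currents \<open>C A\<^sub>C\<^sup>T \<phi>'\<close>, and the left-hand sides of Kirchhoff's current law and of the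
  inductor equations before projection, with the time derivatives resolved.
\<close>

definition cap_currents :: "real^('n + 'b) \<Rightarrow> real^('n + 'b) \<Rightarrow> real^'b" where
  "cap_currents w' w = jacobian (q_C N) (at (volt N {Cap} (pot w))) *v volt N {Cap} (pot w')"

definition kcl :: "real^('n + 'b) \<Rightarrow> real^('n + 'b) \<Rightarrow> real \<Rightarrow> real^'n" where
  "kcl w' w t = inc N {Cap} *v cap_currents w' w + static_currents N (pot w) (cur w) (iS w) (iC w) t"

definition flux :: "real^('n + 'b) \<Rightarrow> real^('n + 'b) \<Rightarrow> real^'b" where
  "flux w' w = jacobian (phi_L N) (at (cur w)) *v cur w' - volt N {Ind} (pot w)"

abbreviation F :: "real^('n + 'b) \<Rightarrow> real^('n + 'b) \<Rightarrow> real \<Rightarrow> real^('n + 'b)" where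
  "F \<equiv> projected_mna N TN TL"

lemma mna_unknowns_eq: "mna_unknowns N TN TL w = (pot w, cur w, iS w, iC w)"
  by (simp add: mna_unknowns_def pot_def cur_def)

lemma F_Inl: "F w' w t $ Inl j = (transpose TN *v kcl w' w t) $ j"
  by (simp add: projected_mna_def mna_unknowns_eq kcl_def cap_currents_def)

lemma F_Inr: "F w' w t $ Inr b =
    (if b \<in> bL then (transpose TL *v flux w' w) $ b
     else if b \<in> bS then vs_residual N (pot w) t $ b
     else if b \<in> bC then vc_residual N (pot w) (cur w) t $ b else 0)"
  by (simp add: projected_mna_def mna_unknowns_eq flux_def branches_def)

text \<open>
  Kirchhoff's current law tested with potentials that put no voltage on the independent voltage
  sources: the currents through these and through the first group of controlled current sources
  drop out.
\<close>

lemma kcl_inner: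
  assumes "volt N {Vs} \<psi> = 0"
  shows "kcl w' w t \<bullet> \<psi> = cap_currents w' w \<bullet> volt N {Cap} \<psi> +
     g_R N (volt N {Res} (pot w)) (volt N ({Cap} \<union> V_kinds) (pot w)) (cur w) t \<bullet> volt N {Res} \<psi> +
     cur w \<bullet> volt N {Ind} \<psi> + iC w \<bullet> volt N {Vc} \<psi> + i_s N t \<bullet> volt N {Is} \<psi> +
     i_c2 N (volt N ({Cap, Res} \<union> V_kinds) (pot w)) (cur w) (iC w) t \<bullet> volt N {Ic2} \<psi> +
     i_c3 N (volt N ({Cap, Res} \<union> V_kinds) (pot w)) (cur w) t \<bullet> volt N {Ic3} \<psi> +
     i_c4 N (volt N ({Cap} \<union> V_kinds) (pot w)) (cur w) t \<bullet> volt N {Ic4} \<psi>"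
  using volt_Ic1[OF assms] assms
  by (simp add: kcl_def inner_add_left inner_inc static_currents_inner)

lemma flagD: "flag N E H TN \<Longrightarrow> volt N E (TN *v a) = 0 \<longleftrightarrow> (\<forall>i\<in>H. a $ i = 0)"
  by (simp add: flag_def restr_eq_0_iff)

lemma test_J2345: "a \<in> coord_space (J2 \<union> J3 \<union> J4 \<union> J5) \<Longrightarrow> volt N {Vs} (TN *v a) = 0"
  unfolding flagD[OF flag1] using disjoint by (auto simp: mem_coord_space)

lemma test_J345: "a \<in> coord_space (J3 \<union> J4 \<union> J5) \<Longrightarrow> volt N {Cap, Vs} (TN *v a) = 0"
  unfolding flagD[OF flag2] using disjoint by (auto simp: mem_coord_space)

lemma test_J45: "a \<in> coord_space (J4 \<union> J5) \<Longrightarrow> volt N ({Cap} \<union> V_kinds) (TN *v a) = 0"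
  unfolding flagD[OF flag3] using disjoint by (auto simp: mem_coord_space)

lemma test_J5: "a \<in> coord_space J5 \<Longrightarrow> volt N ({Cap, Res} \<union> V_kinds) (TN *v a) = 0"
  unfolding flagD[OF flag4] using disjoint by (auto simp: mem_coord_space)

lemma axis_in_coord_space: "j \<in> J \<Longrightarrow> axis j 1 \<in> coord_space J"
  by (auto simp: mem_coord_space axis_def)

subsection \<open>Dependence on the variables\<close>

lemma volt_pot_cong:
  assumes "\<And>i. i \<notin> J5 \<Longrightarrow> w $ Inl i = v $ Inl i" "K \<subseteq> {Cap, Res} \<union> V_kinds"
  shows "volt N K (pot w) = volt N K (pot v)"
proof -
  have "nodal_part w - nodal_part v \<in> coord_space J5"
    using assms(1) by (simp add: mem_coord_space)
  from volt_eq_0_mono[OF test_J5[OF this] assms(2)] show ?thesis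
    by (simp add: pot_def matrix_vector_mult_diff_distrib volt_diff)
qed

lemma cur_cong:
  assumes "\<And>b. b \<in> bL \<Longrightarrow> w $ Inr b = v $ Inr b"
  shows "cur w = cur v"
proof -
  have "restr bL (branch_part w) = restr bL (branch_part v)"
    using assms by (simp add: vec_eq_iff)
  then show ?thesis unfolding cur_def by (metis TL_support)
qed

text \<open>Derivatives enter only through \<open>A\<^sub>C\<^sup>T \<phi>'\<close> and \<open>i\<^sub>L'\<close>, so those at \<open>J3\<close> to \<open>J5\<close> do not matter.\<close>

lemma F_deriv_cong:
  assumes "\<And>k. k \<in> vX \<union> vK \<Longrightarrow> w' $ k = v' $ k"
  shows "F w' w t = F v' w t"
proof -
  have a: "w' $ Inl i = v' $ Inl i" if "i \<in> J1 \<union> J2" for i using assms[of "Inl i"] that by auto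
  have b: "w' $ Inr b = v' $ Inr b" if "b \<in> bL" for b using assms[of "Inr b"] that by auto
  have "nodal_part w' - nodal_part v' \<in> coord_space (J3 \<union> J4 \<union> J5)"
    using a cover by (auto simp: mem_coord_space)
  from volt_eq_0_mono[OF test_J345[OF this], of "{Cap}"]
  have "volt N {Cap} (pot w') = volt N {Cap} (pot v')"
    by (simp add: pot_def matrix_vector_mult_diff_distrib volt_diff)
  then have "kcl w' w t = kcl v' w t" by (simp add: kcl_def cap_currents_def)
  moreover have "flux w' w = flux v' w" using cur_cong[OF b] by (simp add: flux_def)
  ultimately show ?thesis by (simp add: sum_vec_eq_iff F_Inl F_Inr)
qed

text \<open>
  The output variables do not enter the differential and the algebraic equations: all voltages in
  these are unaffected by \<open>J5\<close> except those in the dropped first group of controlled current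
  sources and the inductor voltages, which are orthogonal to the columns of \<open>TL\<close> outside \<open>J'\<close>.
\<close>

lemma F_DE_cong:
  assumes agree: "\<And>k. k \<in> vX \<union> vY \<Longrightarrow> w $ k = v $ k" and k: "k \<in> vX \<union> eE"
  shows "F w' w t $ k = F w' v t $ k"
proof -
  have a: "w $ Inl i = v $ Inl i" if "i \<notin> J5" for i using agree[of "Inl i"] that cover by auto
  have b: "w $ Inr b = v $ Inr b" if "b \<in> bL \<union> bC" for b using agree[of "Inr b"] that by auto
  have V: "volt N K (pot w) = volt N K (pot v)" if "K \<subseteq> {Cap, Res} \<union> V_kinds" for K
    using volt_pot_cong[OF a that] .
  have c: "cur w = cur v" by (intro cur_cong b) simp
  have iC: "iC w = iC v" using b by (simp add: vec_eq_iff)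
  note V' = V[of "{Cap}"] V[of "{Res}"] V[of "{Vs}"] V[of "{Vc}"] V[of "{Cap, Vs}"]
    V[of "{Cap} \<union> V_kinds"] V[of "{Cap, Res} \<union> V_kinds"]
  show ?thesis
  proof (cases k)
    case (Inl j)
    then have "axis j 1 \<in> coord_space (J2 \<union> J3 \<union> J4 \<union> J5)"
      using k by (intro axis_in_coord_space) auto
    note t = test_J2345[OF this]
    have "cap_currents w' w = cap_currents w' v" using V' by (simp add: cap_currents_def)
    then show ?thesis
      unfolding Inl F_Inl transpose_mult_nth kcl_inner[OF t] c iC using V' by (simp add: V_kinds_def)
  next
    case (Inr b)
    show ?thesis
    proof (cases "b \<in> bL")
      case True
      have "nodal_part w - nodal_part v \<in> coord_space J5"
        using a by (simp add: mem_coord_space)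
      moreover have "b \<notin> J'" using k Inr True kind_disjoint by auto
      then have "restr J' (axis b 1) = 0" by (auto simp: vec_eq_iff axis_def)
      then have "\<forall>a\<in>coord_space J5. (TL *v axis b 1) \<bullet> volt N {Ind} (TN *v a) = 0"
        using TL_kernel[OF axis_in_coord_space[OF True]] by simp
      ultimately have "(TL *v axis b 1) \<bullet> volt N {Ind} (TN *v (nodal_part w - nodal_part v)) = 0"
        by blast
      then have "(TL *v axis b 1) \<bullet> volt N {Ind} (pot w) = (TL *v axis b 1) \<bullet> volt N {Ind} (pot v)"
        by (simp add: pot_def matrix_vector_mult_diff_distrib volt_diff inner_diff_right)
      then show ?thesis
        using True unfolding Inr F_Inr transpose_mult_nth flux_def c
        by (simp add: inner_diff_left inner_diff_right inner_commute)
    next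
      case False
      then show ?thesis using V' unfolding Inr F_Inr
        by (simp add: vs_residual_def vc_residual_def c V_kinds_def)
    qed
  qed
qed

lemma F_E_no_derivative:
  assumes "k \<in> eE"
  shows "F w' w t $ k = F 0 w t $ k"
proof (cases k)
  case (Inl j)
  then have "axis j 1 \<in> coord_space (J3 \<union> J4 \<union> J5)"
    using assms by (intro axis_in_coord_space) auto
  note t = test_J345[OF this]
  have "volt N {Vs} (TN *v axis j 1) = 0" "volt N {Cap} (TN *v axis j 1) = 0"
    by (rule volt_eq_0_mono[OF t]; simp)+
  then show ?thesis unfolding Inl F_Inl transpose_mult_nth by (simp add: kcl_inner)
next
  case (Inr b)
  then have "b \<notin> bL" using assms kind_disjoint by auto
  then show ?thesis unfolding Inr F_Inr by simp
qed

end

section \<open>The differential part\<close>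

text \<open>Cramer's rule shows that the solution depends continuously on the parameter.\<close>

lemma injective_family_solution:
  fixes M :: "'p::topological_space \<Rightarrow> real^'k::finite^'k" and r :: "'p \<Rightarrow> real^'k"
  assumes M: "\<And>v. continuous_on UNIV (\<lambda>p. M p *v v)" and r: "continuous_on UNIV r"
    and inj: "\<And>p v. M p *v v = 0 \<Longrightarrow> v = 0"
  obtains f where "continuous_on UNIV f" "\<And>p u. M p *v u = r p \<longleftrightarrow> u = f p"
proof -
  define f where "f p = (\<chi> k. det (\<chi> i j. if j = k then r p $ i else M p $ i $ j) / det (M p))" for p
  have det: "det (M p) \<noteq> 0" for p
  proof -
    have "\<exists>B. B ** M p = mat 1" unfolding matrix_left_invertible_ker using inj by blast
    then show ?thesis by (simp add: invertible_left_inverse flip: invertible_det_nz)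
  qed
  have ent: "continuous_on UNIV (\<lambda>p. M p $ i $ j)" for i j
  proof -
    have eq: "(\<lambda>p. M p $ i $ j) = (\<lambda>p. (M p *v axis j 1) $ i)"
      by (simp add: matrix_vector_mult_basis column_def)
    show ?thesis unfolding eq by (intro continuous_on_component M)
  qed
  have cdet: "continuous_on UNIV (\<lambda>p. det (A p))" if "\<And>i j. continuous_on UNIV (\<lambda>p. A p $ i $ j)"
    for A :: "'p \<Rightarrow> real^'k^'k"
    unfolding det_def by (intro continuous_intros that)
  have "continuous_on UNIV (\<lambda>p. (\<chi> i j. if j = k then r p $ i else M p $ i $ j) $ i $ j)" for k i j
    using ent r by (cases "j = k") (auto intro: continuous_intros)
  then have "continuous_on UNIV f"
    unfolding f_def using det by (intro continuous_intros cdet ent) auto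
  moreover have "M p *v u = r p \<longleftrightarrow> u = f p" for p u
    unfolding f_def by (rule cramer[OF det])
  ultimately show ?thesis by (rule that)
qed

lemma inner_parts: "w \<bullet> v = nodal_part w \<bullet> nodal_part v + branch_part w \<bullet> branch_part v"
  for w v :: "real^('n::finite + 'b::finite)"
proof -
  have "w \<bullet> v = (\<Sum>k\<in>UNIV <+> UNIV. w $ k \<bullet> v $ k)"
    by (simp add: inner_vec_def)
  also have "\<dots> = (\<Sum>i\<in>UNIV. w $ Inl i \<bullet> v $ Inl i) + (\<Sum>b\<in>UNIV. w $ Inr b \<bullet> v $ Inr b)"
    by (simp add: sum.Plus del: UNIV_Plus_UNIV)
  finally show ?thesis by (simp add: inner_vec_def)
qed

lemma linear_join_parts: "linear (\<lambda>p. join_parts (fst p) (snd p))"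
  by (intro linearI) (simp_all add: sum_vec_eq_iff)

lemma continuous_on_join_parts:
  assumes "continuous_on S a" "continuous_on S b"
  shows "continuous_on S (\<lambda>p. join_parts (a p) (b p))"
  using continuous_on_linear[OF linear_join_parts continuous_on_Pair[OF assms]] by simp

context split_network
begin

text \<open>The part of the projected equations that is linear in the derivatives.\<close>

definition mass :: "real^('n + 'b) \<Rightarrow> real^('n + 'b) \<Rightarrow> real^('n + 'b)" where
  "mass w u = join_parts (transpose TN *v (inc N {Cap} *v cap_currents u w))
     (restr bL (transpose TL *v (jacobian (phi_L N) (at (cur w)) *v cur u)))"

lemma cap_currents_linear: "linear (\<lambda>u. cap_currents u w)"
  unfolding cap_currents_def
  by (intro linearI) (simp_all add: linear_add[OF linear_pot] linear_scale[OF linear_pot]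
      volt_add volt_scaleR matrix_vector_right_distrib matrix_vector_mult_scaleR)

lemma linear_mass: "linear (mass w)"
  by (intro linearI) (simp_all add: sum_vec_eq_iff mass_def linear_add[OF cap_currents_linear]
      linear_scale[OF cap_currents_linear] linear_add[OF linear_cur] linear_scale[OF linear_cur]
      matrix_vector_right_distrib matrix_vector_mult_scaleR del: transpose_matrix_vector)

lemma F_affine: "F w' w t = mass w w' + F 0 w t"
  by (auto simp: sum_vec_eq_iff F_Inl F_Inr mass_def kcl_def flux_def linear_0[OF cap_currents_linear]
      linear_0[OF linear_cur] matrix_vector_right_distrib matrix_vector_mult_diff_distrib
      linear_neg[OF matrix_vector_mul_linear]
      simp del: transpose_matrix_vector)

lemma mass_pos:
  assumes u: "u \<in> coord_space vX" "u \<noteq> 0"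
  shows "u \<bullet> mass w u > 0"
proof -
  let ?v = "volt N {Cap} (pot u)"
  let ?i = "cur u"
  have nod: "nodal_part u \<in> coord_space J2" and bra: "branch_part u \<in> coord_space (bL - J')"
    using u(1) by (auto simp: mem_coord_space)
  have "u \<bullet> mass w u = nodal_part u \<bullet> (transpose TN *v (inc N {Cap} *v cap_currents u w)) +
      branch_part u \<bullet> restr bL (transpose TL *v (jacobian (phi_L N) (at (cur w)) *v ?i))"
    by (simp add: inner_parts mass_def del: transpose_matrix_vector)
  also have "branch_part u \<bullet> restr bL z = branch_part u \<bullet> z" for z
    using bra unfolding inner_vec_def by (intro sum.cong) (auto simp: mem_coord_space)
  also have "nodal_part u \<bullet> (transpose TN *v (inc N {Cap} *v cap_currents u w)) = cap_currents u w \<bullet> ?v"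
    by (simp add: inner_commute[of "nodal_part u"] transpose_mult_inner inner_inc pot_def
        del: transpose_matrix_vector)
  also have "branch_part u \<bullet> (transpose TL *v z) = z \<bullet> ?i" for z
    by (simp add: inner_commute[of "branch_part u"] transpose_mult_inner cur_def
        del: transpose_matrix_vector)
  finally have eq: "u \<bullet> mass w u = ?v \<bullet> (jacobian (q_C N) (at (volt N {Cap} (pot w))) *v ?v) +
      ?i \<bullet> (jacobian (phi_L N) (at (cur w)) *v ?i)"
    by (simp add: cap_currents_def inner_commute)
  have C: "?v \<bullet> (jacobian (q_C N) (at (volt N {Cap} (pot w))) *v ?v) > 0" if "?v \<noteq> 0"
    using passive_el volt_in_coord_space that
    unfolding passive_elements_def pos_def_block_def by blast
  have L: "?i \<bullet> (jacobian (phi_L N) (at (cur w)) *v ?i) > 0" if "?i \<noteq> 0"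
    using passive_el cur_in_coord_space that
    unfolding passive_elements_def pos_def_block_def by blast
  have "?v \<noteq> 0 \<or> ?i \<noteq> 0"
  proof (rule ccontr)
    assume "\<not> (?v \<noteq> 0 \<or> ?i \<noteq> 0)"
    then have v0: "?v = 0" and i0: "?i = 0" by auto
    have "nodal_part u \<in> coord_space (J2 \<union> J3 \<union> J4 \<union> J5)"
      using nod by (simp add: mem_coord_space)
    from test_J2345[OF this] have "volt N {Cap, Vs} (pot u) = 0"
      using v0 volt_Un_eq_0[of N "{Cap}" "{Vs}" "pot u"] by (simp add: pot_def insert_commute)
    then have "\<forall>i\<in>J1 \<union> J2. nodal_part u $ i = 0"
      unfolding pot_def flagD[OF flag2] .
    moreover have "branch_part u = 0"
    proof (rule TL_inj)
      show "branch_part u \<in> coord_space bL" using bra by (auto simp: mem_coord_space)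
      show "TL *v branch_part u = 0" using i0 by (simp add: cur_def)
    qed
    ultimately have "u = 0"
      using nod by (auto simp: sum_vec_eq_iff mem_coord_space vec_eq_iff)
    with u(2) show False by simp
  qed
  moreover have "?v \<bullet> (jacobian (q_C N) (at (volt N {Cap} (pot w))) *v ?v) \<ge> 0" using C by force
  moreover have "?i \<bullet> (jacobian (phi_L N) (at (cur w)) *v ?i) \<ge> 0" using L by force
  ultimately show ?thesis unfolding eq using C L by (metis add_nonneg_pos add_pos_nonneg)
qed

lemma smoothD: "cont_diff (q_C N)" "cont_diff (phi_L N)" "cont_diff (\<lambda>(v, w, i, t). g_R N v w i t)"
  "cont_diff (v_s N)" "cont_diff (i_s N)" "cont_diff (\<lambda>(v, i, t). v_c N v i t)"
  "cont_diff (\<lambda>(v, i, j, t). i_c1 N v i j t)" "cont_diff (\<lambda>(v, i, j, t). i_c2 N v i j t)"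
  "cont_diff (\<lambda>(v, i, t). i_c3 N v i t)" "cont_diff (\<lambda>(v, i, t). i_c4 N v i t)"
  using smooth by (auto simp: smooth_elements_def)

lemma continuous_on_mass:
  assumes "continuous_on S w" "continuous_on S u"
  shows "continuous_on S (\<lambda>p. mass (w p) (u p))"
  unfolding mass_def cap_currents_def
  by (intro continuous_on_join_parts
      continuous_on_linear[OF linear_restr]
      continuous_on_linear[OF matrix_vector_mul_linear]
      continuous_on_jacobian_mult smoothD
      continuous_on_linear[OF linear_cur] continuous_on_linear[OF volt_linear]
      continuous_on_linear[OF linear_pot] assms)

lemma cont_diff_kcl:
  assumes w: "cont_diff w" and t: "cont_diff t"
  shows "cont_diff (\<lambda>p. kcl 0 (w p) (t p))"
proof -
  have lin: "cont_diff (\<lambda>p. pot (w p))" "cont_diff (\<lambda>p. cur (w p))" "cont_diff (\<lambda>p. iS (w p))"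
    "cont_diff (\<lambda>p. iC (w p))"
    by (rule cont_diff_lin[OF linear_pot w] cont_diff_lin[OF linear_cur w]
        cont_diff_lin[OF linear_restr cont_diff_lin[OF linear_branch_part w]])+
  have v: "cont_diff (\<lambda>p. volt N K (pot (w p)))" for K
    by (rule cont_diff_lin[OF volt_linear lin(1)])
  note M = cont_diff_lin[OF matrix_vector_mul_linear]
  show ?thesis
    unfolding kcl_def static_currents_def linear_0[OF cap_currents_linear]
    by (intro cont_diff_add M cont_diff_const lin v t
        cont_diff_compose4[OF smoothD(3)] cont_diff_compose[OF smoothD(5)]
        cont_diff_compose4[OF smoothD(7)] cont_diff_compose4[OF smoothD(8)]
        cont_diff_compose3[OF smoothD(9)] cont_diff_compose3[OF smoothD(10)])
qed

lemma cont_diff_F: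
  assumes w: "cont_diff w" and t: "cont_diff t"
  shows "cont_diff (\<lambda>p. F 0 (w p) (t p))"
proof (rule cont_diff_vec)
  fix k
  have lin: "cont_diff (\<lambda>p. pot (w p))" "cont_diff (\<lambda>p. cur (w p))"
    by (rule cont_diff_lin[OF linear_pot w] cont_diff_lin[OF linear_cur w])+
  have v: "cont_diff (\<lambda>p. volt N K (pot (w p)))" for K
    by (rule cont_diff_lin[OF volt_linear lin(1)])
  have nth: "cont_diff (\<lambda>p. z p $ j)" if "cont_diff z" for z :: "_ \<Rightarrow> real^'x::finite" and j
    by (rule cont_diff_linear[OF bounded_linear_vec_nth that])
  show "cont_diff (\<lambda>p. F 0 (w p) (t p) $ k)"
  proof (cases k)
    case (Inl j)
    show ?thesis unfolding Inl F_Inl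
      by (intro nth cont_diff_lin[OF matrix_vector_mul_linear] cont_diff_kcl w t)
  next
    case (Inr b)
    have "cont_diff (\<lambda>p. vs_residual N (pot (w p)) (t p))"
      unfolding vs_residual_def
      by (intro cont_diff_diff v cont_diff_lin[OF linear_restr] cont_diff_compose[OF smoothD(4)] t)
    moreover have "cont_diff (\<lambda>p. vc_residual N (pot (w p)) (cur (w p)) (t p))"
      unfolding vc_residual_def
      by (intro cont_diff_diff v cont_diff_lin[OF linear_restr] cont_diff_compose3[OF smoothD(6)] t lin)
    moreover have "cont_diff (\<lambda>p. transpose TL *v flux 0 (w p))"
      unfolding flux_def linear_0[OF linear_cur] matrix_vector_mult_0_right
      by (intro cont_diff_lin[OF matrix_vector_mul_linear] cont_diff_diff v cont_diff_const)
    ultimately show ?thesis unfolding Inr F_Inr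
      by (cases "b \<in> bL"; cases "b \<in> bS"; cases "b \<in> bC")
        (simp_all add: nth cont_diff_const del: transpose_matrix_vector)
  qed
qed

text \<open>
  As the mass matrix is positive definite on the differential variables, the equations there can be
  solved for \<open>x'\<close>; padding with the identity makes the mass matrix regular on the whole space.
\<close>

lemma explicit_differential_equation:
  assumes \<tau>': "continuous_on UNIV \<tau>'"
  obtains f where "continuous_on UNIV (\<lambda>(x, y, t). f x y t)" "\<And>x y t. f x y t \<in> coord_space vX"
    "\<And>w' w t. restr vK w' = \<tau>' t \<Longrightarrow>
       restr vX (F w' w t) = 0 \<longleftrightarrow> restr vX w' = f (restr vX w) (restr vY w) t"
proof -
  define A where "A w u = restr vX (mass w (restr vX u)) + restr (- vX) u" for w u
  have linA: "linear (A w)" for w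
    unfolding A_def
    by (intro linearI) (simp_all add: restr_add restr_scaleR linear_add[OF linear_mass]
        linear_scale[OF linear_mass] scaleR_add_right)
  define M where "M = (\<lambda>(x, y, t :: real). matrix (A (x + y)))"
  define r where "r = (\<lambda>(x, y, t). - restr vX (F (\<tau>' t) (x + y) t))"
  have M_mult: "M p *v v = A (fst p + fst (snd p)) v" for p v
    using linA by (simp add: M_def matrix_works split_beta)
  have restrX_A: "restr (- vX) (A w u) = restr (- vX) u" for w u
    by (simp add: A_def restr_add restr_restr)
  obtain ff where ff: "continuous_on UNIV ff" "\<And>p u. M p *v u = r p \<longleftrightarrow> u = ff p"
  proof (rule injective_family_solution[of M r])
    show "continuous_on UNIV (\<lambda>p. M p *v v)" for v
      unfolding M_mult A_def
      by (intro continuous_intros continuous_on_linear[OF linear_restr] continuous_on_mass)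
    have xy: "bounded_linear (\<lambda>p::(real^('n + 'b)) \<times> (real^('n + 'b)) \<times> real. fst p + fst (snd p))"
      and t: "bounded_linear (\<lambda>p::(real^('n + 'b)) \<times> (real^('n + 'b)) \<times> real. snd (snd p))"
      by (intro bounded_linear_add bounded_linear_fst_comp bounded_linear_snd_comp bounded_linear_ident)+
    have "continuous_on UNIV (\<lambda>p. F 0 (fst p + fst (snd p)) (snd (snd p)))"
      by (intro cont_diff_continuous cont_diff_F cont_diff_bounded_linear xy t)
    moreover have "continuous_on UNIV (\<lambda>p. mass (fst p + fst (snd p)) (\<tau>' (snd (snd p))))"
      by (intro continuous_on_mass continuous_intros continuous_on_compose2[OF \<tau>']) auto
    ultimately show "continuous_on UNIV r"
      unfolding r_def split_beta F_affine[of "\<tau>' _"]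
      by (intro continuous_intros continuous_on_linear[OF linear_restr])
    show "v = 0" if "M p *v v = 0" for p v
    proof (rule ccontr)
      assume "v \<noteq> 0"
      let ?w = "fst p + fst (snd p)"
      have A0: "A ?w v = 0" using that by (simp add: M_mult)
      then have v: "v = restr vX v" using restrX_A[of ?w v] restr_split[of vX v] by simp
      have "restr vX v \<bullet> mass ?w (restr vX v) = restr vX v \<bullet> A ?w v"
        unfolding A_def inner_vec_def by (intro sum.cong) auto
      with A0 mass_pos[of v ?w] v \<open>v \<noteq> 0\<close> show False
        by (metis inner_zero_right less_irrefl restr_in_coord_space subset_refl)
    qed
  qed blast
  have sol: "A (x + y) u = - restr vX (F (\<tau>' t) (x + y) t) \<longleftrightarrow> u = ff (x, y, t)" for x y t u
    using ff(2)[of "(x, y, t)" u] by (simp add: M_mult r_def)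
  show ?thesis
  proof (rule that[of "\<lambda>x y t. ff (x, y, t)"])
    show "continuous_on UNIV (\<lambda>(x, y, t). ff (x, y, t))" using ff(1) by (simp add: split_beta)
    show "ff (x, y, t) \<in> coord_space vX" for x y t
    proof -
      have "restr (- vX) (ff (x, y, t)) = restr (- vX) (- restr vX (F (\<tau>' t) (x + y) t))"
        using sol[of x y "ff (x, y, t)" t] restrX_A by metis
      then show ?thesis by (auto simp: mem_coord_space vec_eq_iff split: if_splits)
    qed
    fix w' w t assume K: "restr vK w' = \<tau>' t"
    let ?w = "restr vX w + restr vY w"
    have disj: "vX \<inter> vK = {}" using partition_equations by auto
    have "F w' w t = F (restr vX w' + \<tau>' t) w t"
      by (rule F_deriv_cong) (use disj in \<open>auto simp flip: K\<close>)
    then have "restr vX (F w' w t) = restr vX (F (restr vX w' + \<tau>' t) w t)" by simp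
    also have "\<dots> = restr vX (F (restr vX w' + \<tau>' t) ?w t)"
    proof -
      have "F (restr vX w' + \<tau>' t) w t $ k = F (restr vX w' + \<tau>' t) ?w t $ k" if "k \<in> vX" for k
        by (rule F_DE_cong) (use that partition_variables in auto)
      then show ?thesis by (simp add: vec_eq_iff)
    qed
    also have "\<dots> = A ?w (restr vX w') + restr vX (F (\<tau>' t) ?w t)"
      by (simp add: F_affine[of "restr vX w' + \<tau>' t"] F_affine[of "\<tau>' t"] A_def restr_restr restr_add
          linear_add[OF linear_mass])
    finally show "restr vX (F w' w t) = 0 \<longleftrightarrow> restr vX w' = ff (restr vX w, restr vY w, t)"
      by (simp add: add_eq_0_iff2 flip: sol)
  qed
qed

end

section \<open>The algebraic part\<close>

context split_network
begin

lemma TN_surj: "\<exists>a. \<phi> = TN *v a"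
  using TN_inverse by metis

text \<open>
  Voltages of the independent sources determine the coordinates \<open>J1\<close>, and conversely currents
  through them are determined by their contributions to Kirchhoff's law there.  The coordinates \<open>J'\<close>
  of the inductor currents are related to Kirchhoff's law at \<open>J5\<close>, and the coordinates \<open>J5\<close> of the
  potentials to the inductor equations at \<open>J'\<close>, in the same way.
\<close>

definition source_volt :: "real^'n \<Rightarrow> real^'b" where "source_volt a = volt N {Vs} (TN *v a)"
definition source_kcl :: "real^'b \<Rightarrow> real^'n" where
  "source_kcl i = restr J1 (transpose TN *v (inc N {Vs} *v i))"
definition coil_kcl :: "real^'b \<Rightarrow> real^'n" where
  "coil_kcl b = restr J5 (transpose TN *v (inc N {Ind} *v (TL *v b)))"
definition coil_volt :: "real^'n \<Rightarrow> real^'b" where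
  "coil_volt a = restr J' (transpose TL *v volt N {Ind} (TN *v a))"

lemma linear_sources: "linear source_volt" "linear source_kcl" "linear coil_kcl" "linear coil_volt"
  unfolding source_volt_def[abs_def] source_kcl_def[abs_def] coil_kcl_def[abs_def] coil_volt_def[abs_def]
  by (intro linearI; simp add: matrix_vector_right_distrib matrix_vector_mult_scaleR volt_add
      volt_scaleR restr_add restr_scaleR del: transpose_matrix_vector)+

lemma source_volt_range: "source_volt a \<in> coord_space bS"
  by (simp add: source_volt_def volt_in_coord_space)

lemma source_volt_inj: "a \<in> coord_space J1 \<Longrightarrow> source_volt a = 0 \<Longrightarrow> a = 0"
  unfolding source_volt_def flagD[OF flag1] by (auto simp: mem_coord_space vec_eq_iff)

lemma source_kcl_range: "source_kcl i \<in> coord_space J1"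
  by (simp add: source_kcl_def restr_in_coord_space)

lemma source_kcl_inj:
  assumes i: "i \<in> coord_space bS" and 0: "source_kcl i = 0"
  shows "i = 0"
proof (rule Vs_currents_independent[OF i])
  fix \<phi>
  obtain a where a: "\<phi> = TN *v a" using TN_surj by blast
  have "\<forall>a\<in>coord_space J1. i \<bullet> volt N {Vs} (TN *v a) = 0"
    using 0 by (simp add: source_kcl_def restr_transpose_eq_0_iff inner_inc del: transpose_matrix_vector)
  then have "i \<bullet> volt N {Vs} (TN *v restr J1 a) = 0" by (simp add: restr_in_coord_space)
  moreover have "volt N {Vs} (TN *v restr (- J1) a) = 0"
    unfolding flagD[OF flag1] by simp
  moreover have "TN *v a = TN *v restr (- J1) a + TN *v restr J1 a"
    by (simp add: restr_split flip: matrix_vector_right_distrib)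
  ultimately show "i \<bullet> volt N {Vs} \<phi> = 0" by (simp add: a volt_add)
qed

lemma coil_kcl_range: "coil_kcl b \<in> coord_space J5"
  by (simp add: coil_kcl_def restr_in_coord_space)

lemma coil_kcl_eq_0_iff: "b \<in> coord_space bL \<Longrightarrow> coil_kcl b = 0 \<longleftrightarrow> restr J' b = 0"
  using TL_kernel[of b]
  by (simp add: coil_kcl_def restr_transpose_eq_0_iff inner_inc del: transpose_matrix_vector)

lemma coil_kcl_inj: "b \<in> coord_space J' \<Longrightarrow> coil_kcl b = 0 \<Longrightarrow> b = 0"
  using coil_kcl_eq_0_iff[of b] J'_subset by (auto simp: mem_coord_space restr_eq_self)

lemma coil_volt_range: "coil_volt a \<in> coord_space J'"
  by (simp add: coil_volt_def restr_in_coord_space)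

lemma coil_volt_inj:
  assumes a: "a \<in> coord_space J5" and 0: "coil_volt a = 0"
  shows "a = 0"
proof -
  have J': "\<forall>b\<in>coord_space J'. volt N {Ind} (TN *v a) \<bullet> (TL *v b) = 0"
    using 0 by (simp add: coil_volt_def restr_transpose_eq_0_iff del: transpose_matrix_vector)
  obtain g where g: "\<And>i. g i \<in> coord_space bL" "\<And>i. i \<in> coord_space bL \<Longrightarrow> TL *v g i = i"
    using TL_inverse by metis
  let ?v = "volt N {Ind} (TN *v a)"
  let ?b = "g ?v"
  have "?v \<bullet> (TL *v restr J' ?b) = 0" using J' by (simp add: restr_in_coord_space)
  moreover have "restr J' (restr (- J') ?b) = 0" by (simp add: restr_restr)
  moreover have "restr (- J') ?b \<in> coord_space bL" using g(1)[of ?v] by (simp add: mem_coord_space)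
  ultimately have parts: "?v \<bullet> (TL *v restr J' ?b) = 0" "?v \<bullet> (TL *v restr (- J') ?b) = 0"
    using TL_kernel[of "restr (- J') ?b"] a by (auto simp: inner_commute)
  have split: "TL *v ?b = TL *v restr (- J') ?b + TL *v restr J' ?b"
    by (simp only: restr_split flip: matrix_vector_right_distrib)
  have "TL *v ?b = ?v" using g(2) volt_in_coord_space by blast
  moreover have "?v \<bullet> (TL *v ?b) = 0" unfolding split by (simp add: inner_add_right parts)
  ultimately have "?v \<bullet> ?v = 0" by simp
  then have "volt N {Ind} (TN *v a) = 0" by simp
  then show "a = 0" using TN_inj volt_CRVL_injective test_J5[OF a] by blast
qed

lemma card_J1: "card J1 = card bS"
  using card_le_of_coord_inj[OF linear_sources(1), of J1 bS] source_volt_range source_volt_inj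
    card_le_of_coord_inj[OF linear_sources(2), of bS J1] source_kcl_range source_kcl_inj
  by fastforce

lemma card_J5: "card J5 = card J'"
  using card_le_of_coord_inj[OF linear_sources(3), of J' J5] coil_kcl_range coil_kcl_inj
    card_le_of_coord_inj[OF linear_sources(4), of J5 J'] coil_volt_range coil_volt_inj
  by fastforce

lemma card_algebraic: "card eE = card vY"
proof -
  have c: "card (Inl ` A \<union> Inr ` B :: ('n + 'b) set) = card A + card B" for A B
    by (subst card_Un_disjoint) (auto simp: card_image)
  have "card (J3 \<union> J4 \<union> J5) = card J3 + card J4 + card J5"
    "card (J1 \<union> J3 \<union> J4) = card J1 + card J3 + card J4"
    using disjoint by (subst card_Un_disjoint; auto)+
  moreover have "card (bS \<union> bC) = card bS + card bC" "card (J' \<union> bC) = card J' + card bC"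
    using kind_disjoint J'_subset by (auto intro!: card_Un_disjoint)
  ultimately show ?thesis by (simp add: eE_def vY_def c card_J1 card_J5)
qed

text \<open>Kirchhoff's law at the algebraic equations, tested with a combination of coordinates.\<close>

lemma E_inner:
  assumes "a \<in> coord_space (J3 \<union> J4 \<union> J5)"
  shows "restr eE (F w' w t) \<bullet> join_parts a 0 = kcl w' w t \<bullet> (TN *v a)"
proof -
  have "restr eE (F w' w t) \<bullet> join_parts a 0 = (transpose TN *v kcl w' w t) \<bullet> a"
    unfolding inner_parts using assms
    by (auto simp: inner_vec_def F_Inl mem_coord_space intro!: sum.cong simp del: transpose_matrix_vector)
  then show ?thesis by (simp add: transpose_mult_inner del: transpose_matrix_vector)
qed

lemma E_sources: "b \<in> bS \<Longrightarrow> restr eE (F w' w t) $ Inr b = vs_residual N (pot w) t $ b"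
  "b \<in> bC \<Longrightarrow> restr eE (F w' w t) $ Inr b = vc_residual N (pot w) (cur w) t $ b"
  using kind_disjoint by (auto simp: F_Inr)

lemma kcl_inner_J5:
  assumes a: "a \<in> coord_space J5"
  shows "kcl w' w t \<bullet> (TN *v a) = cur w \<bullet> volt N {Ind} (TN *v a) + i_s N t \<bullet> volt N {Is} (TN *v a)"
proof -
  note t = test_J5[OF a]
  have z: "volt N K (TN *v a) = 0" if "K \<subseteq> {Cap, Res} \<union> V_kinds" for K
    using volt_eq_0_mono[OF t that] .
  have "volt N {Ic2} (TN *v a) = 0" "volt N {Ic3} (TN *v a) = 0" "volt N {Ic4} (TN *v a) = 0"
    by (intro volt_Ic2 volt_Ic3 volt_Ic4 z; auto simp: V_kinds_def)+
  moreover have "volt N {Vs} (TN *v a) = 0" "volt N {Cap} (TN *v a) = 0" "volt N {Res} (TN *v a) = 0"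
    "volt N {Vc} (TN *v a) = 0"
    by (intro z; auto simp: V_kinds_def)+
  ultimately show ?thesis by (simp add: kcl_inner)
qed

text \<open>
  The voltages of the independent voltage sources and the currents in the independent current
  sources force the variables \<open>vK\<close>.
\<close>

lemma time_dependent_variables:
  obtains \<tau> \<tau>' where "C1_curve UNIV \<tau> \<tau>'"
    "\<And>w t. restr eE (F 0 w t) = 0 \<Longrightarrow> restr vK w = \<tau> t"
proof -
  obtain g1 where g1: "linear g1" "\<And>a. a \<in> coord_space J1 \<Longrightarrow> g1 (source_volt a) = a"
    using coord_linear_inverse[OF linear_sources(1), of J1 bS] source_volt_range source_volt_inj card_J1
    by (metis order_refl)
  obtain g2 where g2: "linear g2" "\<And>b. b \<in> coord_space J' \<Longrightarrow> g2 (coil_kcl b) = b"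
    using coord_linear_inverse[OF linear_sources(3), of J' J5] coil_kcl_range coil_kcl_inj card_J5
    by (metis order_refl)
  define \<tau> where "\<tau> t = join_parts (g1 (restr bS (v_s N t)))
    (g2 (- restr J5 (transpose TN *v (inc N {Is} *v i_s N t))))" for t
  have "cont_diff (\<lambda>t. g1 (restr bS (v_s N t)))"
    by (rule cont_diff_lin[OF g1(1) cont_diff_lin[OF linear_restr smoothD(4)]])
  moreover have "cont_diff (\<lambda>t. g2 (- restr J5 (transpose TN *v (inc N {Is} *v i_s N t))))"
    by (rule cont_diff_lin[OF g2(1) cont_diff_lin[OF linear_uminus cont_diff_lin[OF linear_restr
        cont_diff_lin[OF matrix_vector_mul_linear cont_diff_lin[OF matrix_vector_mul_linear smoothD(5)]]]]])
  ultimately have "cont_diff \<tau>"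
    unfolding \<tau>_def using cont_diff_lin[OF linear_join_parts cont_diff_Pair] by simp
  then obtain \<tau>' where "C1_curve UNIV \<tau> \<tau>'" by (rule cont_diff_C1_curve)
  moreover have "restr vK w = \<tau> t" if E: "restr eE (F 0 w t) = 0" for w t
  proof -
    have "vs_residual N (pot w) t $ b = 0" for b
      using E_sources(1)[of b 0 w t] E by (cases "b \<in> bS") (auto simp: vs_residual_def volt_nth branches_def)
    then have "source_volt (nodal_part w) = restr bS (v_s N t)"
      by (simp add: source_volt_def vs_residual_def pot_def vec_eq_iff)
    moreover have "source_volt (restr (- J1) (nodal_part w)) = 0"
      unfolding source_volt_def flagD[OF flag1] by simp
    then have "source_volt (nodal_part w) = source_volt (restr J1 (nodal_part w))"
      using linear_add[OF linear_sources(1)] by (metis add_0 restr_split)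
    ultimately have 1: "restr J1 (nodal_part w) = g1 (restr bS (v_s N t))"
      using g1(2)[of "restr J1 (nodal_part w)"] by (simp add: restr_in_coord_space)
    let ?b = "restr bL (branch_part w)"
    have "\<forall>a\<in>coord_space J5. (inc N {Ind} *v (TL *v ?b) + inc N {Is} *v i_s N t) \<bullet> (TN *v a) = 0"
    proof
      fix a assume a: "a \<in> coord_space J5"
      then have "a \<in> coord_space (J3 \<union> J4 \<union> J5)" by (simp add: mem_coord_space)
      then have "kcl 0 w t \<bullet> (TN *v a) = 0" using E_inner[of a 0 w t] E by simp
      then show "(inc N {Ind} *v (TL *v ?b) + inc N {Is} *v i_s N t) \<bullet> (TN *v a) = 0"
        by (simp add: kcl_inner_J5[OF a] inner_add_left inner_inc cur_def flip: TL_support)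
    qed
    then have "coil_kcl ?b = - restr J5 (transpose TN *v (inc N {Is} *v i_s N t))"
      unfolding restr_transpose_eq_0_iff[symmetric]
      by (simp add: coil_kcl_def matrix_vector_right_distrib restr_add eq_neg_iff_add_eq_0
          del: transpose_matrix_vector)
    moreover have "coil_kcl (restr (- J') ?b) = 0"
      by (subst coil_kcl_eq_0_iff) (auto simp: mem_coord_space restr_restr)
    then have "coil_kcl ?b = coil_kcl (restr J' ?b)"
      using linear_add[OF linear_sources(3)] by (metis add_0 restr_split)
    ultimately have "restr J' ?b = g2 (- restr J5 (transpose TN *v (inc N {Is} *v i_s N t)))"
      using g2(2)[of "restr J' ?b"] by (simp add: restr_in_coord_space)
    then have 2: "restr J' (branch_part w) = g2 (- restr J5 (transpose TN *v (inc N {Is} *v i_s N t)))"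
      using J'_subset by (simp add: restr_restr Int_absorb2)
    have "restr vK w = join_parts (restr J1 (nodal_part w)) (restr J' (branch_part w))"
      by (simp add: sum_vec_eq_iff)
    then show ?thesis by (simp add: 1 2 \<tau>_def)
  qed
  ultimately show ?thesis by (rule that)
qed

lemma affine_derivative_0:
  fixes m :: real
  assumes "((\<lambda>s. h s) has_vector_derivative 0) (at 0)" "\<And>s. h s = h 0 + s * m"
  shows "m = 0"
proof -
  have "((\<lambda>s. h 0 + s * m) has_vector_derivative m) (at 0)"
    by (auto intro!: derivative_eq_intros)
  moreover have "(\<lambda>s. h 0 + s * m) = h" by (rule ext, rule assms(2)[symmetric])
  ultimately have "(h has_vector_derivative m) (at 0)" by simp
  then show ?thesis using vector_derivative_unique_at assms(1) by blast
qed

text \<open>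
  The Jacobian of the algebraic equations is block triangular: along a direction in its kernel, the
  equations of the independent voltage sources, Kirchhoff's law at \<open>J5\<close>, the equations of the
  controlled voltage sources, and Kirchhoff's law at \<open>J4\<close> and at \<open>J3\<close> depend in turn on only one block
  of the direction, and force it to vanish.
\<close>

lemma algebraic_jacobian_regular:
  "regular_block eE vY (jacobian (\<lambda>y. restr eE (F 0 (x + y) t)) (at y))"
proof (rule regular_blockI[OF card_algebraic])
  let ?g = "\<lambda>y. restr eE (F 0 (x + y) t)"
  fix d assume d: "d \<in> coord_space vY" and 0: "restr eE (jacobian ?g (at y) *v d) = 0"
  define w where "w s = x + y + s *\<^sub>R d" for s
  define \<gamma> where "\<gamma> s = restr eE (F 0 (w s) t)" for s
  have "cont_diff ?g"
    by (intro cont_diff_lin[OF linear_restr] cont_diff_F cont_diff_add cont_diff_const cont_diff_id)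
  from jacobian_directional[OF this, of y d]
  have "(\<gamma> has_vector_derivative (jacobian ?g (at y) *v d)) (at 0)"
    unfolding \<gamma>_def[abs_def] w_def add.assoc .
  from bounded_linear.has_vector_derivative[OF linear_to_bounded[OF linear_restr[of eE]] this]
  have \<gamma>': "(\<gamma> has_vector_derivative 0) (at 0)"
    by (simp add: 0 \<gamma>_def[abs_def] restr_restr)
  have \<gamma>_nth: "((\<lambda>s. \<gamma> s $ k) has_vector_derivative 0) (at 0)" for k
    using bounded_linear.has_vector_derivative[OF bounded_linear_vec_nth \<gamma>'] by simp
  have kcl': "((\<lambda>s. kcl 0 (w s) t \<bullet> (TN *v a)) has_vector_derivative 0) (at 0)"
    if "a \<in> coord_space (J3 \<union> J4 \<union> J5)" for a
    using bounded_linear.has_vector_derivative[OF bounded_linear_inner_left \<gamma>', of "join_parts a 0"]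
    by (simp add: \<gamma>_def E_inner[OF that])
  have pot_w: "pot (w s) = pot (w 0) + s *\<^sub>R pot d" for s
    by (simp add: w_def linear_add[OF linear_pot] linear_scale[OF linear_pot])
  have volt_w: "volt N K (pot (w s)) = volt N K (pot (w 0)) + s *\<^sub>R volt N K (pot d)" for K s
    by (simp add: pot_w[of s] volt_add volt_scaleR)
  have cur_w: "cur (w s) = cur (w 0) + s *\<^sub>R cur d" for s
    by (simp add: w_def linear_add[OF linear_cur] linear_scale[OF linear_cur])
  have d_nod: "d $ Inl i = 0" if "i \<in> J2 \<union> J5" for i
  proof -
    have "Inl i \<notin> vY" using that disjoint by auto
    then show ?thesis using d by (simp add: mem_coord_space)
  qed
  have d_bra: "d $ Inr b = 0" if "b \<notin> J' \<union> bC" for b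
    using d that by (auto simp: mem_coord_space)

  \<comment> \<open>The independent voltage sources determine \<open>J1\<close>.\<close>
  have "volt N {Vs} (pot d) $ b = 0" for b
  proof (cases "b \<in> bS")
    case True
    have "\<gamma> s $ Inr b = \<gamma> 0 $ Inr b + s * volt N {Vs} (pot d) $ b" for s
      unfolding \<gamma>_def E_sources(1)[OF True] by (simp add: vs_residual_def volt_w[of _ s])
    from affine_derivative_0[OF \<gamma>_nth this] show ?thesis .
  qed (simp add: volt_nth branches_def)
  then have Vs: "volt N {Vs} (pot d) = 0" by (simp add: vec_eq_iff)
  then have J1: "\<forall>i\<in>J1. d $ Inl i = 0" using flagD[OF flag1, of "nodal_part d"] by (simp add: pot_def)

  \<comment> \<open>Kirchhoff's law at \<open>J5\<close> determines the inductor currents.\<close>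
  have "cur d \<bullet> volt N {Ind} (TN *v a) = 0" if a: "a \<in> coord_space J5" for a
  proof -
    have "kcl 0 (w s) t \<bullet> (TN *v a) = kcl 0 (w 0) t \<bullet> (TN *v a) + s * (cur d \<bullet> volt N {Ind} (TN *v a))" for s
      unfolding kcl_inner_J5[OF a] by (simp add: cur_w[of s] inner_add_left)
    moreover have "a \<in> coord_space (J3 \<union> J4 \<union> J5)" using a by (simp add: mem_coord_space)
    ultimately show ?thesis using affine_derivative_0[OF kcl'] by blast
  qed
  then have "\<forall>a\<in>coord_space J5. (TL *v restr bL (branch_part d)) \<bullet> volt N {Ind} (TN *v a) = 0"
    by (simp add: cur_def flip: TL_support)
  then have "restr J' (restr bL (branch_part d)) = 0"
    using TL_kernel[of "restr bL (branch_part d)"] by (simp add: restr_in_coord_space)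
  then have J': "\<forall>b\<in>J'. d $ Inr b = 0"
    using J'_subset by (auto simp: restr_restr Int_absorb2 restr_eq_0_iff)
  have cur0: "cur d = cur 0"
    using J' d_bra kind_disjoint by (intro cur_cong) auto
  then have cur_d: "cur d = 0" by (simp add: linear_0[OF linear_cur])

  \<comment> \<open>The controlled voltage sources determine \<open>J3\<close>, as their voltages depend on those of the
    capacitors and independent voltage sources only.\<close>
  have CVs: "volt N {Cap, Vs} (pot d) = 0"
    unfolding pot_def flagD[OF flag2] using J1 d_nod by auto
  have "volt N {Vc} (pot d) $ b = 0" for b
  proof (cases "b \<in> bC")
    case True
    have "\<gamma> s $ Inr b = \<gamma> 0 $ Inr b + s * volt N {Vc} (pot d) $ b" for s
      unfolding \<gamma>_def E_sources(2)[OF True]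
      by (simp add: vc_residual_def volt_w[of _ s] cur_w[of s] CVs cur_d)
    from affine_derivative_0[OF \<gamma>_nth this] show ?thesis .
  qed (simp add: volt_nth branches_def)
  then have "volt N ({Cap, Vs} \<union> {Vc}) (pot d) = 0" 
    unfolding volt_Un_eq_0 using CVs by (simp add: vec_eq_iff)
  then have CV: "volt N ({Cap} \<union> V_kinds) (pot d) = 0" by (simp add: V_kinds_def insert_commute)
  then have J123: "\<forall>i\<in>J1 \<union> J2 \<union> J3. d $ Inl i = 0"
    using flagD[OF flag3, of "nodal_part d"] by (simp add: pot_def)
  have nod_d: "nodal_part d \<in> coord_space J4"
    using J123 d_nod cover by (auto simp: mem_coord_space)

  \<comment> \<open>Kirchhoff's law at \<open>J4\<close>, tested with the direction itself: positive definite resistors.\<close>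
  have "volt N {Res} (pot d) = 0"
  proof (rule ccontr)
    let ?v = "volt N {Res} (pot d)"
    let ?gR = "\<lambda>v. g_R N v (volt N ({Cap} \<union> V_kinds) (pot (w 0))) (cur (w 0)) t"
    let ?J = "jacobian ?gR (at (volt N {Res} (pot (w 0))))"
    assume nz: "?v \<noteq> 0"
    have z: "volt N {Cap} (pot d) = 0" "volt N {Vc} (pot d) = 0"
      by (rule volt_eq_0_mono[OF CV]; auto simp: V_kinds_def)+
    define c where "c = cur (w 0) \<bullet> volt N {Ind} (pot d) + i_s N t \<bullet> volt N {Is} (pot d) +
      i_c4 N (volt N ({Cap} \<union> V_kinds) (pot (w 0))) (cur (w 0)) t \<bullet> volt N {Ic4} (pot d)"
    have eq: "kcl 0 (w s) t \<bullet> pot d = ?gR (volt N {Res} (pot (w 0)) + s *\<^sub>R ?v) \<bullet> ?v + c" for s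
      unfolding kcl_inner[OF Vs] by (simp add: volt_Ic2[OF CVs] volt_Ic3[OF CV] z c_def volt_w[of "{Res}" s]
          volt_w[of "{Cap} \<union> V_kinds" s] CV cur_w[of s] cur_d del: Un_insert_left)
    have "cont_diff ?gR"
      by (intro cont_diff_compose4[OF smoothD(3)] cont_diff_id cont_diff_const)
    from bounded_linear.has_vector_derivative[OF bounded_linear_inner_left jacobian_directional[OF this]]
    have "((\<lambda>s. ?gR (volt N {Res} (pot (w 0)) + s *\<^sub>R ?v) \<bullet> ?v) has_vector_derivative (?J *v ?v) \<bullet> ?v) (at 0)" .
    then have "((\<lambda>s. kcl 0 (w s) t \<bullet> pot d) has_vector_derivative (?J *v ?v) \<bullet> ?v) (at 0)"
      unfolding eq by (auto intro!: derivative_eq_intros)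
    moreover have "((\<lambda>s. kcl 0 (w s) t \<bullet> pot d) has_vector_derivative 0) (at 0)"
      unfolding pot_def[of d] by (rule kcl') (use nod_d in \<open>auto simp: mem_coord_space\<close>)
    ultimately have "(?J *v ?v) \<bullet> ?v = 0" by (rule vector_derivative_unique_at)
    moreover have "?v \<bullet> (?J *v ?v) > 0"
      using passive_el volt_in_coord_space cur_in_coord_space nz
      unfolding passive_elements_def pos_def_block_def by blast
    ultimately show False by (simp add: inner_commute)
  qed
  then have "volt N (({Cap} \<union> V_kinds) \<union> {Res}) (pot d) = 0"
    unfolding volt_Un_eq_0[of N "{Cap} \<union> V_kinds"] using CV by simp
  then have CRV: "volt N ({Cap, Res} \<union> V_kinds) (pot d) = 0" by (simp add: insert_commute)
  then have "\<forall>i\<in>J1 \<union> J2 \<union> J3 \<union> J4. d $ Inl i = 0"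
    using flagD[OF flag4, of "nodal_part d"] by (simp add: pot_def)
  then have nod0: "d $ Inl i = 0" for i using d_nod cover by blast

  \<comment> \<open>Kirchhoff's law at \<open>J3\<close> determines the currents through the controlled voltage sources.\<close>
  have iC_test: "iC d \<bullet> volt N {Vc} (TN *v a) = 0" if a: "a \<in> coord_space J3" for a
  proof -
    have a': "a \<in> coord_space (J3 \<union> J4 \<union> J5)" using a by (simp add: mem_coord_space)
    note t = test_J345[OF a']
    have z: "volt N {Cap} (TN *v a) = 0" "volt N {Vs} (TN *v a) = 0" by (rule volt_eq_0_mono[OF t]; auto)+
    have Rs: "volt N {Res} (pot d) = 0" by (rule volt_eq_0_mono[OF CRV]) auto
    have iC_w: "iC (w s) = iC (w 0) + s *\<^sub>R iC d" for s by (simp add: w_def vec_eq_iff)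
    have "kcl 0 (w s) t \<bullet> (TN *v a) = kcl 0 (w 0) t \<bullet> (TN *v a) + s * (iC d \<bullet> volt N {Vc} (TN *v a))" for s
      unfolding kcl_inner[OF z(2)]
      by (simp add: volt_Ic2[OF t] z volt_w[of _ s] CV CRV Rs cur_w[of s] cur_d iC_w[of s] inner_add_left
          del: Un_insert_left)
    from affine_derivative_0[OF kcl'[OF a'] this] show ?thesis .
  qed
  have "iC d = 0"
  proof (rule Vc_currents_independent)
    show "iC d \<in> coord_space bC" by (simp add: restr_in_coord_space)
    fix \<phi> assume \<phi>: "volt N {Cap, Vs} \<phi> = 0"
    obtain a where a: "\<phi> = TN *v a" using TN_surj by blast
    then have a12: "\<forall>i\<in>J1 \<union> J2. a $ i = 0" using \<phi> flagD[OF flag2] by simp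
    have "restr (- J3) a \<in> coord_space (J4 \<union> J5)" using a12 cover by (auto simp: mem_coord_space)
    from volt_eq_0_mono[OF test_J45[OF this], of "{Vc}"]
    have "volt N {Vc} (TN *v restr (- J3) a) = 0" by (simp add: V_kinds_def)
    moreover have "TN *v a = TN *v restr (- J3) a + TN *v restr J3 a"
      by (simp add: restr_split flip: matrix_vector_right_distrib)
    ultimately show "iC d \<bullet> volt N {Vc} \<phi> = 0"
      using iC_test[of "restr J3 a"] by (simp add: a volt_add restr_in_coord_space)
  qed
  then have "\<forall>b\<in>bC. d $ Inr b = 0" by (simp add: restr_eq_0_iff)
  then show "d = 0" using nod0 J' d_bra by (auto simp: sum_vec_eq_iff)
qed

end

section \<open>Output variables and solutions\<close>


context split_network
begin

lemma K_eq_0_iff: "restr vK (F w' w t) = 0 \<longleftrightarrow>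
    restr J1 (transpose TN *v kcl w' w t) = 0 \<and> restr J' (transpose TL *v flux w' w) = 0"
  using J'_subset
  by (auto simp: sum_vec_eq_iff F_Inl F_Inr vec_eq_iff simp del: transpose_matrix_vector)

text \<open>
  The inductor equations at \<open>J'\<close> are solved for the potentials \<open>J5\<close>; Kirchhoff's law at \<open>J1\<close> involves
  these through the first group of controlled current sources and is then solved for the currents
  of the independent voltage sources.
\<close>

lemma outputs_unique:
  "\<exists>!z. z \<in> coord_space vZ \<and> restr vK (F w' (v + z) t) = 0"
proof -
  obtain ga where ga: "\<And>c. ga c \<in> coord_space J5" "\<And>a. a \<in> coord_space J5 \<Longrightarrow> ga (coil_volt a) = a"
    "\<And>c. c \<in> coord_space J' \<Longrightarrow> coil_volt (ga c) = c"
    using coord_linear_inverse[OF linear_sources(4), of J5 J'] coil_volt_range coil_volt_inj card_J5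
    by (metis order_refl)
  obtain gi where gi: "\<And>c. gi c \<in> coord_space bS" "\<And>i. i \<in> coord_space bS \<Longrightarrow> gi (source_kcl i) = i"
    "\<And>c. c \<in> coord_space J1 \<Longrightarrow> source_kcl (gi c) = c"
    using coord_linear_inverse[OF linear_sources(2), of bS J1] source_kcl_range source_kcl_inj card_J1
    by (metis order_refl)
  define c1 where "c1 = restr J' (transpose TL *v flux w' v)"
  define c2 where "c2 a = - restr J1 (transpose TN *v kcl w' (v + join_parts a 0) t)" for a
  have c1: "c1 \<in> coord_space J'" by (simp add: c1_def restr_in_coord_space)
  have c2: "c2 a \<in> coord_space J1" for a by (simp add: c2_def mem_coord_space)
  have char: "restr vK (F w' (v + join_parts a i) t) = 0 \<longleftrightarrow> coil_volt a = c1 \<and> source_kcl i = c2 a"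
    if a: "a \<in> coord_space J5" and i: "i \<in> coord_space bS" for a i
  proof -
    have i0: "i $ b = 0" if "b \<in> bL \<union> bC" for b
      using i that kind_disjoint by (auto simp: mem_coord_space)
    have cur: "cur (v + join_parts a i) = cur v" "cur (v + join_parts a 0) = cur v"
      by (rule cur_cong; use i0 in simp)+
    have pot: "pot (v + join_parts a i) = pot v + TN *v a" for i :: "real^'b"
      unfolding linear_add[OF linear_pot] by (simp add: pot_def)
    have iS: "iS (v + join_parts a i) = iS v + i"
      using i by (auto simp: vec_eq_iff mem_coord_space)
    have iS0: "iS (v + join_parts a 0) = iS v" by (simp add: vec_eq_iff)
    have iC: "iC (v + join_parts a i) = iC v" "iC (v + join_parts a 0) = iC v"
      using i0 by (simp_all add: vec_eq_iff)
    have "flux w' (v + join_parts a i) = flux w' v - volt N {Ind} (TN *v a)"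
      by (simp add: flux_def cur pot volt_add)
    then have 1: "restr J' (transpose TL *v flux w' (v + join_parts a i)) = c1 - coil_volt a"
      by (simp add: c1_def coil_volt_def matrix_vector_mult_diff_distrib linear_diff[OF linear_restr]
          del: transpose_matrix_vector)
    have "cap_currents w' (v + join_parts a i) = cap_currents w' (v + join_parts a 0)"
      by (simp add: cap_currents_def pot)
    moreover have "static_currents N \<phi> iL (u + i) k t = static_currents N \<phi> iL u k t + inc N {Vs} *v i"
      for \<phi> iL u k by (simp add: static_currents_def matrix_vector_right_distrib)
    ultimately have "kcl w' (v + join_parts a i) t = kcl w' (v + join_parts a 0) t + inc N {Vs} *v i"
      unfolding kcl_def by (simp add: iS iS0 iC cur pot)
    then have 2: "restr J1 (transpose TN *v kcl w' (v + join_parts a i) t) = source_kcl i - c2 a"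
      by (simp add: c2_def source_kcl_def matrix_vector_right_distrib restr_add
          del: transpose_matrix_vector)
    show ?thesis unfolding K_eq_0_iff 1 2 by auto
  qed
  have Z: "z \<in> coord_space vZ \<longleftrightarrow> nodal_part z \<in> coord_space J5 \<and> branch_part z \<in> coord_space bS" for z
    unfolding mem_coord_space by (metis branch_part_nth index_sets(5,6) nodal_part_nth sum.exhaust)
  show ?thesis
  proof (rule ex1I[of _ "join_parts (ga c1) (gi (c2 (ga c1)))"])
    show "join_parts (ga c1) (gi (c2 (ga c1))) \<in> coord_space vZ \<and>
        restr vK (F w' (v + join_parts (ga c1) (gi (c2 (ga c1)))) t) = 0"
      using ga gi c1 c2 by (simp add: Z char)
    fix z assume z: "z \<in> coord_space vZ \<and> restr vK (F w' (v + z) t) = 0"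
    define a i where "a = nodal_part z" and "i = branch_part z"
    have z': "z = join_parts a i" by (simp add: a_def i_def)
    have "coil_volt a = c1 \<and> source_kcl i = c2 a" 
      using z char[of a i] by (simp add: z' Z)
    moreover have "ga (coil_volt a) = a" "gi (source_kcl i) = i"
      using z by (intro ga(2) gi(2); simp add: z' Z)+
    ultimately show "z = join_parts (ga c1) (gi (c2 (ga c1)))" by (simp add: z')
  qed
qed

lemma linear_mna_unknowns: "linear (mna_unknowns N TN TL)"
  by (intro linearI) (simp_all add: mna_unknowns_eq linear_add[OF linear_pot] linear_scale[OF linear_pot]
      linear_add[OF linear_cur] linear_scale[OF linear_cur] linear_add[OF linear_branch_part]
      linear_scale[OF linear_branch_part] restr_add restr_scaleR)

lemma mna_unknowns_inverse:
  obtains B where "linear B"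
    "\<And>u. u \<in> mna_space N \<Longrightarrow> B u \<in> coord_space vU \<and> mna_unknowns N TN TL (B u) = u"
    "\<And>w. w \<in> coord_space vU \<Longrightarrow> B (mna_unknowns N TN TL w) = w"
proof -
  obtain gN where gN: "linear gN" "\<And>a. gN (TN *v a) = a" "\<And>\<phi>. TN *v gN \<phi> = \<phi>"
    by (rule TN_inverse) blast
  obtain gL where gL: "linear gL" "\<And>i. gL i \<in> coord_space bL"
    "\<And>b. b \<in> coord_space bL \<Longrightarrow> gL (TL *v b) = b" "\<And>i. i \<in> coord_space bL \<Longrightarrow> TL *v gL i = i"
    by (rule TL_inverse) blast
  define B where "B = (\<lambda>(\<phi>, iL, jS, jC). join_parts (gN \<phi>) (gL iL + (jS + jC)))"
  show ?thesis
  proof (rule that[of B])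
    show "linear B"
      unfolding B_def by (intro linearI) (auto simp: sum_vec_eq_iff linear_add[OF gN(1)] linear_add[OF gL(1)]
          linear_scale[OF gN(1)] linear_scale[OF gL(1)] algebra_simps)
    show "B u \<in> coord_space vU \<and> mna_unknowns N TN TL (B u) = u" if u: "u \<in> mna_space N" for u
    proof -
      obtain \<phi> iL jS jC where ue: "u = (\<phi>, iL, jS, jC)" by (metis prod_cases4)
      have mem: "iL \<in> coord_space bL" "jS \<in> coord_space bS" "jC \<in> coord_space bC"
        using u by (auto simp: ue mna_space_def)
      let ?b = "gL iL + (jS + jC)"
      have nth: "gL iL $ b = 0" if "b \<notin> bL" for b using gL(2)[of iL] that by (simp add: mem_coord_space)
      have "restr bL ?b = gL iL" "restr bS ?b = jS" "restr bC ?b = jC"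
        using mem nth by (auto simp: vec_eq_iff mem_coord_space branches_def)
      then have "mna_unknowns N TN TL (B u) = u"
        using gN(3) gL(4)[OF mem(1)] TL_support[of ?b]
        by (simp add: ue B_def mna_unknowns_eq pot_def cur_def)
      moreover have "B u $ k = 0" if "k \<notin> vU" for k
      proof (cases k)
        case (Inr b)
        then show ?thesis using that nth mem by (simp add: ue B_def mem_coord_space)
      qed (use that in simp)
      ultimately show ?thesis by (simp add: mem_coord_space)
    qed
    show "B (mna_unknowns N TN TL w) = w" if w: "w \<in> coord_space vU" for w
    proof -
      have w0: "w $ Inr b = 0" if "b \<notin> bL \<union> bS \<union> bC" for b
        using w that by (simp add: mem_coord_space)
      have "gL (cur w) = restr bL (branch_part w)"
        unfolding cur_def by (subst TL_support) (simp add: gL(3) restr_in_coord_space)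
      moreover have "restr bL (branch_part w) + (iS w + iC w) = branch_part w"
        using w0 kind_disjoint by (auto simp: vec_eq_iff)
      ultimately show ?thesis by (simp add: B_def mna_unknowns_eq pot_def gN(2))
    qed
  qed
qed

lemma bij_mna_unknowns: "bij_betw (mna_unknowns N TN TL) (coord_space vU) (mna_space N)"
proof -
  obtain B where B: "\<And>u. u \<in> mna_space N \<Longrightarrow> B u \<in> coord_space vU \<and> mna_unknowns N TN TL (B u) = u"
    "\<And>w. w \<in> coord_space vU \<Longrightarrow> B (mna_unknowns N TN TL w) = w"
    using mna_unknowns_inverse by metis
  have "mna_unknowns N TN TL w \<in> mna_space N" for w
    by (simp add: mna_unknowns_eq mna_space_def cur_in_coord_space restr_in_coord_space)
  then show ?thesis
    by (intro bij_betw_byWitness[where f' = B]) (use B in auto)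
qed

lemma F_eq_0_iff: "F w' w t = 0 \<longleftrightarrow>
    kcl w' w t = 0 \<and> restr bL (jacobian (phi_L N) (at (cur w)) *v cur w') - volt N {Ind} (pot w) = 0 \<and>
    vs_residual N (pot w) t = 0 \<and> vc_residual N (pot w) (cur w) t = 0"
proof -
  obtain gN where gN: "\<And>\<phi>. TN *v gN \<phi> = \<phi>" using TN_inverse by metis
  obtain gL where gL: "\<And>i. gL i \<in> coord_space bL" "\<And>i. i \<in> coord_space bL \<Longrightarrow> TL *v gL i = i"
    using TL_inverse by metis
  have N0: "transpose TN *v r = 0 \<longleftrightarrow> r = 0" for r
    by (metis gN inner_eq_zero_iff inner_zero_left matrix_vector_mult_0_right transpose_mult_inner)
  have L0: "restr bL (transpose TL *v r) = 0 \<longleftrightarrow> restr bL r = 0" for r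
  proof
    assume "restr bL (transpose TL *v r) = 0"
    then have "\<forall>b\<in>coord_space bL. r \<bullet> (TL *v b) = 0" by (simp only: restr_transpose_eq_0_iff)
    then have "r \<bullet> restr bL r = 0"
      using gL by (metis restr_in_coord_space subset_refl)
    moreover have "r \<bullet> restr bL r = restr bL r \<bullet> restr bL r"
      unfolding inner_vec_def by (intro sum.cong) auto
    ultimately show "restr bL r = 0" by simp
  next
    assume r: "restr bL r = 0"
    have "r \<bullet> (TL *v b) = restr bL r \<bullet> (TL *v b)" for b
      using TL_range[of b] unfolding inner_vec_def by (intro sum.cong) (auto simp: mem_coord_space)
    then show "restr bL (transpose TL *v r) = 0" by (simp only: restr_transpose_eq_0_iff) (simp add: r)
  qed
  have flux: "restr bL (flux w' w) = restr bL (jacobian (phi_L N) (at (cur w)) *v cur w') - volt N {Ind} (pot w)"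
    by (simp add: flux_def linear_diff[OF linear_restr] restr_eq_self volt_in_coord_space)
  have outside: "vs_residual N (pot w) t $ b = 0" if "b \<notin> bS" for b
    using that by (simp add: vs_residual_def volt_nth branches_def)
  have outside': "vc_residual N (pot w) (cur w) t $ b = 0" if "b \<notin> bC" for b
    using that by (simp add: vc_residual_def volt_nth branches_def)
  have "F w' w t = 0 \<longleftrightarrow> transpose TN *v kcl w' w t = 0 \<and> restr bL (transpose TL *v flux w' w) = 0 \<and>
    vs_residual N (pot w) t = 0 \<and> vc_residual N (pot w) (cur w) t = 0"
    (is "_ \<longleftrightarrow> ?R")
  proof
    assume F0: "F w' w t = 0"
    have "(transpose TN *v kcl w' w t) $ j = 0" for j
      using F0 by (simp flip: F_Inl del: transpose_matrix_vector)
    moreover have Fr: "F w' w t $ Inr b = 0" for b using F0 by simp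
    have "(transpose TL *v flux w' w) $ b = 0" if "b \<in> bL" for b
      using Fr[of b] that by (simp add: F_Inr del: transpose_matrix_vector)
    moreover have "vs_residual N (pot w) t $ b = 0" for b
      using Fr[of b] outside[of b] kind_disjoint
      by (cases "b \<in> bS") (auto simp: F_Inr simp del: transpose_matrix_vector split: if_splits)
    moreover have "vc_residual N (pot w) (cur w) t $ b = 0" for b
      using Fr[of b] outside'[of b] kind_disjoint
      by (cases "b \<in> bC") (auto simp: F_Inr simp del: transpose_matrix_vector split: if_splits)
    ultimately show ?R by (simp add: vec_eq_iff del: transpose_matrix_vector)
  next
    assume ?R
    then show "F w' w t = 0"
      by (auto simp: sum_vec_eq_iff F_Inl F_Inr restr_eq_0_iff simp del: transpose_matrix_vector)
  qed
  then show ?thesis unfolding N0 L0 flux .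
qed

text \<open>
  Along continuously differentiable unknowns, charges and fluxes are differentiable by the chain rule,
  so resolving the total time derivatives does not change the solutions.
\<close>

lemma mna_solution_iff:
  assumes T: "is_interval T" "interior T \<noteq> {}" and w: "\<And>t. t \<in> T \<Longrightarrow> w t \<in> coord_space vU"
  shows "mna_solution N T (\<lambda>t. mna_unknowns N TN TL (w t)) \<longleftrightarrow>
    (\<exists>w'. C1_curve T w w' \<and> (\<forall>t\<in>T. F (w' t) (w t) t = 0))" (is "?L \<longleftrightarrow> ?R")
proof -
  have charges: "((\<lambda>s. q_C N (volt N {Cap} (pot (w s)))) has_vector_derivative cap_currents (w' t) (w t)) (at t within T)"
    "((\<lambda>s. phi_L N (cur (w s))) has_vector_derivative jacobian (phi_L N) (at (cur (w t))) *v cur (w' t)) (at t within T)"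
    if "C1_curve T w w'" "t \<in> T" for w' t
  proof -
    have d: "(w has_vector_derivative w' t) (at t within T)" using that by (simp add: C1_curve_def)
    note lin = bounded_linear.has_vector_derivative[OF linear_to_bounded]
    show "((\<lambda>s. q_C N (volt N {Cap} (pot (w s)))) has_vector_derivative cap_currents (w' t) (w t)) (at t within T)"
      unfolding cap_currents_def
      by (rule has_vector_derivative_jacobian_chain[OF smoothD(1) lin[OF volt_linear lin[OF linear_pot d]]])
    show "((\<lambda>s. phi_L N (cur (w s))) has_vector_derivative jacobian (phi_L N) (at (cur (w t))) *v cur (w' t)) (at t within T)"
      by (rule has_vector_derivative_jacobian_chain[OF smoothD(2) lin[OF linear_cur d]])
  qed
  have space: "mna_unknowns N TN TL (w t) \<in> mna_space N" if "t \<in> T" for t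
    using bij_mna_unknowns w[OF that] by (auto simp: bij_betw_def)
  show ?thesis
  proof
    assume ?L
    then obtain u' where u': "C1_curve T (\<lambda>t. mna_unknowns N TN TL (w t)) u'"
      by (auto simp: mna_solution_def)
    obtain B where B: "linear B" "\<And>w. w \<in> coord_space vU \<Longrightarrow> B (mna_unknowns N TN TL w) = w"
      using mna_unknowns_inverse by metis
    define w' where "w' t = B (u' t)" for t
    have C1: "C1_curve T w w'"
      unfolding w'_def
      by (rule C1_curve_cong[OF _ C1_curve_linear[OF linear_to_bounded[OF B(1)] u']]) (simp add: B(2) w)
    moreover have "F (w' t) (w t) t = 0" if t: "t \<in> T" for t
    proof -
      from \<open>?L\<close> t obtain dq d\<phi> where
        dq: "((\<lambda>s. q_C N (volt N {Cap} (pot (w s)))) has_vector_derivative dq) (at t within T)"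
        "inc N {Cap} *v dq + static_currents N (pot (w t)) (cur (w t)) (iS (w t)) (iC (w t)) t = 0" and
        d\<phi>: "((\<lambda>s. phi_L N (cur (w s))) has_vector_derivative d\<phi>) (at t within T)"
        "restr bL d\<phi> - volt N {Ind} (pot (w t)) = 0" and
        res: "vs_residual N (pot (w t)) t = 0" "vc_residual N (pot (w t)) (cur (w t)) t = 0"
        by (auto simp: mna_solution_def mna_unknowns_eq)
      note uniq = vector_derivative_unique_within[OF not_bot_within_interval[OF T t]]
      have "dq = cap_currents (w' t) (w t)" using uniq[OF dq(1)] charges(1)[OF C1 t] by blast
      moreover have "d\<phi> = jacobian (phi_L N) (at (cur (w t))) *v cur (w' t)"
        using uniq[OF d\<phi>(1)] charges(2)[OF C1 t] by blast
      ultimately show ?thesis using dq(2) d\<phi>(2) res unfolding F_eq_0_iff kcl_def by blast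
    qed
    ultimately show ?R by blast
  next
    assume ?R
    then obtain w' where C1: "C1_curve T w w'" and F0: "\<And>t. t \<in> T \<Longrightarrow> F (w' t) (w t) t = 0" by blast
    have "C1_curve T (\<lambda>t. mna_unknowns N TN TL (w t)) (\<lambda>t. mna_unknowns N TN TL (w' t))"
      by (rule C1_curve_linear[OF linear_to_bounded[OF linear_mna_unknowns] C1])
    then show ?L
      unfolding mna_solution_def
      using space charges[OF C1] F0[unfolded F_eq_0_iff kcl_def]
      by (auto simp: mna_unknowns_eq; blast)
  qed
qed

lemma F_eq_0_iff_parts: "F w' w t = 0 \<longleftrightarrow>
    restr vX (F w' w t) = 0 \<and> restr eE (F w' w t) = 0 \<and> restr vK (F w' w t) = 0"
proof -
  have "F w' w t $ k = 0" if "k \<notin> vU" for k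
    using that by (cases k) (auto simp: F_Inr)
  then show ?thesis
    using partition_equations(1) by (auto simp: vec_eq_iff restr_eq_0_iff)
qed

lemma U_decompose:
  assumes "w \<in> coord_space vU"
  shows "restr vX w + restr vY w + restr vZ w = w"
proof -
  have "(restr vX w + restr vY w + restr vZ w) $ k = w $ k" for k
    using assms partition_variables unfolding mem_coord_space by (cases "k \<in> vU") auto
  then show ?thesis by (simp add: vec_eq_iff)
qed

lemma E_via_g: "restr eE (F w' w t) = restr eE (F 0 (restr vX w + restr vY w) t)"
proof -
  have "F w' w t $ k = F 0 (restr vX w + restr vY w) t $ k" if k: "k \<in> eE" for k
    unfolding F_E_no_derivative[OF k, of w']
    by (rule F_DE_cong) (use k partition_variables in auto)
  then show ?thesis by (simp add: vec_eq_iff)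
qed

lemma K_via_h:
  assumes "w \<in> coord_space vU"
  shows "restr vK (F w' w t) =
    restr vK (F (restr vX w' + restr vY w') (restr vX w + restr vY w + restr vZ w) t)"
proof -
  have "F w' w t = F (restr vX w' + restr vY w') w t"
    by (rule F_deriv_cong) (use vK_subset partition_variables in auto)
  then show ?thesis by (simp add: U_decompose[OF assms])
qed

text \<open>
  On an interval the algebraic equations force the variables \<open>vK\<close> to be \<open>\<tau>\<close>, hence their
  derivatives to be \<open>\<tau>'\<close>, as required for solving the differential equations for \<open>x'\<close>.
\<close>

lemma decoupled_solution_iff:
  assumes T: "is_interval T" "interior T \<noteq> {}" and w: "\<And>t. t \<in> T \<Longrightarrow> w t \<in> coord_space vU"
    and \<tau>: "C1_curve UNIV \<tau> \<tau>'" "\<And>w t. restr eE (F 0 w t) = 0 \<Longrightarrow> restr vK w = \<tau> t"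
    and f: "\<And>w' w t. restr vK w' = \<tau>' t \<Longrightarrow>
       restr vX (F w' w t) = 0 \<longleftrightarrow> restr vX w' = f (restr vX w) (restr vY w) t"
  shows "decoupled_solution vX vY vZ f (\<lambda>x y t. restr eE (F 0 (x + y) t))
      (\<lambda>x' y' x y z t. restr vK (F (x' + y') (x + y + z) t)) T w \<longleftrightarrow>
    (\<exists>w'. C1_curve T w w' \<and> (\<forall>t\<in>T. F (w' t) (w t) t = 0))"
proof -
  have "(\<forall>t\<in>T. restr vX (w' t) = f (restr vX (w t)) (restr vY (w t)) t \<and>
       restr eE (F 0 (restr vX (w t) + restr vY (w t)) t) = 0 \<and>
       restr vK (F (restr vX (w' t) + restr vY (w' t)) (restr vX (w t) + restr vY (w t) + restr vZ (w t)) t) = 0)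
     \<longleftrightarrow> (\<forall>t\<in>T. F (w' t) (w t) t = 0)" (is "?L \<longleftrightarrow> ?R") if C1: "C1_curve T w w'" for w'
  proof -
    have E: "?L \<or> ?R \<Longrightarrow> t \<in> T \<Longrightarrow> restr eE (F 0 (restr vX (w t) + restr vY (w t)) t) = 0" for t
      using E_via_g[of "w' t" "w t" t] by auto
    have "restr vK (w' t) = \<tau>' t" if LR: "?L \<or> ?R" and t: "t \<in> T" for t
    proof (rule C1_curve_derivative_unique[OF _ C1_curve_subset[OF \<tau>(1)] _ T t])
      show "C1_curve T (\<lambda>t. restr vK (w t)) (\<lambda>t. restr vK (w' t))"
        by (rule C1_curve_linear[OF linear_to_bounded[OF linear_restr] C1])
      show "restr vK (w s) = \<tau> s" if "s \<in> T" for s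
      proof -
        have "restr vK (restr vX (w s) + restr vY (w s)) = restr vK (w s)"
          using vK_subset partition_variables(2) by (auto simp: vec_eq_iff)
        with \<tau>(2)[OF E[OF LR that]] show ?thesis by simp
      qed
    qed simp
    then have X: "?L \<or> ?R \<Longrightarrow> t \<in> T \<Longrightarrow> restr vX (F (w' t) (w t) t) = 0 \<longleftrightarrow>
        restr vX (w' t) = f (restr vX (w t)) (restr vY (w t)) t" for t
      using f by blast
    show ?thesis
      using X w by (auto simp: F_eq_0_iff_parts E_via_g[of "w' _"] K_via_h[of "w _" "w' _"])
  qed
  moreover have "w t \<in> coord_space (vX \<union> vY \<union> vZ)" if "t \<in> T" for t
    using w[OF that] by (simp add: partition_variables(1))
  ultimately show ?thesis
    unfolding decoupled_solution_def by (simp cong: conj_cong)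
qed

lemma variable_blocks_eq:
  "variable_blocks N {J1, J2, J3, J4} J5 {J', bL - J'} =
    {Inl ` J1, Inl ` J2, Inl ` J3, Inl ` J4, Inl ` J5, Inr ` J', Inr ` (bL - J'), Inr ` bS, Inr ` bC}"
  by (auto simp: variable_blocks_def)

lemma blocks_union: "\<Union> (variable_blocks N {J1, J2, J3, J4} J5 {J', bL - J'}) = vU"
  unfolding variable_blocks_eq using J'_subset cover by (intro set_eq_sumI) auto

lemma decouplable:
  assumes sp: "splitting N {J1, J2, J3, J4} S J5 Q {J', bL - J'} TL" and TN: "TN = S + Q"
  shows "decouplable_by_basis_matrices N"
proof -
  let ?Ls = "{J', bL - J'}"
  let ?blocks = "variable_blocks N {J1, J2, J3, J4} J5 ?Ls"
  obtain \<tau> \<tau>' where \<tau>: "C1_curve UNIV \<tau> \<tau>'" "\<And>w t. restr eE (F 0 w t) = 0 \<Longrightarrow> restr vK w = \<tau> t"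
    by (rule time_dependent_variables) blast
  have "continuous_on UNIV \<tau>'" using \<tau>(1) by (simp add: C1_curve_def)
  then obtain f where f: "continuous_on UNIV (\<lambda>(x, y, t). f x y t)" "\<And>x y t. f x y t \<in> coord_space vX"
    "\<And>w' w t. restr vK w' = \<tau>' t \<Longrightarrow>
       restr vX (F w' w t) = 0 \<longleftrightarrow> restr vX w' = f (restr vX w) (restr vY w) t"
    by (rule explicit_differential_equation) blast
  let ?g = "\<lambda>x y t. restr eE (F 0 (x + y) t)"
  let ?h = "\<lambda>x' y' x y z t. restr vK (F (x' + y') (x + y + z) t)"
  have groups: "groups_blocks ?blocks vX vY vZ" "groups_blocks ?blocks vX eE vK"
    unfolding groups_blocks_def blocks_union
    using partition_variables partition_equations
    unfolding variable_blocks_eq by (auto simp: image_subset_iff)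
  have pure: "\<forall>x\<in>coord_space vX. \<forall>y\<in>coord_space vY. \<forall>t. ?g x y t = 0 \<longrightarrow> restr vK y = \<tau> t"
  proof (intro ballI allI impI)
    fix x y t assume x: "x \<in> coord_space vX" and g: "?g x y t = 0"
    have "restr vK (x + y) = restr vK y"
      using x partition_equations(3) by (auto simp: vec_eq_iff mem_coord_space)
    then show "restr vK y = \<tau> t" using \<tau>(2)[OF g] by simp
  qed
  have index_one: "semi_explicit_index_one vX vY eE f ?g"
    unfolding semi_explicit_index_one_def
  proof (intro conjI ballI allI)
    have "cont_diff (\<lambda>p. restr eE (F 0 (fst p + fst (snd p)) (snd (snd p))))"
      by (intro cont_diff_lin[OF linear_restr] cont_diff_F cont_diff_bounded_linear bounded_linear_add
          bounded_linear_fst_comp bounded_linear_snd_comp bounded_linear_ident)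
    then show "cont_diff (\<lambda>(x, y, t). ?g x y t)" by (simp add: case_prod_unfold)
  qed (use f in \<open>simp_all add: restr_in_coord_space algebraic_jacobian_regular\<close>)
  have outputs: "uniquely_solvable_outputs vX vY vZ ?h"
    unfolding uniquely_solvable_outputs_def using outputs_unique by blast
  have eqs: "\<forall>w'\<in>coord_space vU. \<forall>w\<in>coord_space vU. \<forall>t.
      (restr vK w' = \<tau>' t \<longrightarrow>
        (restr vX (F w' w t) = 0 \<longleftrightarrow> restr vX w' = f (restr vX w) (restr vY w) t)) \<and>
      restr eE (F w' w t) = ?g (restr vX w) (restr vY w) t \<and>
      restr vK (F w' w t) = ?h (restr vX w') (restr vY w') (restr vX w) (restr vY w) (restr vZ w) t"
    using f(3) E_via_g K_via_h by blast
  have sols: "\<forall>T w. is_interval T \<and> interior T \<noteq> {} \<and> (\<forall>t\<in>T. w t \<in> coord_space vU) \<longrightarrow>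
      (mna_solution N T (\<lambda>t. mna_unknowns N TN TL (w t)) \<longleftrightarrow> decoupled_solution vX vY vZ f ?g ?h T w)"
  proof (intro allI impI, elim conjE)
    fix T :: "real set" and w assume T: "is_interval T" "interior T \<noteq> {}" and w: "\<forall>t\<in>T. w t \<in> coord_space vU"
    show "mna_solution N T (\<lambda>t. mna_unknowns N TN TL (w t)) \<longleftrightarrow> decoupled_solution vX vY vZ f ?g ?h T w"
      using mna_solution_iff[OF T, of w] decoupled_solution_iff[OF T _ \<tau> f(3), of w] w by blast
  qed
  show ?thesis
    unfolding decouplable_by_basis_matrices_def Let_def
    by (rule exI[of _ "{J1, J2, J3, J4}"], rule exI[of _ S], rule exI[of _ J5], rule exI[of _ Q],
        rule exI[of _ ?Ls], rule exI[of _ TL], rule exI[of _ vX], rule exI[of _ vY], rule exI[of _ vZ],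
        rule exI[of _ vX], rule exI[of _ eE], rule exI[of _ vK], rule exI[of _ vK], rule exI[of _ \<tau>],
        rule exI[of _ \<tau>'], rule exI[of _ f], rule exI[of _ ?g], rule exI[of _ ?h])
      (unfold blocks_union TN[symmetric], intro conjI sp bij_mna_unknowns groups vK_subset \<tau>(1) pure eqs
        index_one outputs sols)
qed

end

section \<open>Existence of the splittings\<close>

theorem theorem1:
  fixes N :: "('n::finite, 'b::finite) network"
  assumes "smooth_elements N"
    and "well_posed N"
    and "passive_elements N"
    and "admissible_controlled_sources N"
  shows "decouplable_by_basis_matrices N"
proof -
  let ?bL = "branches N {Ind}"
  have "adapted UNIV 0 (mat 1 :: real^'n^'n)" by (simp add: adapted_def)
  moreover have "flag N {} (- UNIV) (0 + mat 1 :: real^'n^'n)"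
    by (simp add: flag_def vec_eq_iff volt_nth)
  ultimately obtain J1 S1 Q1 where
    s1: "splitting N {J1} S1 (UNIV - J1) Q1 {?bL} (id_block ?bL)" "adapted (UNIV - J1) S1 Q1"
    "flag N {Vs} (- (UNIV - J1)) (S1 + Q1)"
    using splitting_extend[OF splitting.start, of N "{}" "{Vs}"] by (metis Un_empty_left)
  then obtain J2 S2 Q2 where
    s2: "splitting N {J2, J1} S2 (UNIV - J1 - J2) Q2 {?bL} (id_block ?bL)" "J2 \<subseteq> UNIV - J1"
    "adapted (UNIV - J1 - J2) S2 Q2"
    "flag N ({Vs} \<union> {Cap}) (- (UNIV - J1 - J2)) (S2 + Q2)" and
    k2: "\<And>E0 H0. H0 \<subseteq> - (UNIV - J1) \<Longrightarrow> flag N E0 H0 (S1 + Q1) \<Longrightarrow> flag N E0 H0 (S2 + Q2)"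
    by (rule splitting_extend[of N _ _ _ _ _ _ _ "{Cap}"]) blast
  then obtain J3 S3 Q3 where
    s3: "splitting N {J3, J2, J1} S3 (UNIV - J1 - J2 - J3) Q3 {?bL} (id_block ?bL)" "J3 \<subseteq> UNIV - J1 - J2"
    "adapted (UNIV - J1 - J2 - J3) S3 Q3"
    "flag N ({Vs} \<union> {Cap} \<union> {Vc}) (- (UNIV - J1 - J2 - J3)) (S3 + Q3)" and
    k3: "\<And>E0 H0. H0 \<subseteq> - (UNIV - J1 - J2) \<Longrightarrow> flag N E0 H0 (S2 + Q2) \<Longrightarrow> flag N E0 H0 (S3 + Q3)"
    using splitting_extend[OF s2(1,3,4), of "{Vc}"] by blast
  obtain J4 S Q where
    s4: "splitting N {J4, J3, J2, J1} S (UNIV - J1 - J2 - J3 - J4) Q {?bL} (id_block ?bL)"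
    "J4 \<subseteq> UNIV - J1 - J2 - J3" "adapted (UNIV - J1 - J2 - J3 - J4) S Q"
    "flag N ({Vs} \<union> {Cap} \<union> {Vc} \<union> {Res}) (- (UNIV - J1 - J2 - J3 - J4)) (S + Q)" and
    k4: "\<And>E0 H0. H0 \<subseteq> - (UNIV - J1 - J2 - J3) \<Longrightarrow> flag N E0 H0 (S3 + Q3) \<Longrightarrow> flag N E0 H0 (S + Q)"
    using splitting_extend[OF s3(1,3,4), of "{Res}"] by blast
  define J5 where "J5 = UNIV - J1 - J2 - J3 - J4"
  let ?M = "transpose (inc N {Ind}) ** Q"
  obtain J P Q' J' V W where bm: "basis_matrices ?bL J5 ?M J P Q' J' V W"
    using basis_matrices_exist by blast
  have ks: "kernel_splitting ?bL (transpose ?M) J' V W" using bm by (simp add: basis_matrices_def)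
  have sp: "splitting N {J4, J3, J2, J1} S J5 Q {J', ?bL - J'} (V + W)"
    using splitting.currents[OF s4(1)] bm unfolding J5_def by blast
  have Qd: "Q *v a = (S + Q) *v restr J5 a" for a
  proof -
    have "Q *v a = Q *v restr (- J5) a + Q *v restr J5 a"
      by (simp add: restr_split flip: matrix_vector_right_distrib)
    then show ?thesis using s4(3) by (simp add: adapted_def J5_def matrix_vector_mult_add_rdistrib)
  qed
  have TLk: "(\<forall>a\<in>coord_space J5. x \<bullet> volt N {Ind} ((S + Q) *v a) = 0) \<longleftrightarrow> transpose ?M *v x = 0" for x
  proof -
    have "transpose ?M *v x = 0 \<longleftrightarrow> (\<forall>a. x \<bullet> (?M *v a) = 0)"
      by (metis inner_eq_zero_iff inner_zero_left transpose_mult_inner)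
    also have "\<dots> \<longleftrightarrow> (\<forall>a. x \<bullet> volt N {Ind} ((S + Q) *v restr J5 a) = 0)"
      by (simp add: volt_def Qd flip: matrix_vector_mul_assoc)
    also have "\<dots> \<longleftrightarrow> (\<forall>a\<in>coord_space J5. x \<bullet> volt N {Ind} ((S + Q) *v a) = 0)"
    proof
      assume *: "\<forall>a. x \<bullet> volt N {Ind} ((S + Q) *v restr J5 a) = 0"
      show "\<forall>a\<in>coord_space J5. x \<bullet> volt N {Ind} ((S + Q) *v a) = 0"
      proof
        fix a assume "a \<in> coord_space J5"
        then show "x \<bullet> volt N {Ind} ((S + Q) *v a) = 0" using *[rule_format, of a] by (simp add: restr_eq_self)
      qed
    qed (blast intro: restr_in_coord_space)
    finally show ?thesis by (rule sym)
  qed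
  interpret split_network N "S + Q" J1 J2 J3 J4 J5 "V + W" J'
  proof
    show "a = 0" if "(S + Q) *v a = 0" for a using s4(3) that unfolding adapted_def by blast
    show "J1 \<union> J2 \<union> J3 \<union> J4 \<union> J5 = UNIV" by (auto simp: J5_def)
    show "J1 \<inter> J2 = {}" "(J1 \<union> J2) \<inter> J3 = {}" "(J1 \<union> J2 \<union> J3) \<inter> J4 = {}"
      "(J1 \<union> J2 \<union> J3 \<union> J4) \<inter> J5 = {}"
      using s2(2) s3(2) s4(2) by (auto simp: J5_def)
    have c: "- (UNIV - J1) = J1" "- (UNIV - J1 - J2) = J1 \<union> J2" "- (UNIV - J1 - J2 - J3) = J1 \<union> J2 \<union> J3"
      "- (UNIV - J1 - J2 - J3 - J4) = J1 \<union> J2 \<union> J3 \<union> J4" by auto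
    have e: "{Vs} \<union> {Cap} = {Cap, Vs}" "{Vs} \<union> {Cap} \<union> {Vc} = {Cap} \<union> V_kinds"
      "{Vs} \<union> {Cap} \<union> {Vc} \<union> {Res} = {Cap, Res} \<union> V_kinds" by (auto simp: V_kinds_def)
    show "flag N {Vs} J1 (S + Q)"
      using s1(3) by (intro k4 k3 k2) (auto simp: c)
    show "flag N {Cap, Vs} (J1 \<union> J2) (S + Q)"
      using s2(4) unfolding e(1) c by (intro k4 k3) auto
    show "flag N ({Cap} \<union> V_kinds) (J1 \<union> J2 \<union> J3) (S + Q)"
      using s3(4) unfolding e(2) c by (intro k4) auto
    show "flag N ({Cap, Res} \<union> V_kinds) (J1 \<union> J2 \<union> J3 \<union> J4) (S + Q)"
      using s4(4) unfolding e(3) c .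
    show "J' \<subseteq> ?bL" by (rule kernel_splitting_subset[OF ks])
    show "(V + W) *v b \<in> coord_space ?bL" for b by (rule kernel_splitting_range[OF ks])
    show "(V + W) *v b = (V + W) *v restr ?bL b" for b
    proof (rule matrix_mult_restr_columns)
      fix j assume "j \<notin> ?bL"
      then show "column j (V + W) = 0"
        using ks by (auto simp: kernel_splitting_def column_def vec_eq_iff)
    qed
    show "b = 0" if "b \<in> coord_space ?bL" "(V + W) *v b = 0" for b
      by (rule kernel_splitting_inj[OF ks that])
    show "(\<forall>a\<in>coord_space J5. ((V + W) *v b) \<bullet> volt N {Ind} ((S + Q) *v a) = 0) \<longleftrightarrow> restr J' b = 0"
      if "b \<in> coord_space ?bL" for b
      unfolding TLk by (rule kernel_splitting_kernel[OF ks that])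
  qed (use assms in auto)
  have "{J4, J3, J2, J1} = {J1, J2, J3, J4}" by auto
  with sp show ?thesis by (intro decouplable[of S Q]) auto
qed

end
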